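(* In the setting described in the context, let $I$ be an open interval of $\mathbb T$ and $\theta\in I$. Then, for every $A>0$, $\mathfrak m\in I$ and $\eta>0$ such that $(\mathfrak m-\eta,\mathfrak m+\eta)\subset I$, $$\mathbb P^\epsilon_\theta\big[H_{I^c}\le A\big]\ \le\ \sup_{\mathfrak m-\eta\le\theta'\le\mathfrak m+\eta}\mathbb P^\epsilon_\theta\big[H_{I^c}<H_{\theta'}\big]\;+\;\frac{2\,e\,A}{\mu_\epsilon(\mathfrak m-\eta,\mathfrak m+\eta)}\ \mathrm{cap}_{\gamma,\epsilon}\big[(I^c,1),(\mathbb T,-1)\big],$$ where $\gamma=A^{-1}$.
   Context: $\mathbb T=[0,1)$ is the one-dimensional torus; functions on $\mathbb T$ are identified with $1$-periodic functions on $\mathbb R$. $b:\mathbb T\to\mathbb R$ is continuous and: (i) $\{b=0\}$ has finitely many connected components $[l_j,r_j]$, $1\le j\le p$, $0<l_1\le r_1<l_2\le\dots<l_p\le r_p<1$ (possibly $l_j=r_j$); (ii) $b$ is of class $C^2$ on the complement of $\cup_j[l_j,r_j]$; (iii) if $(c,d)$ is a connected component of that complement, the one-sided derivatives satisfy $b'(c+)\ne0$, $b'(d-)\neq0$. Moreover $\int_{\mathbb T}b>0$. Let $S(x)=-\int_0^xb(y)dy$, $\pi_\epsilon(x)=\int_x^{x+1}e^{[S(y)-S(x)]/\epsilon}dy$, $m_\epsilon=\pi_\epsilon/\int_0^1\pi_\epsilon$, $\mu_\epsilon(d\theta)=m_\epsilon(\theta)d\theta$, and let the constant $H$ be $\max_{0\le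 x<1}\{\max_{y\ge x}S(y)-S(x)\}$. $\widehat X_\epsilon$ is the diffusion on $\mathbb T$ with generator $\widehat L_\epsilon f=e^{H/\epsilon}(bf'+\epsilon f'')$ (its stationary measure is $\mu_\epsilon$) and $\mathbb P^\epsilon_\theta$ its law starting from $\theta$. $H_{\mathscr A}$ denotes the hitting time of a set $\mathscr A$, and $H_{\theta'}$ that of the point $\theta'$. For $\gamma>0$, the enlarged process on $\mathbb T_2=\mathbb T\times\{-1,1\}$ is the Markov process with generator $(L^\gamma_\epsilon f)(\theta,\sigma)=(\widehat L_\epsilon f)(\theta,\sigma)+\gamma[f(\theta,-\sigma)-f(\theta,\sigma)]$ (derivatives acting on the first coordinate): the first coordinate evolves as $\widehat X_\epsilon$, and the second, independently, flips sign at rate $\gamma$. $\mathbb P^{\gamma,\epsilon}_{(\theta,\sigma)}$ is its law starting from $(\theta,\sigma)$. With $(I^c,1)=\{(\theta,1):\theta\in I^c\}$ and $(\mathbb T,-1)=\{(\theta,-1):\theta\in\mathbb T\}$, let $h_I(\theta)=\mathbb P^{\gamma,\epsilon}_{(\theta,1)}[H_{(I^c,1)}\le H_{(\mathbb T,-1)}]$ and $$\mathrm{cap}_{\gamma,\epsilon}[(I^c,1),(\mathbb T,-1)]=\frac12\,\epsilon\,e^{H/\epsilon}\int_I(\partial_\theta h_I(\theta))^2\mu_\epsilon(d\theta)+\frac\gamma2\int_Ih_I(\theta)^2\mu_\epsilon(d\theta).$$ *)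

theory Defs
  imports "HOL-Probability.Probability"
begin

section \<open>The torus and the drift\<close>

text \<open>The torus is the set \<open>[0, 1)\<close>; a function on it is represented by its 1-periodic extension to
  the reals, a point \<open>x\<close> of the real line is projected to \<open>frac x\<close>, and an open interval
  of the torus is the projection of an open interval of the line (so that it may wrap around 0; the
  case of length greater than 1, which gives the whole torus, is not excluded). The Borel
  sets of the quotient topology are the Borel sets of \<open>[0, 1)\<close>.\<close>

definition torus :: "real set"
  where "torus = {0..<1}"

definition torus_borel :: "real measure"
  where "torus_borel = restrict_space borel torus"

definition open_interval_torus :: "real set \<Rightarrow> bool"
  where "open_interval_torus I \<longleftrightarrow> (\<exists>c d. c < d \<and> I = frac ` {c<..<d})"

definition periodic1 :: "(real \<Rightarrow> real) \<Rightarrow> bool"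
  where "periodic1 f \<longleftrightarrow> (\<forall>x. f (x + 1) = f x)"

definition C2_on_open :: "real set \<Rightarrow> (real \<Rightarrow> real) \<Rightarrow> bool"
  where "C2_on_open U f \<longleftrightarrow>
    open U \<and>
    (\<exists>f' f''. (\<forall>x\<in>U. (f has_real_derivative f' x) (at x)) \<and>
              (\<forall>x\<in>U. (f' has_real_derivative f'' x) (at x)) \<and>
              continuous_on U f'')"

text \<open>Since \<open>0 < l 1\<close>, the zero set of \<open>b\<close> avoids the point 0 of the torus, hence its components in the
  torus are its components in \<open>[0, 1)\<close>. The components of the complement are taken on the line; a
  component on the torus that contains 0 appears there as \<open>(r p - 1, l 1)\<close> and its translates.
  The case \<open>p = 0\<close> (no zero) is allowed. Only the existence of nonzero one-sided derivatives
  at the end-points is required, not that they are limits of \<open>b'\<close>.\<close>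

definition admissible_drift :: "(real \<Rightarrow> real) \<Rightarrow> bool"
  where "admissible_drift b \<longleftrightarrow>
    periodic1 b \<and> continuous_on UNIV b \<and>
    (\<exists>(p::nat) (l::nat \<Rightarrow> real) (r::nat \<Rightarrow> real).
        (\<forall>j\<in>{1..p}. 0 < l j \<and> l j \<le> r j \<and> r j < 1) \<and>
        (\<forall>j\<in>{1..<p}. r j < l (Suc j)) \<and>
        components {x \<in> torus. b x = 0} = (\<lambda>j. {l j..r j}) ` {1..p}) \<and>
    C2_on_open {x. b x \<noteq> 0} b \<and>
    (\<forall>c d. c < d \<and> {c<..<d} \<in> components {x. b x \<noteq> 0} \<longrightarrow>
        (\<exists>D. D \<noteq> 0 \<and> (b has_real_derivative D) (at_right c)) \<and>
        (\<exists>D. D \<noteq> 0 \<and> (b has_real_derivative D) (at_left d))) \<and>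
    0 < (LBINT x=0..1. b x)"

section \<open>The potential and the stationary measure\<close>

definition potential :: "(real \<Rightarrow> real) \<Rightarrow> real \<Rightarrow> real"
  where "potential b x = - (LBINT y=0..x. b y)"

definition pi_eps :: "(real \<Rightarrow> real) \<Rightarrow> real \<Rightarrow> real \<Rightarrow> real"
  where "pi_eps b \<epsilon> x = (LBINT y=x..x + 1. exp ((potential b y - potential b x) / \<epsilon>))"

definition m_eps :: "(real \<Rightarrow> real) \<Rightarrow> real \<Rightarrow> real \<Rightarrow> real"
  where "m_eps b \<epsilon> x = pi_eps b \<epsilon> x / (LBINT y=0..1. pi_eps b \<epsilon> y)"

definition mu_eps :: "(real \<Rightarrow> real) \<Rightarrow> real \<Rightarrow> real measure"
  where "mu_eps b \<epsilon> = density (restrict_space lborel torus) (\<lambda>x. ennreal (m_eps b \<epsilon> x))"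

text \<open>Both suprema are maxima: \<open>potential b (y + 1) = potential b y - (LBINT x=0..1. b x)\<close> is less
  than \<open>potential b y\<close>.\<close>

definition barrier :: "(real \<Rightarrow> real) \<Rightarrow> real"
  where "barrier b = (SUP x\<in>torus. (SUP y\<in>{x..}. potential b y) - potential b x)"

section \<open>Markov processes with a given generator\<close>

definition natural_filtration ::
  "'w measure \<Rightarrow> 'x measure \<Rightarrow> (real \<Rightarrow> 'w \<Rightarrow> 'x) \<Rightarrow> real \<Rightarrow> 'w measure"
  where "natural_filtration \<Omega> E X s =
    sigma (space \<Omega>) {X u -` B \<inter> space \<Omega> | u B. 0 \<le> u \<and> u \<le> s \<and> B \<in> sets E}"

text \<open>A time-homogeneous Markov process \<open>(X t)\<close>, \<open>t \<ge> 0\<close>, with state space \<open>E\<close>, given by the family of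
  its laws \<open>P x\<close> on a common measurable space \<open>\<Omega>\<close>, one for each starting point \<open>x\<close>.\<close>

definition markov_process ::
  "'x measure \<Rightarrow> 'w measure \<Rightarrow> ('x \<Rightarrow> 'w measure) \<Rightarrow> (real \<Rightarrow> 'w \<Rightarrow> 'x) \<Rightarrow> bool"
  where "markov_process E \<Omega> P X \<longleftrightarrow>
    P \<in> E \<rightarrow>\<^sub>M prob_algebra \<Omega> \<and>
    (\<forall>t\<ge>0. X t \<in> \<Omega> \<rightarrow>\<^sub>M E) \<and>
    (\<forall>x\<in>space E. AE \<omega> in P x. X 0 \<omega> = x) \<and>
    (\<forall>x\<in>space E. \<forall>s\<ge>0. \<forall>t\<ge>0. \<forall>B\<in>sets E.
        AE \<omega> in P x.
          real_cond_exp (P x) (natural_filtration \<Omega> E X s)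
            (\<lambda>\<omega>. indicator B (X (s + t) \<omega>)) \<omega>
          = measure (P (X s \<omega>)) {\<omega>'\<in>space \<Omega>. X t \<omega>' \<in> B})"

text \<open>On the set \<open>D\<close> of functions, the infinitesimal generator of the semigroup
  \<open>f \<mapsto> (\<lambda>x. \<integral>\<omega>. f (X t \<omega>) \<partial>P x)\<close> exists in the sup norm and equals \<open>L\<close>.\<close>

definition has_generator_on ::
  "('x \<Rightarrow> real) set \<Rightarrow> 'x measure \<Rightarrow> ('x \<Rightarrow> 'w measure) \<Rightarrow> (real \<Rightarrow> 'w \<Rightarrow> 'x) \<Rightarrow>
   (('x \<Rightarrow> real) \<Rightarrow> 'x \<Rightarrow> real) \<Rightarrow> bool"
  where "has_generator_on D E P X L \<longleftrightarrow>
    (\<forall>f\<in>D. uniform_limit (space E) (\<lambda>t x. ((\<integral>\<omega>. f (X t \<omega>) \<partial>P x) - f x) / t) (L f) (at_right 0))"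

definition hitting_time :: "(real \<Rightarrow> 'w \<Rightarrow> 'x) \<Rightarrow> 'x set \<Rightarrow> 'w \<Rightarrow> ereal"
  where "hitting_time X A \<omega> = Inf {ereal t | t. 0 \<le> t \<and> X t \<omega> \<in> A}"

section \<open>The diffusion on the torus\<close>

definition gen_torus :: "(real \<Rightarrow> real) \<Rightarrow> real \<Rightarrow> (real \<Rightarrow> real) \<Rightarrow> real \<Rightarrow> real"
  where "gen_torus b \<epsilon> f x = exp (barrier b / \<epsilon>) * (b x * deriv f x + \<epsilon> * deriv (deriv f) x)"

definition C2_torus :: "(real \<Rightarrow> real) set"
  where "C2_torus = {f. periodic1 f \<and> C2_on_open UNIV f}"

text \<open>A path in \<open>[0, 1)\<close> is continuous for the topology of the torus iff its image under
  \<open>x \<mapsto> exp (2 \<pi> i x)\<close> is continuous.\<close>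

definition torus_diffusion ::
  "(real \<Rightarrow> real) \<Rightarrow> real \<Rightarrow> 'w measure \<Rightarrow> (real \<Rightarrow> 'w measure) \<Rightarrow> (real \<Rightarrow> 'w \<Rightarrow> real) \<Rightarrow> bool"
  where "torus_diffusion b \<epsilon> \<Omega> P X \<longleftrightarrow>
    markov_process torus_borel \<Omega> P X \<and>
    (\<forall>\<omega>\<in>space \<Omega>. continuous_on {0..} (\<lambda>t. cis (2 * pi * X t \<omega>))) \<and>
    has_generator_on C2_torus torus_borel P X (gen_torus b \<epsilon>)"

section \<open>The enlarged process\<close>

definition torus2_borel :: "(real \<times> int) measure"
  where "torus2_borel = torus_borel \<Otimes>\<^sub>M count_space {-1, 1}"

definition gen_enlarged ::
  "(real \<Rightarrow> real) \<Rightarrow> real \<Rightarrow> real \<Rightarrow> (real \<times> int \<Rightarrow> real) \<Rightarrow> real \<times> int \<Rightarrow> real"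
  where "gen_enlarged b \<epsilon> \<gamma> f = (\<lambda>(x, \<sigma>).
    gen_torus b \<epsilon> (\<lambda>y. f (y, \<sigma>)) x + \<gamma> * (f (x, - \<sigma>) - f (x, \<sigma>)))"

definition C2_torus2 :: "(real \<times> int \<Rightarrow> real) set"
  where "C2_torus2 = {f. \<forall>\<sigma>\<in>{-1, 1}. (\<lambda>x. f (x, \<sigma>)) \<in> C2_torus}"

text \<open>The paths have a continuous first coordinate, and a second coordinate that is
  right-continuous with left limits for the discrete topology. The generator determines the law:
  the first coordinate is the diffusion on the torus, the second flips sign at rate
  \<open>\<gamma>\<close> independently of the first.\<close>

definition enlarged_process ::
  "(real \<Rightarrow> real) \<Rightarrow> real \<Rightarrow> real \<Rightarrow> 'v measure \<Rightarrow> (real \<times> int \<Rightarrow> 'v measure) \<Rightarrow>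
   (real \<Rightarrow> 'v \<Rightarrow> real \<times> int) \<Rightarrow> bool"
  where "enlarged_process b \<epsilon> \<gamma> \<Omega> Q Y \<longleftrightarrow>
    markov_process torus2_borel \<Omega> Q Y \<and>
    (\<forall>\<omega>\<in>space \<Omega>. continuous_on {0..} (\<lambda>t. cis (2 * pi * fst (Y t \<omega>)))) \<and>
    (\<forall>\<omega>\<in>space \<Omega>. \<forall>t\<ge>0. continuous (at_right t) (\<lambda>s. snd (Y s \<omega>))) \<and>
    (\<forall>\<omega>\<in>space \<Omega>. \<forall>t>0. \<exists>l. ((\<lambda>s. snd (Y s \<omega>)) \<longlongrightarrow> l) (at_left t)) \<and>
    has_generator_on C2_torus2 torus2_borel Q Y (gen_enlarged b \<epsilon> \<gamma>)"

text \<open>The function \<open>h\<^sub>I\<close>, extended 1-periodically to the line.\<close>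

definition equilibrium ::
  "'v measure \<Rightarrow> (real \<times> int \<Rightarrow> 'v measure) \<Rightarrow> (real \<Rightarrow> 'v \<Rightarrow> real \<times> int) \<Rightarrow> real set \<Rightarrow> real \<Rightarrow> real"
  where "equilibrium \<Omega> Q Y I x =
    measure (Q (frac x, 1))
      {\<omega>\<in>space \<Omega>. hitting_time Y ((torus - I) \<times> {1}) \<omega> \<le> hitting_time Y (torus \<times> {-1}) \<omega>}"

definition capacity ::
  "(real \<Rightarrow> real) \<Rightarrow> real \<Rightarrow> real \<Rightarrow> 'v measure \<Rightarrow> (real \<times> int \<Rightarrow> 'v measure) \<Rightarrow>
   (real \<Rightarrow> 'v \<Rightarrow> real \<times> int) \<Rightarrow> real set \<Rightarrow> real"
  where "capacity b \<epsilon> \<gamma> \<Omega> Q Y I =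
    1 / 2 * \<epsilon> * exp (barrier b / \<epsilon>) *
      (LINT x:I|mu_eps b \<epsilon>. (deriv (equilibrium \<Omega> Q Y I) x)\<^sup>2) +
    \<gamma> / 2 * (LINT x:I|mu_eps b \<epsilon>. (equilibrium \<Omega> Q Y I x)\<^sup>2)"

end

theory Submission
  imports Defs
begin

text \<open>
  Write \<open>K = e\<^sup>H\<^sup>/\<^sup>\<epsilon>\<close> and \<open>\<gamma> = 1 / A\<close>, let \<open>\<tau>\<close> be the exit time of \<open>X\<close> from \<open>I\<close>, and let \<open>I\<close> be the
  projection of \<open>(c, d)\<close>. If \<open>I\<close> is the whole torus then it is never left and there is nothing to
  prove. Otherwise everything is governed by one function \<open>g\<close>: the solution of
  \<open>K (b g' + \<epsilon> g'') = \<gamma> g\<close> on \<open>(c, d)\<close> with \<open>g = 1\<close> at the end-points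
  (\<open>linear_boundary_value_problem\<close>). It is read in three ways.

  For the diffusion, \<open>e\<^sup>-\<^sup>\<gamma>\<^sup>t g (X t)\<close> keeps its expectation when it is stopped on leaving an open subset of
  \<open>I\<close>. Stop it once at \<open>\<tau> \<and> A\<close>, and once at \<open>\<sigma> \<and> A\<close>, where \<open>\<sigma>\<close> is the first time at
  which the path leaves \<open>I\<close> or hits a given point \<open>z\<close> of \<open>I\<close>. Both expectations are \<open>g \<theta>\<close>. The two values agree unless \<open>\<sigma> < \<tau> \<and> A\<close>; then the second
  one is at most \<open>g z\<close>, and the first one is at least \<open>e\<^sup>-\<^sup>1\<close> if \<open>\<tau> \<le> A\<close>, because \<open>g = 1\<close> on the boundary and
  \<open>\<gamma> A = 1\<close>. Hence the probability of hitting \<open>z\<close> and then leaving \<open>I\<close> before time \<open>A\<close> is at most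
  \<open>e g z\<close> (\<open>hitting_comparison\<close>). So the left-hand side minus the supremum is at most \<open>e g z\<close>, for every \<open>z\<close> in the window around \<open>\<mm>\<close>.

  For the enlarged process, \<open>g\<close> on the upper copy of the torus and \<open>0\<close> on the lower copy is harmonic in
  \<open>I \<times> {1}\<close> and has boundary values 1 and 0, so that \<open>g\<close> is the equilibrium function
  (\<open>equilibrium_eq\<close>). In particular \<open>g \<ge> 0\<close>.

  For the stationary measure, whose density \<open>m\<close> satisfies \<open>\<epsilon> m' = b m - J\<close> with a constant current
  \<open>J\<close>, the differential equation yields the energy identity: twice the capacity is
  \<open>\<gamma>\<close> times the integral of \<open>g\<close>, and not merely of \<open>g\<^sup>2\<close>, over \<open>I\<close> (\<open>energy_identity\<close>). The current
  does not contribute, because \<open>g\<close> takes the same value at both end-points. Integrating the bound of the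
  first reading over the window with respect to the stationary measure now gives the estimate.

  The processes are known only through the Markov property and the limit defining the generator on
  \<open>C\<^sup>2\<close> functions. Optional stopping is therefore derived from these alone
  (\<open>expectation_at_exit\<close>): the process is observed on a grid of times, the Markov property evaluates each
  increment before the exit, and the uniform convergence to the generator makes their sum small. As
  \<open>g\<close> is in general not the restriction of a \<open>C\<^sup>2\<close> function on the torus, it is cut off near the
  end-points of the arc, and the arc is exhausted from inside.
\<close>

section \<open>A linear boundary value problem\<close>

text \<open>Controls one step of the Picard iteration below. The bound is in terms of a monotone majorant
  \<open>B\<close> of \<open>f\<close>, so that the inner integral costs only a constant and the outer one gains a power of
  \<open>x - c\<close> at each step.\<close>

lemma nested_integral_bound:
  fixes a f :: "real \<Rightarrow> real"
  assumes "continuous_on {c..d} a" "\<And>x. x \<in> {c..d} \<Longrightarrow> lo \<le> a x \<and> a x \<le> hi" "0 < lo"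
    and "continuous_on {c..d} f" "x \<in> {c..d}" "\<And>t. t \<in> {c..d} \<Longrightarrow> \<bar>f t\<bar> \<le> B t"
    and "mono_on {c..d} B" "continuous_on {c..d} B"
  shows "\<bar>integral {c..x} (\<lambda>s. integral {c..s} (\<lambda>t. a t * f t) / a s)\<bar> \<le> (hi / lo * (d - c)) * integral {c..x} B"
proof -
  have cd: "c \<le> d" using assms(5) by auto
  have hi: "0 < hi" using assms(2)[of c] assms(3) cd by auto
  have apos: "a t > 0" if "t \<in> {c..d}" for t using assms(2)[OF that] assms(3) by auto
  have caf: "continuous_on {c..d} (\<lambda>t. a t * f t)" by (intro continuous_intros assms)
  have inner: "\<bar>integral {c..s} (\<lambda>t. a t * f t)\<bar> \<le> hi * B s * (d - c)" if s: "s \<in> {c..d}" for s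
  proof -
    have B0: "0 \<le> B s" using assms(6)[OF s] by linarith
    have "norm (integral {c..s} (\<lambda>t. a t * f t)) \<le> (hi * B s) * (s - c)"
    proof (rule integral_bound)
      show "c \<le> s" using s by auto
      show "continuous_on {c..s} (\<lambda>t. a t * f t)" using caf by (rule continuous_on_subset) (use s in auto)
      fix t assume t: "t \<in> {c..s}"
      then have td: "t \<in> {c..d}" using s by auto
      have "B t \<le> B s" using assms(7) t td s by (auto simp: mono_on_def)
      then have "\<bar>f t\<bar> \<le> B s" using assms(6)[OF td] by linarith
      then show "norm (a t * f t) \<le> hi * B s"
        using assms(2)[OF td] apos[OF td] hi by (auto simp: abs_mult intro!: mult_mono)
    qed
    also have "\<dots> \<le> (hi * B s) * (d - c)" using s hi B0 by (intro mult_left_mono) auto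
    finally show ?thesis by simp
  qed
  have cint: "continuous_on {c..d} (\<lambda>s. integral {c..s} (\<lambda>t. a t * f t))"
    by (rule indefinite_integral_continuous_1) (rule integrable_continuous_interval[OF caf])
  have cout: "continuous_on {c..d} (\<lambda>s. integral {c..s} (\<lambda>t. a t * f t) / a s)"
    using apos by (intro continuous_intros cint assms) (force)
  have sub: "{c..x} \<subseteq> {c..d}" using assms(5) by auto
  have "norm (integral {c..x} (\<lambda>s. integral {c..s} (\<lambda>t. a t * f t) / a s))
      \<le> integral {c..x} (\<lambda>s. (hi / lo * (d - c)) * B s)"
  proof (rule integral_norm_bound_integral)
    show "(\<lambda>s. integral {c..s} (\<lambda>t. a t * f t) / a s) integrable_on {c..x}"
      by (rule integrable_continuous_interval) (rule continuous_on_subset[OF cout sub])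
    show "(\<lambda>s. hi / lo * (d - c) * B s) integrable_on {c..x}"
      by (rule integrable_continuous_interval) (intro continuous_intros continuous_on_subset[OF assms(8) sub])
    fix s assume "s \<in> {c..x}"
    then have s: "s \<in> {c..d}" using sub by auto
    have "norm (integral {c..s} (\<lambda>t. a t * f t) / a s) \<le> (hi * B s * (d - c)) / lo"
      using inner[OF s] assms(2)[OF s] apos[OF s] assms(3) by (auto simp: abs_divide intro!: frac_le)
    then show "norm (integral {c..s} (\<lambda>t. a t * f t) / a s) \<le> hi / lo * (d - c) * B s"
      by (simp add: field_simps)
  qed
  then show ?thesis by simp
qed

text \<open>The solution is the sum of the Picard iterates of \<open>f0\<close>. The iterates are nonnegative, which gives
  the lower bound, and the \<open>n\<close>-th one is at most \<open>C (M (x - c))\<^sup>n / n!\<close>, so that the series converges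
  uniformly.\<close>

lemma volterra_solution:
  fixes a f0 :: "real \<Rightarrow> real"
  assumes cd: "c < d" and ca: "continuous_on {c..d} a" and apos: "\<And>x. x \<in> {c..d} \<Longrightarrow> 0 < a x"
    and q: "0 \<le> q" and cf0: "continuous_on {c..d} f0" and f0: "\<And>x. x \<in> {c..d} \<Longrightarrow> 0 \<le> f0 x"
  obtains f where "continuous_on {c..d} f" "\<And>x. x \<in> {c..d} \<Longrightarrow> f0 x \<le> f x"
    "\<And>x. x \<in> {c..d} \<Longrightarrow> f x = f0 x + q * integral {c..x} (\<lambda>s. integral {c..s} (\<lambda>t. a t * f t) / a s)"
proof -
  define T where "T f = (\<lambda>x. q * integral {c..x} (\<lambda>s. integral {c..s} (\<lambda>t. a t * f t) / a s))"
    for f :: "real \<Rightarrow> real"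
  have compact: "compact {c..d}" by simp
  obtain lo where lo: "0 < lo" "\<And>x. x \<in> {c..d} \<Longrightarrow> lo \<le> a x"
  proof -
    obtain x where "x \<in> {c..d}" "\<And>y. y \<in> {c..d} \<Longrightarrow> a x \<le> a y"
      using continuous_attains_inf[OF compact _ ca] cd by auto
    then show ?thesis using apos that by blast
  qed
  obtain hi where hi: "\<And>x. x \<in> {c..d} \<Longrightarrow> a x \<le> hi"
    using continuous_attains_sup[OF compact _ ca] cd by (metis atLeastatMost_empty_iff2 less_le_not_le)
  obtain C where C: "\<And>x. x \<in> {c..d} \<Longrightarrow> f0 x \<le> C"
    using continuous_attains_sup[OF compact _ cf0] cd by (metis atLeastatMost_empty_iff2 less_le_not_le)
  have C0: "0 \<le> C" using C[of c] f0[of c] cd by auto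
  have hi0: "0 < hi" using hi[of c] apos[of c] cd by auto
  have cinner: "continuous_on {c..d} (\<lambda>s. integral {c..s} (\<lambda>t. a t * f t) / a s)"
    if "continuous_on {c..d} f" for f
  proof -
    have "continuous_on {c..d} (\<lambda>s. integral {c..s} (\<lambda>t. a t * f t))"
      by (rule indefinite_integral_continuous_1) (intro integrable_continuous_interval continuous_intros ca that)
    then show ?thesis using apos by (intro continuous_intros ca) force+
  qed
  have cT: "continuous_on {c..d} (T f)" if "continuous_on {c..d} f" for f
    unfolding T_def
    by (intro continuous_intros indefinite_integral_continuous_1 integrable_continuous_interval cinner that)
  have Tdiff: "T f x - T g x = T (\<lambda>x. f x - g x) x"
    if cf: "continuous_on {c..d} f" and cg: "continuous_on {c..d} g" and x: "x \<in> {c..d}" for f g x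
  proof -
    have 1: "integral {c..s} (\<lambda>t. a t * (f t - g t)) / a s =
        integral {c..s} (\<lambda>t. a t * f t) / a s - integral {c..s} (\<lambda>t. a t * g t) / a s"
      if "s \<in> {c..x}" for s
    proof -
      have s: "{c..s} \<subseteq> {c..d}" using that x by auto
      have "integral {c..s} (\<lambda>t. a t * f t - a t * g t)
          = integral {c..s} (\<lambda>t. a t * f t) - integral {c..s} (\<lambda>t. a t * g t)"
        by (intro integral_diff integrable_continuous_interval continuous_intros continuous_on_subset[OF _ s] ca cf cg)
      then show ?thesis by (simp add: right_diff_distrib diff_divide_distrib)
    qed
    have sub: "{c..x} \<subseteq> {c..d}" using x by auto
    have "integral {c..x} (\<lambda>s. integral {c..s} (\<lambda>t. a t * (f t - g t)) / a s) =
      integral {c..x} (\<lambda>s. integral {c..s} (\<lambda>t. a t * f t) / a s - integral {c..s} (\<lambda>t. a t * g t) / a s)"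
      by (intro integral_cong 1)
    also have "\<dots> = integral {c..x} (\<lambda>s. integral {c..s} (\<lambda>t. a t * f t) / a s)
        - integral {c..x} (\<lambda>s. integral {c..s} (\<lambda>t. a t * g t) / a s)"
      by (intro integral_diff integrable_continuous_interval continuous_on_subset[OF _ sub] cinner cf cg)
    finally show ?thesis by (simp add: T_def right_diff_distrib)
  qed
  have Tbound: "\<bar>T f x\<bar> \<le> q * (hi / lo * (d - c)) * integral {c..x} B"
    if cf: "continuous_on {c..d} f" and x: "x \<in> {c..d}" and B: "\<And>t. t \<in> {c..d} \<Longrightarrow> \<bar>f t\<bar> \<le> B t"
     "mono_on {c..d} B" "continuous_on {c..d} B" for f x B
  proof -
    have "\<bar>integral {c..x} (\<lambda>s. integral {c..s} (\<lambda>t. a t * f t) / a s)\<bar> \<le> (hi / lo * (d - c)) * integral {c..x} B"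
      by (rule nested_integral_bound[OF ca _ lo(1) cf x]) (use lo(2) hi B in auto)
    from mult_left_mono[OF this q] show ?thesis by (simp add: T_def abs_mult q mult.assoc)
  qed
  define M where "M = q * (hi / lo * (d - c))"
  have M0: "0 \<le> M" using q hi0 lo(1) cd by (simp add: M_def)
  define F where "F n = (T ^^ n) f0" for n
  have F_0: "F 0 = f0" and F_Suc: "F (Suc n) = T (F n)" for n by (simp_all add: F_def)
  have cF: "continuous_on {c..d} (F n)" for n
    by (induction n) (auto simp: F_0 F_Suc cf0 cT)
  have Fnonneg: "0 \<le> F n x" if "x \<in> {c..d}" for n x
    using that
  proof (induction n arbitrary: x)
    case (Suc n)
    have "0 \<le> integral {c..x} (\<lambda>s. integral {c..s} (\<lambda>t. a t * F n t) / a s)"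
    proof (intro integral_nonneg integrable_continuous_interval continuous_on_subset[OF cinner[OF cF]])
      fix s assume s: "s \<in> {c..x}"
      have "0 \<le> integral {c..s} (\<lambda>t. a t * F n t)"
        using s Suc.prems
        by (intro integral_nonneg integrable_continuous_interval continuous_intros
              continuous_on_subset[OF ca] continuous_on_subset[OF cF] mult_nonneg_nonneg
              Suc.IH less_imp_le[OF apos]) auto
      then show "0 \<le> integral {c..s} (\<lambda>t. a t * F n t) / a s"
        using apos[of s] s Suc.prems by simp
    qed (use Suc.prems in auto)
    then show ?case by (simp add: F_Suc T_def q)
  qed (simp add: F_0 f0)
  have Fbound: "\<bar>F n x\<bar> \<le> C * (M * (x - c)) ^ n / fact n" if "x \<in> {c..d}" for n x
    using that
  proof (induction n arbitrary: x)
    case (Suc n)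
    have hi: "((\<lambda>s. C * (M * (s - c)) ^ n / fact n) has_integral
        C * M ^ n / fact (Suc n) * (x - c) ^ Suc n - C * M ^ n / fact (Suc n) * (c - c) ^ Suc n) {c..x}"
    proof (rule fundamental_theorem_of_calculus)
      show "c \<le> x" using Suc.prems by auto
      fix s assume "s \<in> {c..x}"
      have "((\<lambda>s. C * M ^ n / fact (Suc n) * (s - c) ^ Suc n) has_real_derivative
          C * M ^ n / fact (Suc n) * (real (Suc n) * (s - c) ^ n)) (at s within {c..x})"
        by (auto intro!: derivative_eq_intros simp del: fact_Suc power_Suc of_nat_Suc)
      also have "C * M ^ n / fact (Suc n) * (real (Suc n) * (s - c) ^ n) = C * (M * (s - c)) ^ n / fact n"
        by (simp add: power_mult_distrib divide_simps del: of_nat_Suc)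
      finally show "((\<lambda>s. C * M ^ n / fact (Suc n) * (s - c) ^ Suc n) has_vector_derivative
          C * (M * (s - c)) ^ n / fact n) (at s within {c..x})"
        by (simp add: has_real_derivative_iff_has_vector_derivative)
    qed
    have "\<bar>F (Suc n) x\<bar> \<le> M * integral {c..x} (\<lambda>s. C * (M * (s - c)) ^ n / fact n)"
      unfolding F_Suc M_def
    proof (rule Tbound[OF cF Suc.prems], unfold M_def[symmetric])
      show "mono_on {c..d} (\<lambda>s. C * (M * (s - c)) ^ n / fact n)"
        using C0 M0 by (auto simp: mono_on_def intro!: divide_right_mono mult_left_mono power_mono)
    qed (auto intro!: Suc.IH continuous_intros)
    also have "\<dots> = C * (M * (x - c)) ^ Suc n / fact (Suc n)"
      using integral_unique[OF hi] by (simp add: power_mult_distrib)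
    finally show ?case .
  qed (use C f0 in \<open>auto simp: F_0\<close>)
  define N where "N n = C * ((M * (d - c)) ^ n / fact n)" for n :: nat
  have sumN: "summable N"
    unfolding N_def using summable_exp[of "M * (d - c)"] by (intro summable_mult) (simp add: field_simps)
  have FN: "norm (F n x) \<le> N n" if "x \<in> {c..d}" for n x
  proof -
    have "C * (M * (x - c)) ^ n / fact n \<le> N n"
      unfolding N_def times_divide_eq_right using C0 M0 that
      by (intro divide_right_mono mult_left_mono power_mono) auto
    then show ?thesis using Fbound[OF that, of n] by simp
  qed
  define f where "f x = (\<Sum>n. F n x)" for x
  have ul: "uniform_limit {c..d} (\<lambda>n x. \<Sum>i<n. F i x) f sequentially"
    unfolding f_def by (rule Weierstrass_m_test[OF FN sumN])
  have csum: "continuous_on {c..d} (\<lambda>x. \<Sum>i<n. F i x)" for n by (intro continuous_intros cF)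
  have cf: "continuous_on {c..d} f"
    by (rule uniform_limit_theorem[OF _ ul]) (intro always_eventually allI csum, simp)
  have sumF: "summable (\<lambda>n. F n x)" if "x \<in> {c..d}" for x
    by (rule summable_comparison_test'[OF sumN FN[OF that]])
  have ge: "f0 x \<le> f x" if "x \<in> {c..d}" for x
    using sum_le_suminf[OF sumF[OF that], of "{0}"] Fnonneg[OF that] by (simp add: f_def F_0)
  have Tsum: "(\<Sum>i<Suc n. F i x) = f0 x + T (\<lambda>x. \<Sum>i<n. F i x) x" if x: "x \<in> {c..d}" for n x
  proof (induction n)
    case (Suc n)
    have "T (\<lambda>x. \<Sum>i<Suc n. F i x) x - T (\<lambda>x. \<Sum>i<n. F i x) x = T (F n) x"
      by (subst Tdiff[OF csum csum x]) simp
    then show ?case using Suc by (simp add: F_Suc)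
  qed (simp add: F_0 T_def)
  have eq: "f x = f0 x + T f x" if x: "x \<in> {c..d}" for x
  proof -
    have lim1: "(\<lambda>n. \<Sum>i<Suc n. F i x) \<longlonglongrightarrow> f x"
      using LIMSEQ_Suc[OF tendsto_uniform_limitI[OF ul x]] .
    have "(\<lambda>n. T (\<lambda>x. \<Sum>i<n. F i x) x) \<longlonglongrightarrow> T f x"
    proof (rule LIMSEQ_I)
      fix r :: real assume r: "0 < r"
      define e where "e = r / (M * (d - c) + 1)"
      have den: "0 < M * (d - c) + 1" using M0 cd by (simp add: add_nonneg_pos)
      have e: "0 < e" unfolding e_def using r den by simp
      obtain n0 where n0: "\<And>n y. n \<ge> n0 \<Longrightarrow> y \<in> {c..d} \<Longrightarrow> dist (\<Sum>i<n. F i y) (f y) < e"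
        using uniform_limitD[OF ul e] unfolding eventually_sequentially by blast
      have "norm (T (\<lambda>x. \<Sum>i<n. F i x) x - T f x) < r" if "n \<ge> n0" for n
      proof -
        have "\<bar>T (\<lambda>x. (\<Sum>i<n. F i x) - f x) x\<bar> \<le> M * integral {c..x} (\<lambda>_. e)"
          unfolding M_def
          using n0[OF that] by (intro Tbound x) (auto intro!: continuous_intros csum cf cF less_imp_le simp: dist_real_def mono_on_def)
        also have "\<dots> = M * (x - c) * e" using x by simp
        also have "\<dots> \<le> M * (d - c) * e" using x M0 e by (intro mult_right_mono mult_left_mono) auto
        also have "\<dots> < r"
          unfolding e_def using r den M0 cd by (simp add: field_simps)
        finally show ?thesis by (simp add: Tdiff[OF csum cf x])
      qed
      then show "\<exists>no. \<forall>n\<ge>no. norm (T (\<lambda>x. \<Sum>i<n. F i x) x - T f x) < r" by blast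
    qed
    then have "(\<lambda>n. f0 x + T (\<lambda>x. \<Sum>i<n. F i x) x) \<longlonglongrightarrow> f0 x + T f x"
      by (intro tendsto_intros)
    with lim1 show ?thesis unfolding Tsum[OF x] by (rule LIMSEQ_unique)
  qed
  show ?thesis
    by (rule that[OF cf ge]) (use eq in \<open>auto simp: T_def\<close>)
qed

text \<open>With \<open>a = exp (\<integral> \<beta>)\<close> the equation \<open>g'' = q g - \<beta> g'\<close> becomes \<open>(a g')' = q a g\<close>, whose integrated form is
  the equation of the previous lemma. One solution \<open>f1\<close> has value 1 and slope 0 at \<open>c\<close>; another one, \<open>f2\<close>,
  has value 0 there. Since \<open>q \<ge> 0\<close>, \<open>f2\<close> dominates the solution \<open>s\<close> for \<open>q = 0\<close> and
  is positive at \<open>d\<close>; so a multiple of \<open>f2\<close> can be added to \<open>f1\<close> to reach the value 1 at \<open>d\<close>.\<close>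

lemma linear_boundary_value_problem:
  fixes \<beta> :: "real \<Rightarrow> real"
  assumes cd: "c < d" and c\<beta>: "continuous_on {c..d} \<beta>" and q: "0 \<le> q"
  obtains g g' where "continuous_on {c..d} g" "continuous_on {c..d} g'" "g c = 1" "g d = 1"
    "\<And>x. x \<in> {c<..<d} \<Longrightarrow> (g has_real_derivative g' x) (at x)"
    "\<And>x. x \<in> {c<..<d} \<Longrightarrow> (g' has_real_derivative q * g x - \<beta> x * g' x) (at x)"
proof -
  define a where "a x = exp (integral {c..x} \<beta>)" for x
  have c\<beta>': "continuous_on {c..d} (\<lambda>x. integral {c..x} \<beta>)"
    by (rule indefinite_integral_continuous_1) (rule integrable_continuous_interval[OF c\<beta>])
  have ca: "continuous_on {c..d} a" unfolding a_def by (intro continuous_intros c\<beta>')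
  have apos: "0 < a x" for x by (simp add: a_def)
  define s where "s x = integral {c..x} (\<lambda>t. 1 / a t)" for x
  have cinv: "continuous_on {c..d} (\<lambda>t. 1 / a t)"
    using apos by (intro continuous_intros ca) (auto simp: less_le)
  have cs: "continuous_on {c..d} s" unfolding s_def
    by (rule indefinite_integral_continuous_1) (rule integrable_continuous_interval[OF cinv])
  have s0: "0 \<le> s x" if "x \<in> {c..d}" for x
    unfolding s_def using apos that
    by (intro integral_nonneg integrable_continuous_interval continuous_on_subset[OF cinv]) (auto intro: less_imp_le)
  have sd: "0 < s d"
  proof -
    have "s d \<noteq> 0"
    proof
      assume "s d = 0"
      then have "1 / a c = 0"
        unfolding s_def using integral_eq_0_iff[OF cinv cd] apos cd
        by (metis atLeastAtMost_iff less_eq_real_def order_refl zero_less_divide_1_iff)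
      then show False using apos[of c] by simp
    qed
    then show ?thesis using s0[of d] cd by simp
  qed
  obtain f1 where f1: "continuous_on {c..d} f1" "\<And>x. x \<in> {c..d} \<Longrightarrow> 1 \<le> f1 x"
    "\<And>x. x \<in> {c..d} \<Longrightarrow> f1 x = 1 + q * integral {c..x} (\<lambda>s. integral {c..s} (\<lambda>t. a t * f1 t) / a s)"
    by (rule volterra_solution[OF cd ca apos q, of "\<lambda>_. 1"]) auto
  obtain f2 where f2: "continuous_on {c..d} f2" "\<And>x. x \<in> {c..d} \<Longrightarrow> s x \<le> f2 x"
    "\<And>x. x \<in> {c..d} \<Longrightarrow> f2 x = s x + q * integral {c..x} (\<lambda>s. integral {c..s} (\<lambda>t. a t * f2 t) / a s)"
    by (rule volterra_solution[OF cd ca apos q cs s0]) auto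
  define k where "k = (1 - f1 d) / f2 d"
  have f2d: "0 < f2 d" using f2(2)[of d] sd cd by simp
  define g where "g x = f1 x + k * f2 x" for x
  define p1 where "p1 x = integral {c..x} (\<lambda>t. a t * f1 t)" for x
  define p2 where "p2 x = integral {c..x} (\<lambda>t. a t * f2 t)" for x
  define g' where "g' x = (k + q * (p1 x + k * p2 x)) / a x" for x
  have cp: "continuous_on {c..d} p1" "continuous_on {c..d} p2"
    unfolding p1_def p2_def
    by (intro indefinite_integral_continuous_1 integrable_continuous_interval continuous_intros ca f1 f2)+
  have anz: "a x \<noteq> 0" for x using apos[of x] by simp
  have cg: "continuous_on {c..d} g" unfolding g_def by (intro continuous_intros f1 f2)
  have cg': "continuous_on {c..d} g'" unfolding g'_def by (intro continuous_intros cp ca anz ballI)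
  have fundamental: "((\<lambda>x. integral {c..x} h) has_real_derivative h x) (at x)"
    if "continuous_on {c..d} h" "x \<in> {c<..<d}" for h :: "real \<Rightarrow> real" and x
    using integral_has_real_derivative[OF that(1), of x] that(2) at_within_Icc_at[of c x d] by auto
  have dg: "(g has_real_derivative g' x) (at x)" if x: "x \<in> {c<..<d}" for x
  proof -
    have "((\<lambda>x. (1 + q * integral {c..x} (\<lambda>s. p1 s / a s)) + k * (s x + q * integral {c..x} (\<lambda>s. p2 s / a s)))
        has_real_derivative g' x) (at x)"
      unfolding s_def g'_def
      by (rule derivative_eq_intros fundamental[OF _ x] continuous_intros cp ca cinv ballI anz refl)+
        (simp add: field_simps anz)
    moreover have "eventually (\<lambda>y. y \<in> {c<..<d}) (nhds x)"
      using x by (intro eventually_nhds_in_open) auto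
    then have "eventually (\<lambda>y. g y = (1 + q * integral {c..y} (\<lambda>s. p1 s / a s)) + k * (s y + q * integral {c..y} (\<lambda>s. p2 s / a s))) (nhds x)"
    proof eventually_elim
      case (elim y)
      then have "y \<in> {c..d}" by auto
      from f1(3)[OF this] f2(3)[OF this] show ?case
        by (simp add: g_def p1_def p2_def)
    qed
    ultimately show ?thesis by (subst DERIV_cong_ev[OF refl _ refl])
  qed
  have dg': "(g' has_real_derivative q * g x - \<beta> x * g' x) (at x)" if x: "x \<in> {c<..<d}" for x
  proof -
    have da: "(a has_real_derivative a x * \<beta> x) (at x)"
      unfolding a_def by (rule derivative_eq_intros fundamental[OF c\<beta> x] refl)+
    have dp: "(p1 has_real_derivative a x * f1 x) (at x)" "(p2 has_real_derivative a x * f2 x) (at x)"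
      unfolding p1_def p2_def by (intro fundamental x continuous_intros ca f1 f2)+
    show ?thesis
      unfolding g'_def g_def
      by (rule derivative_eq_intros da dp anz refl)+ (simp add: field_simps anz power2_eq_square)
  qed
  have "g c = 1" using f1(3)[of c] f2(3)[of c] cd by (simp add: g_def s_def)
  moreover have "g d = 1" using f2d by (simp add: g_def k_def)
  ultimately show ?thesis using that[OF cg cg' _ _ dg dg'] by blast
qed

section \<open>Periodic functions and the stationary density\<close>

lemma periodic1_int: "periodic1 f \<Longrightarrow> f (x + of_int k) = f x"
proof -
  assume f: "periodic1 f"
  have n: "f (y + real n) = f y" for y n
  proof (induction n)
    case (Suc n)
    have "f (y + real (Suc n)) = f ((y + real n) + 1)" by (simp add: algebra_simps)
    then show ?case using f Suc by (simp add: periodic1_def)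
  qed simp
  show ?thesis
  proof (cases "0 \<le> k")
    case True
    then show ?thesis using n[of x "nat k"] by simp
  next
    case False
    then show ?thesis using n[of "x + of_int k" "nat (- k)"] by simp
  qed
qed

lemma periodic1_frac: "periodic1 f \<Longrightarrow> f (frac x) = f x"
  using periodic1_int[of f x "- \<lfloor>x\<rfloor>"] by (simp add: frac_def)

lemma antiderivative_on_line:
  fixes f :: "real \<Rightarrow> real"
  assumes "continuous_on UNIV f"
  obtains F where "\<And>x. (F has_real_derivative f x) (at x)" "\<And>a b :: real. (LBINT y=a..b. f y) = F b - F a"
proof -
  have "\<exists>F. \<forall>x :: real. - \<infinity> < ereal x \<longrightarrow> ereal x < \<infinity> \<longrightarrow> (F has_vector_derivative f x) (at x)"
    by (rule einterval_antiderivative) (use assms in \<open>auto simp: continuous_on_eq_continuous_at\<close>)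
  then obtain F where F: "\<And>x. (F has_vector_derivative f x) (at x)" by auto
  have "(LBINT y=a..b. f y) = F b - F a" for a b :: real
    by (rule interval_integral_FTC_finite)
      (use F in \<open>auto intro: continuous_on_subset[OF assms] has_vector_derivative_at_within\<close>)
  with F show ?thesis by (intro that) (auto simp: has_real_derivative_iff_has_vector_derivative)
qed

text \<open>With \<open>W' = e\<^sup>S\<^sup>/\<^sup>\<epsilon>\<close>, the density is proportional to \<open>e\<^sup>-\<^sup>S\<^sup>/\<^sup>\<epsilon> (W (x + 1) - W x)\<close>. As \<open>S (x + 1) - S x\<close> does
  not depend on \<open>x\<close>, a unit shift multiplies the two factors by constants inverse to each other, which
  gives the periodicity, and in the derivative of the density the term
  \<open>e\<^sup>-\<^sup>S\<^sup>/\<^sup>\<epsilon> (W' (x + 1) - W' x)\<close> is constant. The constant \<open>J\<close> is the current of the stationary state.\<close>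

lemma stationary_density:
  assumes per: "periodic1 b" and cont: "continuous_on UNIV b" and \<epsilon>: "0 < \<epsilon>"
  obtains J where "\<And>x. (m_eps b \<epsilon> has_real_derivative (b x * m_eps b \<epsilon> x - J) / \<epsilon>) (at x)"
    "\<And>x. 0 < m_eps b \<epsilon> x" "periodic1 (m_eps b \<epsilon>)"
proof -
  obtain B where B: "\<And>x. (B has_real_derivative b x) (at x)" "\<And>a c :: real. (LBINT y=a..c. b y) = B c - B a"
    by (rule antiderivative_on_line[OF cont]) blast
  have S: "potential b x = B 0 - B x" for x
    using B(2)[of 0 x] by (simp add: potential_def zero_ereal_def)
  have dS: "(potential b has_real_derivative - b x) (at x)" for x
    unfolding S[abs_def] by (auto intro!: derivative_eq_intros B)
  define \<Delta> where "\<Delta> = B 1 - B 0"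
  have B1: "B (x + 1) = B x + \<Delta>" for x
  proof -
    have "((\<lambda>x. B (x + 1) - B x) has_real_derivative 0) (at x)" for x
    proof -
      have "((\<lambda>x. B (x + 1)) has_real_derivative b (x + 1)) (at x)" for x
        using B(1)[of "x + 1"] by (simp add: DERIV_shift)
      from DERIV_diff[OF this B(1)] show ?thesis using per by (simp add: periodic1_def)
    qed
    then have "B (x + 1) - B x = B (0 + 1) - B 0"
      by (intro DERIV_isconst_all[where f = "\<lambda>x. B (x + 1) - B x"]) simp
    then show ?thesis by (simp add: \<Delta>_def)
  qed
  have contS: "continuous_on UNIV (potential b)"
    using dS by (intro DERIV_continuous_on) (auto intro: has_field_derivative_at_within)
  have "continuous_on UNIV (\<lambda>y. exp (potential b y / \<epsilon>))"
    using \<epsilon> by (intro continuous_intros contS) auto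
  then obtain W where W: "\<And>x. (W has_real_derivative exp (potential b x / \<epsilon>)) (at x)"
    by (rule antiderivative_on_line) blast
  have pi_eq: "pi_eps b \<epsilon> x = exp (- potential b x / \<epsilon>) * (W (x + 1) - W x)" for x
  proof -
    have "((\<lambda>y. exp (- potential b x / \<epsilon>) * W y) has_vector_derivative exp ((potential b y - potential b x) / \<epsilon>)) (at y within A)" for y A
      unfolding has_real_derivative_iff_has_vector_derivative[symmetric]
      using has_field_derivative_at_within[OF DERIV_cmult[OF W[of y], of "exp (- potential b x / \<epsilon>)"], of A]
      by (simp add: exp_add[symmetric] diff_divide_distrib)
    moreover have "continuous_on UNIV (\<lambda>y. exp ((potential b y - potential b x) / \<epsilon>))"
      using \<epsilon> by (intro continuous_intros contS) auto
    ultimately have "(LBINT y=ereal x..ereal (x + 1). exp ((potential b y - potential b x) / \<epsilon>)) =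
        exp (- potential b x / \<epsilon>) * W (x + 1) - exp (- potential b x / \<epsilon>) * W x"
      by (intro interval_integral_FTC_finite) (auto intro: continuous_on_subset)
    then show ?thesis by (simp add: pi_eps_def right_diff_distrib one_ereal_def)
  qed
  have W_mono: "W x < W (x + 1)" for x
    by (rule DERIV_pos_imp_increasing[of x "x + 1"], simp, metis W exp_gt_zero)
  have pi_pos: "0 < pi_eps b \<epsilon> x" for x
    unfolding pi_eq using W_mono[of x] by simp
  define k where "k = exp (- \<Delta> / \<epsilon>) - 1"
  have d_pi: "(pi_eps b \<epsilon> has_real_derivative b x / \<epsilon> * pi_eps b \<epsilon> x + k) (at x)" for x
  proof -
    have shift: "((\<lambda>x. W (x + 1)) has_real_derivative exp (potential b (x + 1) / \<epsilon>)) (at x)"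
      using W[of "x + 1"] by (simp add: DERIV_shift)
    have factor: "exp (potential b (x + 1) / \<epsilon>) = exp (potential b x / \<epsilon>) * exp (- \<Delta> / \<epsilon>)"
      by (simp add: S B1 exp_add[symmetric] add_divide_distrib diff_divide_distrib)
    note dW = shift[unfolded factor]
    have *: "exp (- potential b x / \<epsilon>) * exp (potential b x / \<epsilon>) = 1" by (simp add: exp_add[symmetric])
    have "((\<lambda>x. exp (- potential b x / \<epsilon>) * (W (x + 1) - W x)) has_real_derivative
       b x / \<epsilon> * (exp (- potential b x / \<epsilon>) * (W (x + 1) - W x)) + (exp (- potential b x / \<epsilon>) * exp (potential b x / \<epsilon>)) * k) (at x)"
      using \<epsilon> by (auto intro!: derivative_eq_intros dS W dW simp: k_def field_simps)
    then show ?thesis unfolding pi_eq[abs_def] * by simp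
  qed
  have pi_per: "periodic1 (pi_eps b \<epsilon>)"
  proof -
    have Wd: "W (x + 2) - W (x + 1) = exp (- \<Delta> / \<epsilon>) * (W (x + 1) - W x)" for x
    proof -
      have sh: "((\<lambda>x. W (x + a)) has_real_derivative exp (potential b (x + a) / \<epsilon>)) (at x)" for x a
        using W[of "x + a"] by (simp add: DERIV_shift)
      have S1: "exp (potential b (y + 1) / \<epsilon>) = exp (potential b y / \<epsilon>) * exp (- \<Delta> / \<epsilon>)" for y
        by (simp add: S B1 exp_add[symmetric] add_divide_distrib diff_divide_distrib)
      have d: "((\<lambda>y. W (y + 1) - exp (- \<Delta> / \<epsilon>) * W y) has_real_derivative 0) (at y)" for y
        by (rule derivative_eq_intros sh W refl)+ (simp add: S1)
      have "W (x + 1 + 1) - exp (- \<Delta> / \<epsilon>) * W (x + 1) = W (x + 1) - exp (- \<Delta> / \<epsilon>) * W x"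
        by (rule DERIV_isconst_all[where f = "\<lambda>y. W (y + 1) - exp (- \<Delta> / \<epsilon>) * W y"]) (use d in simp)
      then show ?thesis by (simp add: algebra_simps)
    qed
    have "pi_eps b \<epsilon> (x + 1) = pi_eps b \<epsilon> x" for x
    proof -
      have "exp (- potential b (x + 1) / \<epsilon>) * exp (- \<Delta> / \<epsilon>) = exp (- potential b x / \<epsilon>)"
        by (simp add: S B1 exp_add[symmetric] diff_divide_distrib add_divide_distrib)
      then show ?thesis
        using Wd[of x] by (simp add: pi_eq mult.assoc[symmetric] add.assoc)
    qed
    then show ?thesis by (simp add: periodic1_def)
  qed
  define N where "N = (LBINT y=0..1. pi_eps b \<epsilon> y)"
  have N0: "0 < N"
  proof -
    have "continuous_on UNIV (pi_eps b \<epsilon>)"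
      using d_pi by (intro DERIV_continuous_on) (auto intro: has_field_derivative_at_within)
    then obtain V where V: "\<And>x. (V has_real_derivative pi_eps b \<epsilon> x) (at x)"
      "\<And>a c :: real. (LBINT y=a..c. pi_eps b \<epsilon> y) = V c - V a"
      by (rule antiderivative_on_line) blast
    have "V 0 < V 1" by (rule DERIV_pos_imp_increasing[of 0 1]) (use V(1) pi_pos in auto)
    then show ?thesis using V(2)[of 0 1] by (simp add: N_def zero_ereal_def one_ereal_def)
  qed
  have m: "m_eps b \<epsilon> = (\<lambda>x. pi_eps b \<epsilon> x / N)" by (simp add: m_eps_def N_def fun_eq_iff)
  show ?thesis
  proof (rule that[of "- \<epsilon> * k / N"])
    show "(m_eps b \<epsilon> has_real_derivative (b x * m_eps b \<epsilon> x - - \<epsilon> * k / N) / \<epsilon>) (at x)" for x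
      unfolding m using DERIV_cdivide[OF d_pi[of x], of N] \<epsilon> N0 by (simp add: field_simps)
    show "0 < m_eps b \<epsilon> x" for x using pi_pos N0 by (simp add: m)
    show "periodic1 (m_eps b \<epsilon>)" using pi_per by (simp add: m periodic1_def)
  qed
qed

section \<open>The energy identity\<close>

text \<open>The integrand of the left side minus that of the right side is the derivative of
  \<open>K \<epsilon> m g' (g - 1) + K J (g - 1)\<^sup>2 / 2\<close>, which vanishes at both end-points.\<close>

lemma energy_identity:
  fixes g g' m b :: "real \<Rightarrow> real"
  assumes cd: "c < d" and K: "0 < K" and \<epsilon>: "0 < \<epsilon>"
    and cont: "continuous_on {c..d} g" "continuous_on {c..d} g'" "continuous_on {c..d} m"
    and bdry: "g c = 1" "g d = 1"
    and dg: "\<And>x. x \<in> {c<..<d} \<Longrightarrow> (g has_real_derivative g' x) (at x)"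
    and dg': "\<And>x. x \<in> {c<..<d} \<Longrightarrow> (g' has_real_derivative \<gamma> / (K * \<epsilon>) * g x - b x / \<epsilon> * g' x) (at x)"
    and dm: "\<And>x. x \<in> {c<..<d} \<Longrightarrow> (m has_real_derivative (b x * m x - J) / \<epsilon>) (at x)"
  shows "\<epsilon> * K * integral {c..d} (\<lambda>x. m x * (g' x)\<^sup>2) + \<gamma> * integral {c..d} (\<lambda>x. m x * (g x)\<^sup>2)
    = \<gamma> * integral {c..d} (\<lambda>x. m x * g x)"
proof -
  define G where "G x = K * \<epsilon> * m x * g' x * (g x - 1) + K * J / 2 * (g x - 1)\<^sup>2" for x
  define f where "f x = \<epsilon> * K * (m x * (g' x)\<^sup>2) + \<gamma> * (m x * (g x)\<^sup>2) - \<gamma> * (m x * g x)" for x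
  have "(f has_integral G d - G c) {c..d}"
  proof (rule fundamental_theorem_of_calculus_interior)
    show "continuous_on {c..d} G" unfolding G_def by (intro continuous_intros cont) auto
    fix x assume x: "x \<in> {c<..<d}"
    have "(G has_real_derivative f x) (at x)"
      unfolding G_def
      by (rule derivative_eq_intros dg[OF x] dg'[OF x] dm[OF x] refl)+
        (use K \<epsilon> in \<open>simp add: f_def field_simps power2_eq_square\<close>)
    then show "(G has_vector_derivative f x) (at x)"
      by (simp add: has_real_derivative_iff_has_vector_derivative)
  qed (use cd in simp)
  then have "integral {c..d} f = 0" by (simp add: integral_unique G_def bdry)
  moreover have "integral {c..d} f = \<epsilon> * K * integral {c..d} (\<lambda>x. m x * (g' x)\<^sup>2)
      + \<gamma> * integral {c..d} (\<lambda>x. m x * (g x)\<^sup>2) - \<gamma> * integral {c..d} (\<lambda>x. m x * g x)"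
    unfolding f_def
    by (intro integral_unique has_integral_diff has_integral_add has_integral_mult_right integrable_integral
        integrable_continuous_interval continuous_intros cont)
  ultimately show ?thesis by simp
qed

section \<open>Integrals over arcs of the torus\<close>

lemma frac_image_unit:
  fixes c d :: real
  assumes "0 \<le> c" "c < 1" "c < d" "d \<le> c + 1"
  shows "frac ` {c<..<d} = (if d \<le> 1 then {c<..<d} else {c<..<1} \<union> {0..<d - 1})"
proof -
  have small: "frac x = x" if "0 \<le> x" "x < 1" for x :: real using that by (simp add: frac_eq)
  have big: "frac x = x - 1" if "1 \<le> x" "x < 2" for x :: real using that by (simp add: frac_unique_iff)
  show ?thesis
  proof (cases "d \<le> 1")
    case True
    then have "frac x = x" if "x \<in> {c<..<d}" for x using that assms by (simp add: small)
    then have "frac ` {c<..<d} = (\<lambda>x. x) ` {c<..<d}" by (intro image_cong) auto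
    then show ?thesis using True by simp
  next
    case False
    then have "{c<..<d} = {c<..<1} \<union> {1..<d}" using assms by auto
    moreover have "frac ` {c<..<1} = {c<..<1}" using small assms by (auto simp: image_iff)
    moreover have "frac ` {1..<d} = {0..<d - 1}"
    proof -
      have "frac ` {1..<d} = (\<lambda>x. x - 1) ` {1..<d}"
        by (rule image_cong[OF refl], rule big) (use assms in auto)
      also have "\<dots> = {0..<d - 1}" by (auto simp: image_iff intro!: bexI[of _ "_ + 1"])
      finally show ?thesis .
    qed
    ultimately show ?thesis using False by (simp add: image_Un)
  qed
qed

text \<open>The end-points of an interval do not matter for the integral; \<open>S\<close> is meant to be one of the two
  pieces into which an arc around 0 falls.\<close>

lemma interval_piece:
  fixes F f :: "real \<Rightarrow> real"
  assumes "continuous_on {a..b} f" "a \<le> b" "{a<..<b} \<subseteq> S" "S \<subseteq> {a..b}" "S \<in> sets borel"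
    and "\<And>x. x \<in> S \<Longrightarrow> F x = f x"
  shows "set_integrable lborel S F" "(LINT x:S|lborel. F x) = integral {a..b} f"
proof -
  have "set_integrable lborel S f"
    by (rule set_integrable_subset[OF borel_integrable_atLeastAtMost'[OF assms(1)]]) (use assms in auto)
  moreover have "set_integrable lborel S F \<longleftrightarrow> set_integrable lborel S f"
    by (rule set_integrable_cong) (use assms in auto)
  ultimately show *: "set_integrable lborel S F" by simp
  have "(LINT x:S|lborel. F x) = integral S F" by (rule set_borel_integral_eq_integral[OF *])
  also have "\<dots> = integral S f" by (rule integral_cong) (rule assms)
  also have "\<dots> = integral {a..b} f"
  proof (rule integral_spike_set)
    show "negligible {x \<in> S - {a..b}. f x \<noteq> 0}" using assms(4) by (simp add: Diff_eq_empty_iff[THEN iffD2])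
    have "{x \<in> {a..b} - S. f x \<noteq> 0} \<subseteq> {a, b}" using assms(3) by force
    then show "negligible {x \<in> {a..b} - S. f x \<noteq> 0}" by (rule negligible_subset[rotated]) simp
  qed
  finally show "(LINT x:S|lborel. F x) = integral {a..b} f" .
qed

lemma arc_integral_unit:
  fixes F f :: "real \<Rightarrow> real"
  assumes cd: "0 \<le> c" "c < 1" "c < d" "d \<le> c + 1" and per: "periodic1 F"
    and cont: "continuous_on {c..d} f" and eq: "\<And>x. x \<in> {c<..<d} \<Longrightarrow> F x = f x"
  shows "set_integrable lborel (frac ` {c<..<d}) F \<and> (LINT x:frac ` {c<..<d}|lborel. F x) = integral {c..d} f"
proof (cases "d \<le> 1")
  case True
  have "{c<..<d} \<subseteq> {c..d}" by auto
  then show ?thesis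
    using True interval_piece[OF cont, of "{c<..<d}" F] eq cd by (simp add: frac_image_unit)
next
  case False
  have 1: "set_integrable lborel {c<..<1} F" "(LINT x:{c<..<1}|lborel. F x) = integral {c..1} f"
    by (rule interval_piece[of c 1 f "{c<..<1}" F],
        (use continuous_on_subset[OF cont, of "{c..1}"] eq cd False in auto))+
  have F1: "F x = (f \<circ> (+) 1) x" if "x \<in> {0..<d - 1}" for x
    using eq[of "1 + x"] periodic1_int[OF per, of x 1] that cd by (simp add: add.commute[of 1 x])
  have c1: "continuous_on {0..d - 1} (f \<circ> (+) 1)"
  proof (rule continuous_on_compose)
    show "continuous_on ((+) 1 ` {0..d - 1}) f"
      by (rule continuous_on_subset[OF cont]) (use cd in auto)
  qed (intro continuous_intros)
  have sub: "{0<..<d - 1} \<subseteq> {0..<d - 1}" "{0..<d - 1} \<subseteq> {0..d - 1}" by auto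
  have 2: "set_integrable lborel {0..<d - 1} F"
      "(LINT x:{0..<d - 1}|lborel. F x) = integral {0..d - 1} (f \<circ> (+) 1)"
    using interval_piece[OF c1 _ sub _ F1] False by (simp_all add: o_def)
  have fr: "frac ` {c<..<d} = {c<..<1} \<union> {0..<d - 1}" using frac_image_unit[OF cd] False by simp
  have "set_integrable lborel (frac ` {c<..<d}) F"
    unfolding fr by (rule set_integrable_Un[OF 1(1) 2(1)]) auto
  moreover have "(LINT x:frac ` {c<..<d}|lborel. F x) = integral {c..1} f + integral {0..d - 1} (f \<circ> (+) 1)"
    unfolding fr 1(2)[symmetric] 2(2)[symmetric] using cd False
    by (intro set_integral_Un 1 2) auto
  moreover have "integral {0..d - 1} (f \<circ> (+) 1) = integral {1..d} f"
    using integral_shift_Icc_real[of 0 "d - 1" f 1] by simp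
  moreover have "integral {c..1} f + integral {1..d} f = integral {c..d} f"
    using cd False by (intro Henstock_Kurzweil_Integration.integral_combine integrable_continuous_interval cont) auto
  ultimately show ?thesis by simp
qed

lemma frac_image_shift: "frac ` {c - of_int n<..<d - of_int n} = frac ` {c<..<d :: real}"
proof -
  have "{c - of_int n<..<d - of_int n} = (\<lambda>x. x - of_int n) ` {c<..<d}"
    by (auto simp: image_iff intro!: bexI[of _ "_ + of_int n"])
  moreover have "frac (x - of_int n) = frac x" for x :: real by (simp add: frac_def)
  ultimately show ?thesis by (simp add: image_image)
qed

text \<open>Integrals over an arc of the torus are computed on the line, where the arc is an interval
  \<open>(c, d)\<close>. The function \<open>F\<close> is periodic, and \<open>f\<close> is its continuous continuation from \<open>(c, d)\<close> to
  the end-points, where \<open>F\<close> itself may behave differently.\<close>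

lemma arc_integral:
  fixes F f :: "real \<Rightarrow> real"
  assumes cd: "c < d" "d \<le> c + 1" and per: "periodic1 F"
    and cont: "continuous_on {c..d} f" and eq: "\<And>x. x \<in> {c<..<d} \<Longrightarrow> F x = f x"
  shows "set_integrable lborel (frac ` {c<..<d}) F"
    and "(LINT x:frac ` {c<..<d}|lborel. F x) = integral {c..d} f"
proof -
  define n where "n = \<lfloor>c\<rfloor>"
  have "set_integrable lborel (frac ` {c - of_int n<..<d - of_int n}) F \<and>
    (LINT x:frac ` {c - of_int n<..<d - of_int n}|lborel. F x) = integral {c - of_int n..d - of_int n} (\<lambda>x. f (x + of_int n))"
  proof (rule arc_integral_unit)
    show "0 \<le> c - of_int n" "c - of_int n < 1" unfolding n_def by linarith+
    show "continuous_on {c - of_int n..d - of_int n} (\<lambda>x. f (x + of_int n))"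
      by (rule continuous_on_compose2[OF cont]) (auto intro!: continuous_intros)
    show "F x = f (x + of_int n)" if "x \<in> {c - of_int n<..<d - of_int n}" for x
      using eq[of "x + of_int n"] that by (simp add: periodic1_int[OF per])
  qed (use cd per in auto)
  then show "set_integrable lborel (frac ` {c<..<d}) F"
    "(LINT x:frac ` {c<..<d}|lborel. F x) = integral {c..d} f"
    by (simp_all add: frac_image_shift integral_shift_real_ivl)
qed

lemma arc_measurable:
  assumes "c < d" "d \<le> c + 1"
  shows "frac ` {c<..<d :: real} \<in> sets borel"
proof -
  have n: "0 \<le> c - of_int \<lfloor>c\<rfloor>" "c - of_int \<lfloor>c\<rfloor> < 1" by linarith+
  have "frac ` {c - of_int \<lfloor>c\<rfloor><..<d - of_int \<lfloor>c\<rfloor>} \<in> sets borel"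
    using assms by (subst frac_image_unit[OF n]) auto
  then show ?thesis by (simp add: frac_image_shift)
qed

lemma stationary_arc_integral:
  fixes F f :: "real \<Rightarrow> real"
  assumes m: "continuous_on UNIV (m_eps b \<epsilon>)" "\<And>x. 0 < m_eps b \<epsilon> x" "periodic1 (m_eps b \<epsilon>)"
    and cd: "c < d" "d \<le> c + 1" and per: "periodic1 F"
    and cont: "continuous_on {c..d} f" and eq: "\<And>x. x \<in> {c<..<d} \<Longrightarrow> F x = f x"
  shows "set_integrable (mu_eps b \<epsilon>) (frac ` {c<..<d}) F"
    and "(LINT x:frac ` {c<..<d}|mu_eps b \<epsilon>. F x) = integral {c..d} (\<lambda>x. m_eps b \<epsilon> x * f x)"
proof -
  let ?I = "frac ` {c<..<d}" and ?m = "m_eps b \<epsilon>" and ?R = "restrict_space lborel torus"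
  have Isub: "?I \<subseteq> torus" by (auto simp: torus_def frac_lt_1)
  have "set_integrable lborel ?I F" by (rule arc_integral[OF cd per cont eq])
  then have Fm: "(\<lambda>x. indicator ?I x *\<^sub>R F x) \<in> borel_measurable ?R"
    unfolding set_integrable_def by (intro measurable_restrict_space1) auto
  have mm: "?m \<in> borel_measurable ?R"
    by (intro measurable_restrict_space1) (use m(1) in \<open>simp add: borel_measurable_continuous_onI\<close>)
  have perm: "periodic1 (\<lambda>x. ?m x * F x)" using m(3) per by (simp add: periodic1_def)
  have contm: "continuous_on {c..d} (\<lambda>x. ?m x * f x)"
    by (intro continuous_intros cont continuous_on_subset[OF m(1)]) auto
  note arc = arc_integral[OF cd perm contm]
  have set_torus: "torus \<inter> space lborel \<in> sets lborel" by (simp add: torus_def)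
  have prod: "indicator torus x *\<^sub>R (?m x *\<^sub>R (indicator ?I x *\<^sub>R F x)) = indicator ?I x *\<^sub>R (?m x * F x)" for x
    using Isub by (auto simp: indicator_def)
  have ae: "AE x in ?R. 0 \<le> ?m x" using m(2) by (auto intro: less_imp_le)
  have "integrable ?R (\<lambda>x. ?m x *\<^sub>R (indicator ?I x *\<^sub>R F x))"
    unfolding integrable_restrict_space[OF set_torus] set_integrable_def prod
    using arc(1) eq by (simp add: set_integrable_def)
  then show "set_integrable (mu_eps b \<epsilon>) ?I F"
    unfolding set_integrable_def mu_eps_def by (subst integrable_density[OF Fm mm ae])
  have "(LINT x:?I|mu_eps b \<epsilon>. F x) = (\<integral>x. ?m x *\<^sub>R (indicator ?I x *\<^sub>R F x) \<partial>?R)"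
    unfolding set_lebesgue_integral_def mu_eps_def by (rule integral_density[OF Fm mm ae])
  also have "\<dots> = (LINT x:?I|lborel. ?m x * F x)"
    unfolding integral_restrict_space[OF set_torus] set_lebesgue_integral_def prod ..
  also have "\<dots> = integral {c..d} (\<lambda>x. ?m x * f x)" using arc(2) eq by simp
  finally show "(LINT x:?I|mu_eps b \<epsilon>. F x) = integral {c..d} (\<lambda>x. ?m x * f x)" .
qed

section \<open>Twice continuously differentiable functions\<close>

lemma C2_on_openI:
  assumes "open U" "\<And>x. x \<in> U \<Longrightarrow> (f has_real_derivative f' x) (at x)"
    "\<And>x. x \<in> U \<Longrightarrow> (f' has_real_derivative f'' x) (at x)" "continuous_on U f''"
  shows "C2_on_open U f"
  using assms unfolding C2_on_open_def by blast

lemma C2_on_openE: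
  assumes "C2_on_open U f"
  obtains f' f'' where "open U" "\<And>x. x \<in> U \<Longrightarrow> (f has_real_derivative f' x) (at x)"
    "\<And>x. x \<in> U \<Longrightarrow> (f' has_real_derivative f'' x) (at x)" "continuous_on U f''"
    "continuous_on U f'" "continuous_on U f"
proof -
  obtain f' f'' where f: "open U" "\<And>x. x \<in> U \<Longrightarrow> (f has_real_derivative f' x) (at x)"
    "\<And>x. x \<in> U \<Longrightarrow> (f' has_real_derivative f'' x) (at x)" "continuous_on U f''"
    using assms unfolding C2_on_open_def by blast
  have "continuous_on U f'" "continuous_on U f"
    using f(2,3) by (meson DERIV_continuous_on has_field_derivative_at_within)+
  with f show ?thesis by (intro that)
qed

lemma C2_on_open_mult:
  assumes "C2_on_open U f" "C2_on_open U h"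
  shows "C2_on_open U (\<lambda>x. f x * h x)"
proof -
  obtain f' f'' where f: "open U" "\<And>x. x \<in> U \<Longrightarrow> (f has_real_derivative f' x) (at x)"
    "\<And>x. x \<in> U \<Longrightarrow> (f' has_real_derivative f'' x) (at x)" "continuous_on U f''"
    "continuous_on U f'" "continuous_on U f"
    by (rule C2_on_openE[OF assms(1)]) blast
  obtain h' h'' where h: "\<And>x. x \<in> U \<Longrightarrow> (h has_real_derivative h' x) (at x)"
    "\<And>x. x \<in> U \<Longrightarrow> (h' has_real_derivative h'' x) (at x)" "continuous_on U h''"
    "continuous_on U h'" "continuous_on U h"
    by (rule C2_on_openE[OF assms(2)]) blast
  show ?thesis
  proof (rule C2_on_openI[OF f(1)])
    fix x assume x: "x \<in> U"
    show "((\<lambda>x. f x * h x) has_real_derivative f' x * h x + f x * h' x) (at x)"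
      using f(2)[OF x] h(1)[OF x] by (auto intro!: derivative_eq_intros)
    show "((\<lambda>x. f' x * h x + f x * h' x) has_real_derivative f'' x * h x + 2 * (f' x * h' x) + f x * h'' x) (at x)"
      using f(2,3)[OF x] h(1,2)[OF x] by (auto intro!: derivative_eq_intros)
  qed (intro continuous_intros f h)
qed

lemma C2_on_open_compose:
  assumes "C2_on_open U f" "C2_on_open V h" "f ` U \<subseteq> V"
  shows "C2_on_open U (\<lambda>x. h (f x))"
proof -
  obtain f' f'' where f: "open U" "\<And>x. x \<in> U \<Longrightarrow> (f has_real_derivative f' x) (at x)"
    "\<And>x. x \<in> U \<Longrightarrow> (f' has_real_derivative f'' x) (at x)" "continuous_on U f''"
    "continuous_on U f'" "continuous_on U f"
    by (rule C2_on_openE[OF assms(1)]) blast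
  obtain h' h'' where h: "\<And>x. x \<in> V \<Longrightarrow> (h has_real_derivative h' x) (at x)"
    "\<And>x. x \<in> V \<Longrightarrow> (h' has_real_derivative h'' x) (at x)" "continuous_on V h''"
    "continuous_on V h'" "continuous_on V h"
    by (rule C2_on_openE[OF assms(2)]) blast
  have ch: "continuous_on U (\<lambda>x. h'' (f x))" "continuous_on U (\<lambda>x. h' (f x))"
    by (rule continuous_on_compose2[OF _ f(6) assms(3)], rule h)+
  show ?thesis
  proof (rule C2_on_openI[OF f(1)])
    fix x assume x: "x \<in> U"
    then have y: "f x \<in> V" using assms(3) by auto
    show "((\<lambda>x. h (f x)) has_real_derivative h' (f x) * f' x) (at x)"
      by (rule DERIV_chain2[OF h(1)[OF y] f(2)[OF x]])
    have "((\<lambda>x. h' (f x)) has_real_derivative h'' (f x) * f' x) (at x)"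
      by (rule DERIV_chain2[OF h(2)[OF y] f(2)[OF x]])
    from DERIV_mult[OF this f(3)[OF x]]
    show "((\<lambda>x. h' (f x) * f' x) has_real_derivative h'' (f x) * (f' x)\<^sup>2 + h' (f x) * f'' x) (at x)"
      by (simp add: power2_eq_square algebra_simps)
  qed (intro continuous_intros f ch)
qed

lemma C2_on_open_local:
  assumes "open U"
    and "\<And>x. x \<in> U \<Longrightarrow> \<exists>V h. x \<in> V \<and> C2_on_open V h \<and> (\<forall>y\<in>V. f y = h y)"
  shows "C2_on_open U f"
proof (rule C2_on_openI[OF assms(1)])
  have loc: "(f has_real_derivative deriv f x) (at x) \<and> (deriv f has_real_derivative deriv (deriv f) x) (at x)
      \<and> isCont (deriv (deriv f)) x" if x: "x \<in> U" for x
  proof -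
    obtain V h where V: "x \<in> V" "C2_on_open V h" "\<And>y. y \<in> V \<Longrightarrow> f y = h y"
      using assms(2)[OF x] by blast
    obtain h' h'' where h: "open V" "\<And>x. x \<in> V \<Longrightarrow> (h has_real_derivative h' x) (at x)"
      "\<And>x. x \<in> V \<Longrightarrow> (h' has_real_derivative h'' x) (at x)" "continuous_on V h''"
      by (rule C2_on_openE[OF V(2)]) blast
    have d1: "(f has_real_derivative h' y) (at y)" if "y \<in> V" for y
      by (rule has_field_derivative_transform_within_open[OF h(2)[OF that] h(1) that]) (simp add: V(3))
    then have e1: "deriv f y = h' y" if "y \<in> V" for y using that by (simp add: DERIV_imp_deriv)
    have d2: "(deriv f has_real_derivative h'' y) (at y)" if "y \<in> V" for y
      by (rule has_field_derivative_transform_within_open[OF h(3)[OF that] h(1) that]) (simp add: e1)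
    then have e2: "deriv (deriv f) y = h'' y" if "y \<in> V" for y using that by (simp add: DERIV_imp_deriv)
    have "continuous_on V (deriv (deriv f))"
      using h(4) e2 by (simp cong: continuous_on_cong)
    then have "isCont (deriv (deriv f)) x" using h(1) V(1) by (simp add: continuous_on_eq_continuous_at)
    then show ?thesis using d1[OF V(1)] d2[OF V(1)] e1[OF V(1)] e2[OF V(1)] by simp
  qed
  show "(f has_real_derivative deriv f x) (at x)" "(deriv f has_real_derivative deriv (deriv f) x) (at x)"
    if "x \<in> U" for x using loc[OF that] by auto
  show "continuous_on U (deriv (deriv f))" using loc by (auto intro: continuous_at_imp_continuous_on)
qed

lemma positive_part_power_deriv:
  "((\<lambda>x :: real. (max 0 x) ^ Suc (Suc n)) has_real_derivative real (Suc (Suc n)) * (max 0 x) ^ Suc n) (at x)"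
proof -
  consider "x < 0" | "0 < x" | "x = 0" by linarith
  then show ?thesis
  proof cases
    case 1
    have "((\<lambda>x :: real. 0) has_real_derivative 0) (at x)" by simp
    then have "((\<lambda>x :: real. (max 0 x) ^ Suc (Suc n)) has_real_derivative 0) (at x)"
      by (rule has_field_derivative_transform_within_open[of _ _ _ "{..<0}"]) (use 1 in auto)
    then show ?thesis using 1 by simp
  next
    case 2
    have "((\<lambda>x :: real. x ^ Suc (Suc n)) has_real_derivative real (Suc (Suc n)) * x ^ Suc n) (at x)"
      using DERIV_pow[of "Suc (Suc n)" x] by simp
    then have "((\<lambda>x :: real. (max 0 x) ^ Suc (Suc n)) has_real_derivative real (Suc (Suc n)) * x ^ Suc n) (at x)"
      by (rule has_field_derivative_transform_within_open[of _ _ _ "{0<..}"]) (use 2 in auto)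
    then show ?thesis using 2 by simp
  next
    case 3
    have "((\<lambda>h :: real. (max 0 h) ^ Suc (Suc n) / h) \<longlongrightarrow> 0) (at 0)"
    proof (rule Lim_null_comparison)
      show "\<forall>\<^sub>F h :: real in at 0. norm ((max 0 h) ^ Suc (Suc n) / h) \<le> \<bar>h\<bar> ^ Suc n"
      proof (rule always_eventually, rule allI)
        fix h :: real
        show "norm ((max 0 h) ^ Suc (Suc n) / h) \<le> \<bar>h\<bar> ^ Suc n"
        proof (cases "0 < h")
          case False
          then have "(max 0 h) ^ Suc (Suc n) / h = 0" by simp
          then show ?thesis by (simp only: norm_zero zero_le_power_abs)
        qed (simp add: max_def)
      qed
      have "((\<lambda>h :: real. \<bar>h\<bar> ^ Suc n) \<longlongrightarrow> \<bar>0\<bar> ^ Suc n) (at 0)" by (intro tendsto_intros)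
      then show "((\<lambda>h :: real. \<bar>h\<bar> ^ Suc n) \<longlongrightarrow> 0) (at 0)" by simp
    qed
    then show ?thesis by (simp add: 3 has_field_derivative_iff)
  qed
qed

text \<open>The cube of the positive part is of class \<open>C\<^sup>2\<close>, hence so is this composition of two of them, which
  is 0 on \<open>(-\<infinity>, 0]\<close> and 1 on \<open>[1, \<infinity>)\<close>.\<close>

definition smooth_step :: "real \<Rightarrow> real"
  where "smooth_step s = 1 - (max 0 (1 - (max 0 s) ^ 3)) ^ 3"

lemma smooth_step_0: "s \<le> 0 \<Longrightarrow> smooth_step s = 0"
  by (simp add: smooth_step_def)

lemma smooth_step_1: "1 \<le> s \<Longrightarrow> smooth_step s = 1"
proof -
  assume s: "1 \<le> s"
  have "1 - s ^ 3 \<le> 0" using one_le_power[OF s, of 3] by linarith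
  then have "max 0 (1 - s ^ 3) = 0" by (rule max_absorb1)
  moreover have "max 0 s = s" using s by simp
  ultimately show ?thesis by (simp only: smooth_step_def) simp
qed

lemma C2_smooth_step: "C2_on_open UNIV smooth_step"
proof -
  have p3: "((\<lambda>x :: real. (max 0 x) ^ 3) has_real_derivative 3 * (max 0 x) ^ 2) (at x)"
   and p2: "((\<lambda>x :: real. (max 0 x) ^ 2) has_real_derivative 2 * max 0 x) (at x)" for x
    using positive_part_power_deriv[of 1 x] positive_part_power_deriv[of 0 x]
    by (simp_all add: numeral_3_eq_3 numeral_2_eq_2)
  have 1: "C2_on_open UNIV (\<lambda>x. 1 - (max 0 x) ^ 3)"
  proof (rule C2_on_openI)
    show "((\<lambda>x :: real. 1 - (max 0 x) ^ 3) has_real_derivative - (3 * (max 0 x) ^ 2)) (at x)" for x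
      using DERIV_diff[OF DERIV_const p3] by simp
    show "((\<lambda>x :: real. - (3 * (max 0 x) ^ 2)) has_real_derivative - (3 * (2 * max 0 x))) (at x)" for x
      by (intro DERIV_minus DERIV_cmult p2)
  qed (auto intro!: continuous_intros)
  show ?thesis
    unfolding smooth_step_def[abs_def] by (rule C2_on_open_compose[OF 1 1]) simp
qed

section \<open>Functions on an arc of the torus\<close>

text \<open>A smooth function on the torus that is positive exactly on the arc \<open>(c, d)\<close>.\<close>

definition arc_height :: "real \<Rightarrow> real \<Rightarrow> real \<Rightarrow> real"
  where "arc_height c d x = cos (2 * pi * (x - (c + d) / 2)) - cos (pi * (d - c))"

text \<open>The extension of a function on \<open>[c, d]\<close> to the torus that is constant, equal to \<open>g d\<close>,
  outside of the arc.\<close>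

definition arc_extension :: "real \<Rightarrow> real \<Rightarrow> (real \<Rightarrow> real) \<Rightarrow> real \<Rightarrow> real"
  where "arc_extension c d g x = g (min d (c + frac (x - c)))"

lemma periodic1_arc_height: "periodic1 (arc_height c d)"
proof -
  have "cos (2 * pi * (x + 1 - (c + d) / 2)) = cos (2 * pi * (x - (c + d) / 2))" for x
  proof -
    have "2 * pi * (x + 1 - (c + d) / 2) = 2 * pi * (x - (c + d) / 2) + 2 * pi" by (simp add: algebra_simps)
    then show ?thesis by (simp only: cos_periodic)
  qed
  then show ?thesis by (simp add: periodic1_def arc_height_def)
qed

lemma periodic1_arc_extension: "periodic1 (arc_extension c d g)"
proof -
  have "frac (x + 1 - c) = frac (x - c)" for x
    using frac_1_eq[of "x - c"] by (simp add: algebra_simps)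
  then show ?thesis by (simp add: periodic1_def arc_extension_def)
qed

lemma continuous_arc_height: "continuous_on A (arc_height c d)"
  unfolding arc_height_def by (intro continuous_intros)

lemma C2_arc_height: "C2_on_open UNIV (arc_height c d)"
proof (rule C2_on_openI)
  let ?y = "\<lambda>x. 2 * pi * (x - (c + d) / 2)"
  show "(arc_height c d has_real_derivative - (2 * pi) * sin (?y x)) (at x)" for x
    unfolding arc_height_def[abs_def] by (auto intro!: derivative_eq_intros)
  show "((\<lambda>x. - (2 * pi) * sin (?y x)) has_real_derivative - (2 * pi) * (2 * pi) * cos (?y x)) (at x)" for x
    by (auto intro!: derivative_eq_intros)
qed (auto intro!: continuous_intros)

text \<open>In terms of the angle \<open>t\<close> from the midpoint of the arc, the height is \<open>cos t - cos w\<close>, where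
  \<open>2 w\<close> is the angular length; the cosine is compared on \<open>[0, \<pi>]\<close>, after a reflection if
  \<open>t > \<pi>\<close>.\<close>

lemma arc_height_pos_iff_fundamental:
  assumes cd: "c < d" "d \<le> c + 1" and y: "c \<le> y" "y < c + 1"
  shows "0 < arc_height c d y \<longleftrightarrow> c < y \<and> y < d"
proof -
  define w where "w = pi * (d - c)"
  have "pi * (d - c) \<le> pi * 1" using cd by (intro mult_left_mono) auto
  then have w: "0 < w" "w \<le> pi" using cd by (auto simp: w_def)
  define t where "t = 2 * pi * (y - (c + d) / 2)"
  have tl: "c < y \<longleftrightarrow> - w < t" and tu: "y < d \<longleftrightarrow> t < w" and t0: "- w \<le> t" and t2: "t < 2 * pi - w"
  proof -
    have e: "t + w = 2 * pi * (y - c)" "w - t = 2 * pi * (d - y)" "2 * pi - w - t = 2 * pi * (c + 1 - y)"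
      by (auto simp: t_def w_def field_simps)
    have "0 < t + w \<longleftrightarrow> 0 < y - c" "0 < w - t \<longleftrightarrow> 0 < d - y" "0 \<le> t + w" "0 < 2 * pi - w - t"
      unfolding e using y by (auto simp: zero_less_mult_iff)
    then show "c < y \<longleftrightarrow> - w < t" "y < d \<longleftrightarrow> t < w" "- w \<le> t" "t < 2 * pi - w" by linarith+
  qed
  have "0 < arc_height c d y \<longleftrightarrow> cos w < cos t" by (simp add: arc_height_def t_def w_def)
  also have "\<dots> \<longleftrightarrow> - w < t \<and> t < w"
  proof (cases "t \<le> pi")
    case True
    have "cos w < cos \<bar>t\<bar> \<longleftrightarrow> \<bar>t\<bar> < w"
      by (rule cos_mono_less_eq) (use True w t0 in auto)
    then show ?thesis by auto
  next
    case False
    have "cos t = cos (2 * pi - t)" by (simp add: cos_diff)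
    moreover have "cos w < cos (2 * pi - t) \<longleftrightarrow> 2 * pi - t < w"
      by (rule cos_mono_less_eq) (use False w t2 in auto)
    ultimately show ?thesis using False w t2 by auto
  qed
  finally show ?thesis using tl tu by simp
qed

lemma frac_shift: "\<exists>k :: int. x = (c + frac (x - c)) + of_int k"
  by (intro exI[of _ "\<lfloor>x - c\<rfloor>"]) (simp add: frac_def)

lemma arc_height_pos_iff:
  assumes cd: "c < d" "d \<le> c + 1"
  shows "0 < arc_height c d x \<longleftrightarrow> (\<exists>k :: int. c + of_int k < x \<and> x < d + of_int k)" (is "_ \<longleftrightarrow> ?R")
proof
  obtain k :: int where k: "x = (c + frac (x - c)) + of_int k" using frac_shift by blast
  assume "0 < arc_height c d x"
  then have "0 < arc_height c d (c + frac (x - c))"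
    using periodic1_int[OF periodic1_arc_height, of c d "c + frac (x - c)" k] k by simp
  then have "c < c + frac (x - c)" "c + frac (x - c) < d"
    using arc_height_pos_iff_fundamental[OF cd, of "c + frac (x - c)"] by (auto simp: frac_lt_1)
  then show ?R using k by (intro exI[of _ k]) linarith
next
  assume ?R
  then obtain k :: int where k: "c + of_int k < x" "x < d + of_int k" by blast
  have "0 < arc_height c d (x - of_int k)"
    using arc_height_pos_iff_fundamental[OF cd, of "x - of_int k"] k cd by auto
  then show "0 < arc_height c d x"
    using periodic1_int[OF periodic1_arc_height, of c d "x - of_int k" k] by simp
qed

lemma arc_eq_height_pos:
  assumes cd: "c < d" "d \<le> c + 1"
  shows "frac ` {c<..<d} = {x \<in> torus. 0 < arc_height c d x}"
proof (intro set_eqI iffI)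
  fix x assume "x \<in> frac ` {c<..<d}"
  then obtain y where y: "c < y" "y < d" "x = frac y" by auto
  have "0 < arc_height c d y" using y arc_height_pos_iff[OF cd, of y] by (auto intro: exI[of _ 0])
  then show "x \<in> {x \<in> torus. 0 < arc_height c d x}"
    using y(3) periodic1_frac[OF periodic1_arc_height] by (simp add: torus_def frac_lt_1)
next
  fix x assume x: "x \<in> {x \<in> torus. 0 < arc_height c d x}"
  then obtain k :: int where k: "c + of_int k < x" "x < d + of_int k" using arc_height_pos_iff[OF cd] by blast
  have "frac (x - of_int k) = x" using x by (simp add: torus_def frac_unique_iff)
  then show "x \<in> frac ` {c<..<d}" using k by (intro image_eqI[of _ _ "x - of_int k"]) auto
qed

lemma arc_extension_on_arc:
  assumes "d \<le> c + 1" "c < x - of_int k" "x - of_int k < d"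
  shows "arc_extension c d g x = g (x - of_int k)"
proof -
  have "frac (x - c) = x - of_int k - c" using assms by (simp add: frac_unique_iff)
  then show ?thesis using assms by (simp add: arc_extension_def)
qed

lemma arc_extension_outside:
  assumes cd: "c < d" "d \<le> c + 1" and g: "g c = g d" and x: "arc_height c d x \<le> 0"
  shows "arc_extension c d g x = g d"
proof -
  obtain k :: int where k: "x = (c + frac (x - c)) + of_int k" using frac_shift by blast
  have "\<not> (c + of_int k < x \<and> x < d + of_int k)" using x arc_height_pos_iff[OF cd, of x] by force
  then have "frac (x - c) = 0 \<or> d \<le> c + frac (x - c)" using k frac_ge_0[of "x - c"] by linarith
  then show ?thesis
  proof
    assume "frac (x - c) = 0"
    then show ?thesis unfolding arc_extension_def \<open>frac (x - c) = 0\<close> using g cd by simp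
  qed (simp add: arc_extension_def)
qed

text \<open>On each interval \<open>[c + k, c + k + 1]\<close> the extension is a composition of continuous functions. The
  pieces match at the translates of \<open>c\<close> because \<open>g c = g d\<close>.\<close>

lemma continuous_arc_extension:
  assumes cd: "c < d" "d \<le> c + 1" and g: "g c = g d" and cont: "continuous_on {c..d} g"
  shows "continuous_on UNIV (arc_extension c d g)"
proof -
  let ?G = "arc_extension c d g"
  have piece: "continuous_on {c + of_int k..c + of_int k + 1} ?G" for k :: int
  proof -
    have eq: "?G x = g (min d (x - of_int k))" if "x \<in> {c + of_int k..c + of_int k + 1}" for x
    proof (cases "x = c + of_int k + 1")
      case True
      then have "frac (x - c) = 0" by (simp add: frac_unique_iff)
      then show ?thesis using True cd g by (simp add: arc_extension_def)
    next
      case False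
      then have "frac (x - c) = x - of_int k - c" using that by (simp add: frac_unique_iff)
      then show ?thesis by (simp add: arc_extension_def)
    qed
    have "continuous_on {c + of_int k..c + of_int k + 1} (\<lambda>x. g (min d (x - of_int k)))"
      by (rule continuous_on_compose2[OF cont]) (use cd in \<open>auto intro!: continuous_intros\<close>)
    then show ?thesis by (rule continuous_on_eq) (rule eq[symmetric])
  qed
  have "isCont ?G x" for x
  proof -
    define k where "k = \<lfloor>x - c\<rfloor>"
    have k: "c + of_int k \<le> x" "x < c + of_int k + 1" unfolding k_def by linarith+
    have "continuous_on ({c + of_int (k - 1)..c + of_int (k - 1) + 1} \<union> {c + of_int k..c + of_int k + 1}) ?G"
      by (intro continuous_on_closed_Un piece) auto
    moreover have "{c + of_int (k - 1)..c + of_int (k - 1) + 1} \<union> {c + of_int k..c + of_int k + 1} =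
        {c + of_int k - 1..c + of_int k + 1}" by auto
    ultimately have "continuous_on {c + of_int k - 1..c + of_int k + 1} ?G" by simp
    then have "continuous_on {c + of_int k - 1<..<c + of_int k + 1} ?G"
      by (rule continuous_on_subset) auto
    then show ?thesis using k by (subst (asm) continuous_on_eq_continuous_at) auto
  qed
  then show ?thesis by (simp add: continuous_at_imp_continuous_on)
qed

text \<open>A version of the extension that is of class \<open>C\<^sup>2\<close> on the whole torus: the cutoff factor vanishes where
  the height is at most \<open>\<kappa> / 2\<close>, hence also near the end-points of the arc.\<close>

definition arc_cutoff :: "real \<Rightarrow> real \<Rightarrow> (real \<Rightarrow> real) \<Rightarrow> real \<Rightarrow> real \<Rightarrow> real"
  where "arc_cutoff c d g \<kappa> x = arc_extension c d g x * smooth_step (2 * arc_height c d x / \<kappa> - 1)"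

lemma arc_cutoff_inside: "0 < \<kappa> \<Longrightarrow> \<kappa> \<le> arc_height c d x \<Longrightarrow> arc_cutoff c d g \<kappa> x = arc_extension c d g x"
  by (simp add: arc_cutoff_def smooth_step_1 field_simps)

text \<open>The two cases of the proof are open sets that cover the line: where the height is positive, the
  extension is a translate of \<open>g\<close>, and where it is less than \<open>\<kappa> / 2\<close>, the cutoff vanishes.\<close>

lemma C2_arc_cutoff:
  assumes cd: "c < d" "d \<le> c + 1" and \<kappa>: "0 < \<kappa>" and g: "C2_on_open {c<..<d} g"
  shows "arc_cutoff c d g \<kappa> \<in> C2_torus"
proof -
  have step: "C2_on_open UNIV (\<lambda>x. smooth_step (2 * arc_height c d x / \<kappa> - 1))"
  proof -
    have "C2_on_open UNIV (\<lambda>x. 2 * x / \<kappa> - 1)"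
      using \<kappa> by (intro C2_on_openI[of _ _ "\<lambda>_. 2 / \<kappa>" "\<lambda>_. 0"]) (auto intro!: derivative_eq_intros)
    from C2_on_open_compose[OF C2_on_open_compose[OF C2_arc_height this] C2_smooth_step]
    show ?thesis by simp
  qed
  have "C2_on_open UNIV (arc_cutoff c d g \<kappa>)"
  proof (rule C2_on_open_local)
    fix x :: real
    show "\<exists>V h. x \<in> V \<and> C2_on_open V h \<and> (\<forall>y\<in>V. arc_cutoff c d g \<kappa> y = h y)"
    proof (cases "0 < arc_height c d x")
      case True
      then obtain k :: int where k: "c + of_int k < x" "x < d + of_int k" using arc_height_pos_iff[OF cd] by blast
      let ?V = "{c + of_int k<..<d + of_int k}"
      have "C2_on_open ?V (\<lambda>x. x - of_int k)"
        by (rule C2_on_openI[of _ _ "\<lambda>_. 1" "\<lambda>_. 0"]) (auto intro!: derivative_eq_intros)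
      from C2_on_open_compose[OF this g]
      have 1: "C2_on_open ?V (\<lambda>x. g (x - of_int k))" by force
      have 2: "C2_on_open ?V (\<lambda>x. smooth_step (2 * arc_height c d x / \<kappa> - 1))"
        using step unfolding C2_on_open_def by (auto intro: continuous_on_subset)
      have "arc_cutoff c d g \<kappa> y = g (y - of_int k) * smooth_step (2 * arc_height c d y / \<kappa> - 1)" if "y \<in> ?V" for y
        using that arc_extension_on_arc[OF cd(2), of y k g] by (simp add: arc_cutoff_def)
      moreover have "x \<in> ?V" using k by simp
      ultimately show ?thesis using C2_on_open_mult[OF 1 2] by blast
    next
      case False
      let ?V = "{x. arc_height c d x < \<kappa> / 2}"
      have "open ?V" by (intro open_Collect_less continuous_arc_height continuous_intros)
      then have "C2_on_open ?V (\<lambda>_. 0)"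
        by (rule C2_on_openI[of _ _ "\<lambda>_. 0" "\<lambda>_. 0"]) auto
      moreover have "arc_cutoff c d g \<kappa> y = 0" if "y \<in> ?V" for y
        using that \<kappa> by (simp add: arc_cutoff_def smooth_step_0 field_simps)
      ultimately show ?thesis using False \<kappa> by (intro exI[of _ ?V] exI[of _ "\<lambda>_. 0"]) auto
    qed
  qed simp
  moreover have "periodic1 (arc_cutoff c d g \<kappa>)"
    using periodic1_arc_extension[of c d g] periodic1_arc_height[of c d]
    by (simp add: periodic1_def arc_cutoff_def)
  ultimately show ?thesis by (simp add: C2_torus_def)
qed

text \<open>Where the height exceeds \<open>\<kappa>\<close> the cutoff factor is 1, so that the function is locally a translate of
  \<open>g\<close> and inherits its differential equation.\<close>

lemma gen_torus_arc_cutoff: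
  assumes cd: "c < d" "d \<le> c + 1" and \<kappa>: "0 < \<kappa>" and per: "periodic1 b" and \<epsilon>: "0 < \<epsilon>"
    and dg: "\<And>x. x \<in> {c<..<d} \<Longrightarrow> (g has_real_derivative g' x) (at x)"
    and dg': "\<And>x. x \<in> {c<..<d} \<Longrightarrow>
      (g' has_real_derivative \<gamma> / (exp (barrier b / \<epsilon>) * \<epsilon>) * g x - b x / \<epsilon> * g' x) (at x)"
    and x: "\<kappa> < arc_height c d x"
  shows "gen_torus b \<epsilon> (arc_cutoff c d g \<kappa>) x = \<gamma> * arc_cutoff c d g \<kappa> x"
proof -
  let ?u = "arc_cutoff c d g \<kappa>" and ?K = "exp (barrier b / \<epsilon>)"
  have "0 < arc_height c d x" using x \<kappa> by simp
  then obtain k :: int where k: "c + of_int k < x" "x < d + of_int k" using arc_height_pos_iff[OF cd] by blast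
  define V where "V = {y. \<kappa> < arc_height c d y} \<inter> {c + of_int k<..<d + of_int k}"
  have V: "open V" unfolding V_def
    by (intro open_Int open_Collect_less continuous_arc_height continuous_intros open_greaterThanLessThan)
  have xV: "x \<in> V" using x k by (simp add: V_def)
  have u: "?u y = g (y - of_int k)" if "y \<in> V" for y
    using that \<kappa> arc_extension_on_arc[OF cd(2), of y k g] by (simp add: V_def arc_cutoff_inside)
  have d1: "(?u has_real_derivative g' (y - of_int k)) (at y)" if y: "y \<in> V" for y
  proof (rule has_field_derivative_transform_within_open[OF _ V y])
    have "(g has_real_derivative g' (y - of_int k)) (at (y - of_int k))" using y by (intro dg) (auto simp: V_def)
    then show "((\<lambda>y. g (y - of_int k)) has_real_derivative g' (y - of_int k)) (at y)"
      using DERIV_shift[of g _ y "- of_int k"] by simp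
  qed (simp add: u)
  have e1: "deriv ?u y = g' (y - of_int k)" if "y \<in> V" for y by (rule DERIV_imp_deriv[OF d1[OF that]])
  have d2: "(deriv ?u has_real_derivative \<gamma> / (?K * \<epsilon>) * g (x - of_int k) - b (x - of_int k) / \<epsilon> * g' (x - of_int k)) (at x)"
  proof (rule has_field_derivative_transform_within_open[OF _ V xV])
    have "(g' has_real_derivative \<gamma> / (?K * \<epsilon>) * g (x - of_int k) - b (x - of_int k) / \<epsilon> * g' (x - of_int k)) (at (x - of_int k))"
      using xV by (intro dg') (auto simp: V_def)
    then show "((\<lambda>y. g' (y - of_int k)) has_real_derivative
        \<gamma> / (?K * \<epsilon>) * g (x - of_int k) - b (x - of_int k) / \<epsilon> * g' (x - of_int k)) (at x)"
      using DERIV_shift[of g' _ x "- of_int k"] by simp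
  qed (simp add: e1)
  have "b (x - of_int k) = b x" using periodic1_int[OF per, of x "- k"] by simp
  then show ?thesis
    unfolding gen_torus_def DERIV_imp_deriv[OF d2] e1[OF xV] u[OF xV] using \<epsilon> by (simp add: field_simps)
qed

text \<open>Reals whose images on the circle are close differ by a small number and an integer: the argument of
  the quotient of the images gives the former, and a periodic function does not see the latter.\<close>

lemma continuous_on_torus_path:
  fixes F :: "real \<Rightarrow> real"
  assumes per: "periodic1 F" and F: "continuous_on UNIV F"
    and path: "continuous_on A (\<lambda>t. cis (2 * pi * x t))"
  shows "continuous_on A (\<lambda>t. F (x t))"
  unfolding continuous_on_def
proof
  fix s assume s: "s \<in> A"
  define z where "z t = cis (2 * pi * x t) * cis (- (2 * pi * x s))" for t
  define \<delta> where "\<delta> t = Arg (z t) / (2 * pi)" for t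
  have z1: "z s = 1" by (simp add: z_def cis_mult)
  have "continuous_on A z" unfolding z_def by (intro continuous_intros path)
  then have "(z \<longlongrightarrow> 1) (at s within A)" using s z1 by (auto simp: continuous_on_def)
  moreover have "isCont Arg 1" by (rule continuous_at_Arg) (simp add: complex_nonpos_Reals_iff)
  ultimately have "((\<lambda>t. Arg (z t)) \<longlongrightarrow> Arg 1) (at s within A)"
    by (rule isCont_tendsto_compose[rotated])
  then have "((\<lambda>t. x s + \<delta> t) \<longlongrightarrow> x s + Arg 1 / (2 * pi)) (at s within A)"
    unfolding \<delta>_def by (intro tendsto_add[OF tendsto_const] tendsto_divide[OF _ tendsto_const]) auto
  then have "((\<lambda>t. F (x s + \<delta> t)) \<longlongrightarrow> F (x s)) (at s within A)"
    using F by (intro isCont_tendsto_compose[of "x s" F]) (auto simp: continuous_on_eq_continuous_at)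
  moreover have "F (x s + \<delta> t) = F (x t)" for t
  proof -
    have "cis (Arg (z t)) = z t" by (subst cis_Arg) (auto simp: z_def cis_mult sgn_eq)
    then have "cis (2 * pi * \<delta> t) = cis (2 * pi * x t - 2 * pi * x s)" by (simp add: \<delta>_def z_def cis_mult)
    then have "sin (2 * pi * x t - 2 * pi * x s) = sin (2 * pi * \<delta> t) \<and> cos (2 * pi * x t - 2 * pi * x s) = cos (2 * pi * \<delta> t)"
      by (auto simp: complex_eq_iff)
    then obtain n :: int where "2 * pi * x t - 2 * pi * x s = 2 * pi * \<delta> t + 2 * pi * of_int n"
      using sin_cos_eq_iff by blast
    then have "2 * pi * (x t) = 2 * pi * (x s + \<delta> t + of_int n)" by (simp add: algebra_simps)
    then have "x t = x s + \<delta> t + of_int n" by simp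
    then show ?thesis using periodic1_int[OF per, of "x s + \<delta> t" n] by simp
  qed
  ultimately show "((\<lambda>t. F (x t)) \<longlongrightarrow> F (x s)) (at s within A)" by simp
qed

section \<open>Markov processes stopped on leaving a region\<close>

lemma markov_process_lawD:
  assumes "markov_process E \<Omega> P Z" "x \<in> space E"
  shows "prob_space (P x)" "sets (P x) = sets \<Omega>" "space (P x) = space \<Omega>"
proof -
  have "P x \<in> space (prob_algebra \<Omega>)"
    using assms by (auto simp: markov_process_def dest: measurable_space)
  then show "prob_space (P x)" "sets (P x) = sets \<Omega>" by (auto simp: space_prob_algebra)
  then show "space (P x) = space \<Omega>" by (metis sets_eq_imp_space_eq)
qed

lemma markov_process_measurable:
  assumes "markov_process E \<Omega> P Z" "0 \<le> t"
  shows "Z t \<in> \<Omega> \<rightarrow>\<^sub>M E"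
  using assms by (simp add: markov_process_def)

lemma space_natural_filtration: "space (natural_filtration \<Omega> E Z t) = space \<Omega>"
  unfolding natural_filtration_def by (rule space_measure_of) auto

lemma sets_natural_filtration:
  "sets (natural_filtration \<Omega> E Z t) =
    sigma_sets (space \<Omega>) {Z u -` B \<inter> space \<Omega> | u B. 0 \<le> u \<and> u \<le> t \<and> B \<in> sets E}"
  unfolding natural_filtration_def by (rule sets_measure_of) auto

lemma natural_filtration_vimage:
  "0 \<le> u \<Longrightarrow> u \<le> t \<Longrightarrow> B \<in> sets E \<Longrightarrow> {\<omega> \<in> space \<Omega>. Z u \<omega> \<in> B} \<in> sets (natural_filtration \<Omega> E Z t)"
  unfolding sets_natural_filtration by (rule sigma_sets.Basic) auto

lemma sets_natural_filtration_subset: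
  assumes "markov_process E \<Omega> P Z"
  shows "sets (natural_filtration \<Omega> E Z t) \<subseteq> sets \<Omega>"
  unfolding sets_natural_filtration
  by (rule sets.sigma_sets_subset) (use assms in \<open>auto dest!: markov_process_measurable intro: measurable_sets\<close>)

lemma semigroup_bounded:
  fixes u :: "'x \<Rightarrow> real"
  assumes mp: "markov_process E \<Omega> P Z" and t: "0 \<le> t"
    and u: "u \<in> borel_measurable E" and bnd: "\<And>y. y \<in> space E \<Longrightarrow> \<bar>u y\<bar> \<le> C"
  shows "(\<lambda>y. \<integral>\<omega>. u (Z t \<omega>) \<partial>P y) \<in> borel_measurable E"
    and "x \<in> space E \<Longrightarrow> integrable (P x) (\<lambda>\<omega>. u (Z t \<omega>))"
    and "x \<in> space E \<Longrightarrow> \<bar>\<integral>\<omega>. u (Z t \<omega>) \<partial>P x\<bar> \<le> C"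
proof -
  note Zm = markov_process_measurable[OF mp t]
  have um: "(\<lambda>\<omega>. u (Z t \<omega>)) \<in> borel_measurable \<Omega>" by (rule measurable_compose[OF Zm u])
  have "P \<in> E \<rightarrow>\<^sub>M subprob_algebra \<Omega>"
    using mp by (auto simp: markov_process_def intro: measurable_prob_algebraD)
  then show "(\<lambda>y. \<integral>\<omega>. u (Z t \<omega>) \<partial>P y) \<in> borel_measurable E"
    by (rule measurable_compose[OF _ integral_measurable_subprob_algebra[OF um]])
  assume x: "x \<in> space E"
  note law = markov_process_lawD[OF mp x]
  interpret prob_space "P x" by (rule law)
  have uC: "\<bar>u (Z t \<omega>)\<bar> \<le> C" if "\<omega> \<in> space (P x)" for \<omega>
    using bnd[OF measurable_space[OF Zm]] that by (simp add: law)
  have "(\<lambda>\<omega>. u (Z t \<omega>)) \<in> borel_measurable (P x)" using um measurable_cong_sets[OF law(2) refl] by blast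
  then show int: "integrable (P x) (\<lambda>\<omega>. u (Z t \<omega>))"
    by (rule integrable_const_bound[of _ C, rotated]) (use uC in auto)
  have "\<bar>\<integral>\<omega>. u (Z t \<omega>) \<partial>P x\<bar> \<le> (\<integral>\<omega>. \<bar>u (Z t \<omega>)\<bar> \<partial>P x)" by (rule integral_abs_bound)
  also have "\<dots> \<le> (\<integral>\<omega>. C \<partial>P x)" by (intro integral_mono integrable_abs int) (use uC in auto)
  finally show "\<bar>\<integral>\<omega>. u (Z t \<omega>) \<partial>P x\<bar> \<le> C" by (simp add: prob_space)
qed

text \<open>On the event \<open>A\<close>, the law of \<open>Z (s + t)\<close> is that of \<open>Z s\<close> composed with the transition kernel. The
  two measures agree on every set, by the definition of a Markov process, so they have the same
  integrals.\<close>

lemma markov_property: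
  fixes u :: "'x \<Rightarrow> real"
  assumes mp: "markov_process E \<Omega> P Z" and x: "x \<in> space E" and s: "0 \<le> s" and t: "0 \<le> t"
    and A: "A \<in> sets (natural_filtration \<Omega> E Z s)"
    and u: "u \<in> borel_measurable E" and bnd: "\<And>y. y \<in> space E \<Longrightarrow> \<bar>u y\<bar> \<le> C"
  shows "(\<integral>\<omega>. indicator A \<omega> * u (Z (s + t) \<omega>) \<partial>P x) =
    (\<integral>\<omega>. indicator A \<omega> * (\<integral>\<omega>'. u (Z t \<omega>') \<partial>P (Z s \<omega>)) \<partial>P x)"
proof -
  note law = markov_process_lawD[OF mp x]
  interpret prob_space "P x" by (rule law)
  let ?F = "natural_filtration \<Omega> E Z s"
  interpret finite_measure_subalgebra "P x" ?F
    by unfold_locales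
      (auto simp: subalgebra_def space_natural_filtration law
        intro: subsetD[OF sets_natural_filtration_subset[OF mp]])
  have Zst: "Z (s + t) \<in> \<Omega> \<rightarrow>\<^sub>M E" "Z s \<in> \<Omega> \<rightarrow>\<^sub>M E" "Z t \<in> \<Omega> \<rightarrow>\<^sub>M E"
    using s t by (auto intro: markov_process_measurable[OF mp])
  have meas: "measurable (P x) N = measurable \<Omega> N" for N :: "'c measure"
    by (rule measurable_cong_sets[OF law(2) refl])
  have APx: "A \<in> sets (P x)" using A sets_natural_filtration_subset[OF mp] law(2) by auto
  have Zsp: "Z s \<omega> \<in> space E" if "\<omega> \<in> space \<Omega>" for \<omega>
    using measurable_space[OF Zst(2) that] .
  define \<mu> where "\<mu> = density (P x) (indicator A)"
  have sets_\<mu>: "sets \<mu> = sets \<Omega>" "space \<mu> = space \<Omega>" by (simp_all add: \<mu>_def law)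
  have ne: "space \<mu> \<noteq> {}" using not_empty by (simp add: sets_\<mu> law)
  have meas\<mu>: "measurable \<mu> N = measurable \<Omega> N" for N :: "'c measure"
    by (rule measurable_cong_sets[OF sets_\<mu>(1) refl])
  have int\<mu>: "(\<integral>\<omega>. f \<omega> \<partial>\<mu>) = (\<integral>\<omega>. indicator A \<omega> * f \<omega> \<partial>P x)" if "f \<in> borel_measurable \<Omega>" for f :: "_ \<Rightarrow> real"
  proof -
    have \<mu>': "\<mu> = density (P x) (\<lambda>\<omega>. ennreal (indicator A \<omega>))" by (simp add: \<mu>_def ennreal_indicator)
    have "f \<in> borel_measurable (P x)" using that by (simp add: meas)
    from integral_density[OF this borel_measurable_indicator[OF APx]] show ?thesis by (simp add: \<mu>')
  qed
  define k where "k \<omega> = distr (P (Z s \<omega>)) E (Z t)" for \<omega>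
  have km: "k \<in> \<mu> \<rightarrow>\<^sub>M subprob_algebra E"
  proof -
    have "P \<in> E \<rightarrow>\<^sub>M subprob_algebra \<Omega>"
      using mp by (auto simp: markov_process_def intro: measurable_prob_algebraD)
    then have "(\<lambda>\<omega>. P (Z s \<omega>)) \<in> \<Omega> \<rightarrow>\<^sub>M subprob_algebra \<Omega>" by (rule measurable_compose[OF Zst(2)])
    then show ?thesis
      unfolding k_def meas\<mu> by (rule measurable_compose[OF _ measurable_distr[OF Zst(3)]])
  qed
  have fin: "finite_measure \<mu>"
    unfolding \<mu>_def by (rule finite_measure_restricted[OF APx])
  have eq: "distr \<mu> E (Z (s + t)) = \<mu> \<bind> k"
  proof (rule measure_eqI)
    show "sets (distr \<mu> E (Z (s + t))) = sets (\<mu> \<bind> k)" using sets_bind[OF sets_kernel[OF km] ne] by simp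
    fix B assume "B \<in> sets (distr \<mu> E (Z (s + t)))"
    then have B: "B \<in> sets E" by simp
    let ?g = "\<lambda>\<omega>. measure (P (Z s \<omega>)) {\<omega>' \<in> space \<Omega>. Z t \<omega>' \<in> B}"
    have ZB: "{\<omega>' \<in> space \<Omega>. Z r \<omega>' \<in> B} \<in> sets \<Omega>" if "0 \<le> r" for r
      using measurable_sets[OF markov_process_measurable[OF mp that] B] by (simp add: vimage_def Int_def conj_commute)
    have kB: "emeasure (k \<omega>) B = ennreal (?g \<omega>)" if \<omega>: "\<omega> \<in> space \<Omega>" for \<omega>
    proof -
      note law' = markov_process_lawD[OF mp Zsp[OF \<omega>]]
      interpret Q: prob_space "P (Z s \<omega>)" by (rule law')
      have "Z t \<in> P (Z s \<omega>) \<rightarrow>\<^sub>M E" using Zst(3) measurable_cong_sets[OF law'(2) refl] by blast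
      then show ?thesis
        using B by (simp add: k_def emeasure_distr law' Q.emeasure_eq_measure vimage_def Int_def conj_commute)
    qed
    have gm: "?g \<in> borel_measurable \<Omega>"
    proof -
      have "(\<lambda>\<omega>. enn2real (emeasure (k \<omega>) B)) \<in> borel_measurable \<mu>"
        using measurable_compose[OF km measurable_emeasure_subprob_algebra[OF B]] by measurable
      then have "(\<lambda>\<omega>. enn2real (emeasure (k \<omega>) B)) \<in> borel_measurable \<Omega>" by (simp only: meas\<mu>)
      then show ?thesis by (rule iffD1[OF measurable_cong, rotated]) (simp add: kB)
    qed
    have im: "(\<lambda>\<omega>. indicator B (Z (s + t) \<omega>) :: real) \<in> borel_measurable \<Omega>"
      by (rule measurable_compose[OF Zst(1) borel_measurable_indicator[OF B]])
    have int1: "integrable (P x) (\<lambda>\<omega>. indicator B (Z (s + t) \<omega>) :: real)"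
      using im by (intro integrable_const_bound[of _ 1]) (auto simp: meas)
    have "(\<integral>\<omega>\<in>A. indicator B (Z (s + t) \<omega>) \<partial>P x) =
        (\<integral>\<omega>\<in>A. real_cond_exp (P x) ?F (\<lambda>\<omega>. indicator B (Z (s + t) \<omega>)) \<omega> \<partial>P x)"
      by (rule real_cond_exp_intA[OF int1 A])
    also have "\<dots> = (\<integral>\<omega>\<in>A. ?g \<omega> \<partial>P x)"
    proof -
      have "AE \<omega> in P x. real_cond_exp (P x) ?F (\<lambda>\<omega>. indicator B (Z (s + t) \<omega>)) \<omega> = ?g \<omega>"
        using mp x s t B unfolding markov_process_def by blast
      then show ?thesis
        unfolding set_lebesgue_integral_def
        by (intro integral_cong_AE borel_measurable_scaleR borel_measurable_indicator APx
            borel_measurable_cond_exp2) (auto simp: meas gm)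
    qed
    finally have eq: "(\<integral>\<omega>. indicator B (Z (s + t) \<omega>) \<partial>\<mu>) = (\<integral>\<omega>. ?g \<omega> \<partial>\<mu>)"
      by (simp add: int\<mu>[OF im] int\<mu>[OF gm] set_lebesgue_integral_def)
    have "emeasure (distr \<mu> E (Z (s + t))) B = (\<integral>\<^sup>+ \<omega>. ennreal (indicator B (Z (s + t) \<omega>)) \<partial>\<mu>)"
      using B Zst(1) by (subst emeasure_distr)
        (auto simp: meas\<mu> sets_\<mu> ZB ennreal_indicator nn_integral_indicator[symmetric] simp del: nn_integral_indicator
          intro!: nn_integral_cong split: split_indicator)
    also have "\<dots> = ennreal (\<integral>\<omega>. indicator B (Z (s + t) \<omega>) \<partial>\<mu>)"
      by (intro nn_integral_eq_integral finite_measure.integrable_const_bound[OF fin, of _ 1]) (auto simp: meas\<mu> im)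
    also have "\<dots> = (\<integral>\<^sup>+ \<omega>. ennreal (?g \<omega>) \<partial>\<mu>)"
      unfolding eq
      by (intro nn_integral_eq_integral[symmetric] finite_measure.integrable_const_bound[OF fin, of _ 1])
        (use prob_space.prob_le_1[OF markov_process_lawD(1)[OF mp Zsp]] in \<open>auto simp: meas\<mu> gm sets_\<mu>\<close>)
    also have "\<dots> = emeasure (\<mu> \<bind> k) B"
      unfolding emeasure_bind[OF ne km B] by (intro nn_integral_cong) (simp add: kB sets_\<mu>)
    finally show "emeasure (distr \<mu> E (Z (s + t))) B = emeasure (\<mu> \<bind> k) B" .
  qed
  have uk: "(\<integral>y. u y \<partial>k \<omega>) = (\<integral>\<omega>'. u (Z t \<omega>') \<partial>P (Z s \<omega>))" "emeasure (k \<omega>) (space (k \<omega>)) \<le> ennreal 1"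
    if \<omega>: "\<omega> \<in> space \<Omega>" for \<omega>
  proof -
    note law' = markov_process_lawD[OF mp Zsp[OF \<omega>]]
    have Zt: "Z t \<in> P (Z s \<omega>) \<rightarrow>\<^sub>M E" using Zst(3) measurable_cong_sets[OF law'(2) refl] by blast
    show "(\<integral>y. u y \<partial>k \<omega>) = (\<integral>\<omega>'. u (Z t \<omega>') \<partial>P (Z s \<omega>))" unfolding k_def by (rule integral_distr[OF Zt u])
    show "emeasure (k \<omega>) (space (k \<omega>)) \<le> ennreal 1"
      using prob_space.emeasure_space_1[OF prob_space.prob_space_distr[OF law'(1) Zt]] by (simp add: k_def)
  qed
  have "(\<integral>\<omega>. u (Z (s + t) \<omega>) \<partial>\<mu>) = (\<integral>y. u y \<partial>(\<mu> \<bind> k))"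
    unfolding eq[symmetric] by (rule integral_distr[symmetric]) (simp_all add: meas\<mu> Zst u)
  also have "\<dots> = (\<integral>\<omega>. (\<integral>y. u y \<partial>k \<omega>) \<partial>\<mu>)"
    by (rule integral_bind[OF u bnd km fin, of 1]) (auto simp: sets_\<mu> uk(2) simp del: ennreal_1)
  also have "\<dots> = (\<integral>\<omega>. (\<integral>\<omega>'. u (Z t \<omega>') \<partial>P (Z s \<omega>)) \<partial>\<mu>)"
    by (rule Bochner_Integration.integral_cong) (simp_all add: sets_\<mu> uk(1))
  finally show ?thesis
    using int\<mu>[OF measurable_compose[OF Zst(1) u]]
      int\<mu>[OF measurable_compose[OF Zst(2) semigroup_bounded(1)[OF mp t u bnd]]] by simp
qed

text \<open>The cap \<open>T\<close> keeps the exit time real-valued when \<open>D\<close> is never left.\<close>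

definition exit_time :: "(real \<Rightarrow> 'w \<Rightarrow> 'x) \<Rightarrow> 'x set \<Rightarrow> real \<Rightarrow> 'w \<Rightarrow> real"
  where "exit_time Z D T \<omega> = Inf (insert T {s. 0 \<le> s \<and> Z s \<omega> \<notin> D})"

lemma exit_time_bdd: "bdd_below (insert (T :: real) {s. 0 \<le> s \<and> Z s \<omega> \<notin> D})"
  by (rule bdd_belowI[of _ "min 0 T"]) (auto simp: min_le_iff_disj)

lemma exit_time_le: "exit_time Z D T \<omega> \<le> T"
  unfolding exit_time_def by (rule cInf_lower[OF _ exit_time_bdd]) simp

lemma exit_time_le_outside: "0 \<le> s \<Longrightarrow> Z s \<omega> \<notin> D \<Longrightarrow> exit_time Z D T \<omega> \<le> s"
  unfolding exit_time_def by (rule cInf_lower[OF _ exit_time_bdd]) simp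

lemma exit_time_nonneg: "0 \<le> T \<Longrightarrow> 0 \<le> exit_time Z D T \<omega>"
  unfolding exit_time_def by (rule cInf_greatest) auto

lemma exit_time_before: "0 \<le> s \<Longrightarrow> s < exit_time Z D T \<omega> \<Longrightarrow> Z s \<omega> \<in> D"
  using exit_time_le_outside[of s Z \<omega> D T] by force

lemma exit_time_ge:
  "s \<le> T \<Longrightarrow> (\<And>r. 0 \<le> r \<Longrightarrow> r < s \<Longrightarrow> Z r \<omega> \<in> D) \<Longrightarrow> s \<le> exit_time Z D T \<omega>"
  unfolding exit_time_def by (rule cInf_greatest) force+

lemma exit_time_mono: "D \<subseteq> D' \<Longrightarrow> exit_time Z D T \<omega> \<le> exit_time Z D' T \<omega>"
  unfolding exit_time_def by (rule cInf_superset_mono) (use exit_time_bdd in auto)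

lemma exit_time_outside_sequence:
  assumes "exit_time Z D T \<omega> < T" "0 \<le> T" "Z (exit_time Z D T \<omega>) \<omega> \<in> D" "0 < e"
  shows "\<exists>s. exit_time Z D T \<omega> < s \<and> s < exit_time Z D T \<omega> + e \<and> Z s \<omega> \<notin> D"
proof -
  have "Inf (insert T {s. 0 \<le> s \<and> Z s \<omega> \<notin> D}) < min T (exit_time Z D T \<omega> + e)"
    using assms by (simp add: exit_time_def)
  then obtain s where s: "s \<in> insert T {s. 0 \<le> s \<and> Z s \<omega> \<notin> D}" "s < min T (exit_time Z D T \<omega> + e)"
    using cInf_lessD[of "insert T {s. 0 \<le> s \<and> Z s \<omega> \<notin> D}"] by blast
  then have "0 \<le> s" "Z s \<omega> \<notin> D" by auto
  then have "exit_time Z D T \<omega> \<le> s" by (rule exit_time_le_outside)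
  moreover have "exit_time Z D T \<omega> \<noteq> s" using assms(3) \<open>Z s \<omega> \<notin> D\<close> by auto
  ultimately show ?thesis using s \<open>Z s \<omega> \<notin> D\<close> by (intro exI[of _ s]) auto
qed

text \<open>A value along a path, read off at the first point of the grid \<open>{k T / (n + 1)}\<close> by which the
  path has left \<open>D\<close>. Written as a telescoping sum, it involves the path at fixed times only.\<close>

definition grid_exit_value ::
  "'w measure \<Rightarrow> (real \<Rightarrow> 'w \<Rightarrow> 'x) \<Rightarrow> 'x set \<Rightarrow> real \<Rightarrow> (real \<Rightarrow> 'w \<Rightarrow> real) \<Rightarrow> nat \<Rightarrow> 'w \<Rightarrow> real"
  where "grid_exit_value M Z D T \<Phi> n \<omega> = (let \<delta> = T / real (Suc n) in
    \<Phi> 0 \<omega> + (\<Sum>k<Suc n. indicator {\<omega> \<in> space M. \<forall>s\<in>{0..real k * \<delta>}. Z s \<omega> \<in> D} \<omega> *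
      (\<Phi> (real k * \<delta> + \<delta>) \<omega> - \<Phi> (real k * \<delta>) \<omega>)))"

lemma grid_exit_value_eq:
  fixes Z :: "real \<Rightarrow> 'w \<Rightarrow> 'x" and D :: "'x set" and T :: real
  assumes \<omega>: "\<omega> \<in> space M" and T: "0 \<le> T"
  defines "\<tau> \<equiv> exit_time Z D T"
  shows "\<exists>t. \<tau> \<omega> \<le> t \<and> t \<le> \<tau> \<omega> + T / real (Suc n) \<and> t \<le> T \<and> grid_exit_value M Z D T \<Phi> n \<omega> = \<Phi> t \<omega>"
proof -
  define \<delta> where "\<delta> = T / real (Suc n)"
  have \<delta>0: "0 \<le> \<delta>" using T by (simp add: \<delta>_def)
  have \<delta>T: "real k * \<delta> \<le> T" if "k \<le> Suc n" for k
  proof -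
    have "real k * \<delta> \<le> real (Suc n) * \<delta>" using that \<delta>0 by (intro mult_right_mono) auto
    then show ?thesis by (simp add: \<delta>_def)
  qed
  define A where "A t = {\<omega> \<in> space M. \<forall>s\<in>{0..t}. Z s \<omega> \<in> D}" for t
  define N where "N = (LEAST k. k = Suc n \<or> \<omega> \<notin> A (real k * \<delta>))"
  have N: "N = Suc n \<or> \<omega> \<notin> A (real N * \<delta>)"
    unfolding N_def by (rule LeastI[of _ "Suc n"]) simp
  have Nle: "N \<le> Suc n" unfolding N_def by (rule Least_le) simp
  have below: "\<omega> \<in> A (real k * \<delta>)" if "k < N" for k
    using not_less_Least[OF that[unfolded N_def]] by simp
  have above: "\<omega> \<notin> A (real k * \<delta>)" if "N \<le> k" "k < Suc n" for k
  proof -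
    have "\<omega> \<notin> A (real N * \<delta>)" using N that by auto
    moreover have "real N * \<delta> \<le> real k * \<delta>" using that \<delta>0 by (intro mult_right_mono) auto
    ultimately show ?thesis by (fastforce simp: A_def)
  qed
  have "(\<Sum>k<Suc n. indicator (A (real k * \<delta>)) \<omega> *
      (\<Phi> (real k * \<delta> + \<delta>) \<omega> - \<Phi> (real k * \<delta>) \<omega>)) =
      (\<Sum>k<N. \<Phi> (real k * \<delta> + \<delta>) \<omega> - \<Phi> (real k * \<delta>) \<omega>)"
    by (rule sum.mono_neutral_cong_right) (use Nle above below in auto)
  also have "\<dots> = (\<Sum>k<N. \<Phi> (real (Suc k) * \<delta>) \<omega> - \<Phi> (real k * \<delta>) \<omega>)"
    by (simp add: algebra_simps)
  also have "\<dots> = \<Phi> (real N * \<delta>) \<omega> - \<Phi> (real 0 * \<delta>) \<omega>"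
    by (rule sum_lessThan_telescope)
  finally have "grid_exit_value M Z D T \<Phi> n \<omega> = \<Phi> (real N * \<delta>) \<omega>"
    unfolding grid_exit_value_def Let_def \<delta>_def[symmetric] A_def[symmetric] by simp
  moreover have "\<tau> \<omega> \<le> real N * \<delta>"
  proof (cases "N = Suc n")
    case True
    then have "real N * \<delta> = T" by (simp add: \<delta>_def)
    then show ?thesis using exit_time_le[of Z D T \<omega>] by (simp add: \<tau>_def)
  next
    case False
    then obtain s where s: "0 \<le> s" "s \<le> real N * \<delta>" "Z s \<omega> \<notin> D" using N \<omega> by (auto simp: A_def)
    then show ?thesis using exit_time_le_outside[of s Z \<omega> D T] by (simp add: \<tau>_def)
  qed
  moreover have "real N * \<delta> \<le> \<tau> \<omega> + \<delta>"
  proof (cases N)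
    case 0
    then show ?thesis using add_nonneg_nonneg[OF exit_time_nonneg[OF T] \<delta>0] by (simp add: \<tau>_def)
  next
    case (Suc k)
    then have "\<omega> \<in> A (real k * \<delta>)" "real k * \<delta> \<le> T" using below \<delta>T[of k] Nle by auto
    then have "real k * \<delta> \<le> \<tau> \<omega>" unfolding \<tau>_def by (intro exit_time_ge) (auto simp: A_def)
    then show ?thesis by (simp add: Suc algebra_simps)
  qed
  ultimately show ?thesis using \<delta>T[OF Nle] unfolding \<delta>_def by blast
qed

lemma grid_exit_value_tendsto:
  fixes Z :: "real \<Rightarrow> 'w \<Rightarrow> 'x"
  assumes \<omega>: "\<omega> \<in> space M" and T: "0 \<le> T"
    and rc: "continuous (at_right (exit_time Z D T \<omega>)) (\<lambda>s. \<Phi> s \<omega>)"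
  shows "(\<lambda>n. grid_exit_value M Z D T \<Phi> n \<omega>) \<longlonglongrightarrow> \<Phi> (exit_time Z D T \<omega>) \<omega>"
proof -
  let ?\<tau> = "exit_time Z D T \<omega>"
  obtain t where t: "\<And>n. ?\<tau> \<le> t n" "\<And>n. t n \<le> ?\<tau> + T / real (Suc n)"
    "\<And>n. grid_exit_value M Z D T \<Phi> n \<omega> = \<Phi> (t n) \<omega>"
    using grid_exit_value_eq[OF \<omega> T] by metis
  have tlim: "t \<longlonglongrightarrow> ?\<tau>"
  proof (rule tendsto_sandwich[of "\<lambda>_. ?\<tau>" _ _ "\<lambda>n. ?\<tau> + T / real (Suc n)"])
    show "(\<lambda>n. ?\<tau> + T / real (Suc n)) \<longlonglongrightarrow> ?\<tau>"
      using tendsto_add[OF tendsto_const LIMSEQ_Suc[OF lim_const_over_n], of ?\<tau> T] by simp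
  qed (use t in auto)
  have "at ?\<tau> within {?\<tau>..} = at_right ?\<tau>"
    unfolding at_within_def by (rule arg_cong[where f = "\<lambda>S. inf (nhds ?\<tau>) (principal S)"]) auto
  then have "continuous (at ?\<tau> within {?\<tau>..}) (\<lambda>s. \<Phi> s \<omega>)" using rc by simp
  then show ?thesis
    unfolding t(3) by (rule continuous_within_tendsto_compose'[OF _ _ tlim]) (simp add: t(1))
qed

lemma exit_value_measurable:
  fixes Z :: "real \<Rightarrow> 'w \<Rightarrow> 'x"
  assumes \<Phi>: "\<And>t. 0 \<le> t \<Longrightarrow> \<Phi> t \<in> borel_measurable M"
    and stays: "\<And>t. 0 \<le> t \<Longrightarrow> {\<omega> \<in> space M. \<forall>s\<in>{0..t}. Z s \<omega> \<in> D} \<in> sets M"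
    and rc: "\<And>\<omega> t. \<omega> \<in> space M \<Longrightarrow> 0 \<le> t \<Longrightarrow> continuous (at_right t) (\<lambda>s. \<Phi> s \<omega>)"
    and T: "0 \<le> T"
  shows "(\<lambda>\<omega>. \<Phi> (exit_time Z D T \<omega>) \<omega>) \<in> borel_measurable M"
    and "grid_exit_value M Z D T \<Phi> n \<in> borel_measurable M"
proof -
  show grid: "grid_exit_value M Z D T \<Phi> n \<in> borel_measurable M" for n
    unfolding grid_exit_value_def Let_def
    by (intro borel_measurable_add borel_measurable_sum borel_measurable_times borel_measurable_diff
        borel_measurable_indicator stays \<Phi>) (use T in auto)
  show "(\<lambda>\<omega>. \<Phi> (exit_time Z D T \<omega>) \<omega>) \<in> borel_measurable M"
    by (rule borel_measurable_LIMSEQ_real[OF grid_exit_value_tendsto grid])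
      (auto intro: T rc exit_time_nonneg)
qed

text \<open>An eigenfunction of the generator with eigenvalue \<open>lam\<close> is, after the discount \<open>exp (- lam t)\<close>, invariant
  under the semigroup to first order in \<open>t\<close>, uniformly where the eigenvalue equation holds.\<close>

lemma discounted_generator_limit:
  fixes lam C :: real and p :: "real \<Rightarrow> 'x \<Rightarrow> real"
  assumes gen: "uniform_limit D (\<lambda>t y. (p t y - u y) / t) (\<lambda>y. lam * u y) (at_right 0)"
    and bnd: "\<And>y. y \<in> D \<Longrightarrow> \<bar>u y\<bar> \<le> C"
  shows "uniform_limit D (\<lambda>t y. (exp (- lam * t) * p t y - u y) / t) (\<lambda>_. 0) (at_right 0)"
proof (rule uniform_limitI)
  fix e :: real assume e: "0 < e"
  define r where "r t = exp (- lam * t) * lam + (exp (- lam * t) - 1) / t" for t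
  have "((\<lambda>t. exp (- lam * t)) has_real_derivative - lam) (at 0)"
    by (auto intro!: derivative_eq_intros)
  then have "((\<lambda>t. (exp (- lam * t) - 1) / t) \<longlongrightarrow> - lam) (at 0)"
    by (simp add: has_field_derivative_iff)
  then have lim1: "((\<lambda>t. (exp (- lam * t) - 1) / t) \<longlongrightarrow> - lam) (at_right 0)"
    by (rule tendsto_mono[rotated]) (simp add: at_le)
  have lim2: "((\<lambda>t. exp (- lam * t)) \<longlongrightarrow> 1) (at_right 0)"
    by (auto intro!: tendsto_eq_intros)
  have "(r \<longlongrightarrow> 1 * lam + - lam) (at_right 0)"
    unfolding r_def by (intro tendsto_intros lim1 lim2)
  then have lim3: "((\<lambda>t. exp (- lam * t) * (e / 4) + \<bar>r t\<bar> * \<bar>C\<bar>) \<longlongrightarrow> 1 * (e / 4) + \<bar>0\<bar> * \<bar>C\<bar>) (at_right 0)"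
    by (intro tendsto_intros lim2) simp
  have "\<forall>\<^sub>F t in at_right 0. exp (- lam * t) * (e / 4) + \<bar>r t\<bar> * \<bar>C\<bar> < e"
    by (rule order_tendstoD(2)[OF lim3]) (use e in simp)
  moreover have "\<forall>\<^sub>F t in at_right 0. \<forall>y\<in>D. dist ((p t y - u y) / t) (lam * u y) < e / 4"
    using e by (intro uniform_limitD[OF gen]) simp
  moreover have "\<forall>\<^sub>F t in at_right (0::real). 0 < t" by (simp add: eventually_at_right_less)
  ultimately show "\<forall>\<^sub>F t in at_right 0. \<forall>y\<in>D. dist ((exp (- lam * t) * p t y - u y) / t) 0 < e"
  proof eventually_elim
    case (elim t)
    show ?case
    proof
      fix y assume y: "y \<in> D"
      have "(exp (- lam * t) * p t y - u y) / t =
          exp (- lam * t) * ((p t y - u y) / t - lam * u y) + r t * u y"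
        unfolding r_def using elim(3) by (simp add: field_simps)
      also have "\<bar>\<dots>\<bar> \<le> exp (- lam * t) * \<bar>(p t y - u y) / t - lam * u y\<bar> + \<bar>r t\<bar> * \<bar>u y\<bar>"
        by (rule order_trans[OF abs_triangle_ineq]) (simp add: abs_mult)
      also have "\<dots> \<le> exp (- lam * t) * (e / 4) + \<bar>r t\<bar> * \<bar>C\<bar>"
        using elim(2) y bnd[OF y] by (intro add_mono mult_left_mono) (auto simp: dist_real_def less_imp_le)
      also have "\<dots> < e" by (rule elim(1))
      finally show "dist ((exp (- lam * t) * p t y - u y) / t) 0 < e" by (simp add: dist_real_def)
    qed
  qed
qed

lemma exp_weight_bound:
  fixes t T lam :: real
  assumes "0 \<le> t" "t \<le> T"
  shows "exp (- lam * t) \<le> exp (\<bar>lam\<bar> * T)"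
proof -
  have "- lam * t \<le> \<bar>lam\<bar> * t" using assms by (intro mult_right_mono) auto
  also have "\<dots> \<le> \<bar>lam\<bar> * T" using assms by (intro mult_left_mono) auto
  finally show ?thesis by simp
qed

text \<open>Optional stopping for an eigenfunction of the generator. Each increment of the grid value before the
  exit starts from a point of \<open>D\<close>, so by the Markov property its expectation is \<open>o(\<delta>)\<close>, uniformly, where
  \<open>\<delta>\<close> is the grid width. There are about \<open>T / \<delta>\<close> of them, hence the expectation of the grid value tends to
  \<open>u x\<close>. It also tends to the expectation of the value at the exit time, by right-continuity.\<close>

lemma expectation_at_exit:
  fixes u :: "'x \<Rightarrow> real" and lam C T :: real
  assumes mp: "markov_process E \<Omega> P Z" and x: "x \<in> space E"
    and u: "u \<in> borel_measurable E" and bnd: "\<And>y. y \<in> space E \<Longrightarrow> \<bar>u y\<bar> \<le> C"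
    and D: "D \<subseteq> space E"
    and gen: "uniform_limit D (\<lambda>t y. ((\<integral>\<omega>. u (Z t \<omega>) \<partial>P y) - u y) / t) (\<lambda>y. lam * u y) (at_right 0)"
    and G: "\<And>t. 0 \<le> t \<Longrightarrow> {\<omega> \<in> space \<Omega>. \<forall>s\<in>{0..t}. Z s \<omega> \<in> D} \<in> sets (natural_filtration \<Omega> E Z t)"
    and rc: "\<And>\<omega> t. \<omega> \<in> space \<Omega> \<Longrightarrow> 0 \<le> t \<Longrightarrow> continuous (at_right t) (\<lambda>s. u (Z s \<omega>))"
    and T: "0 \<le> T"
  shows "(\<integral>\<omega>. exp (- lam * exit_time Z D T \<omega>) * u (Z (exit_time Z D T \<omega>) \<omega>) \<partial>P x) = u x"
proof -
  interpret prob_space "P x" by (rule markov_process_lawD[OF mp x])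
  have sets_Px: "sets (P x) = sets \<Omega>" and sp: "space (P x) = space \<Omega>"
    by (rule markov_process_lawD[OF mp x])+
  have Zm: "Z t \<in> \<Omega> \<rightarrow>\<^sub>M E" if "0 \<le> t" for t by (rule markov_process_measurable[OF mp that])
  have uZm: "(\<lambda>\<omega>. u (Z t \<omega>)) \<in> borel_measurable (P x)" if "0 \<le> t" for t
    using measurable_compose[OF Zm[OF that] u] measurable_cong_sets[OF sets_Px refl] by blast
  have Zsp: "Z t \<omega> \<in> space E" if "0 \<le> t" "\<omega> \<in> space \<Omega>" for t \<omega>
    using measurable_space[OF Zm[OF that(1)] that(2)] .
  define A where "A t = {\<omega> \<in> space \<Omega>. \<forall>s\<in>{0..t}. Z s \<omega> \<in> D}" for t
  have AF: "A t \<in> sets (natural_filtration \<Omega> E Z t)" if "0 \<le> t" for t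
    unfolding A_def by (rule G[OF that])
  have APx: "A t \<in> sets (P x)" if "0 \<le> t" for t
    using AF[OF that] sets_natural_filtration_subset[OF mp] sets_Px by blast
  define \<Phi> where "\<Phi> t \<omega> = exp (- lam * t) * u (Z t \<omega>)" for t \<omega>
  define \<tau> where "\<tau> = exit_time Z D T"
  define K where "K = exp (\<bar>lam\<bar> * T)"
  have expK: "exp (- lam * t) \<le> K" if "0 \<le> t" "t \<le> T" for t
    unfolding K_def by (rule exp_weight_bound[OF that])
  have \<Phi>m: "\<Phi> t \<in> borel_measurable (P x)" if "0 \<le> t" for t
    unfolding \<Phi>_def using uZm[OF that] by simp
  have \<Phi>b: "\<bar>\<Phi> t \<omega>\<bar> \<le> K * C" if "0 \<le> t" "t \<le> T" "\<omega> \<in> space \<Omega>" for t \<omega>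
    using expK[OF that(1,2)] bnd[OF Zsp[OF that(1,3)]]
    by (auto simp: \<Phi>_def abs_mult K_def intro!: mult_mono)
  define \<delta> where "\<delta> n = T / real (Suc n)" for n
  have \<delta>0: "0 \<le> \<delta> n" for n using T by (simp add: \<delta>_def)
  have \<delta>T: "real k * \<delta> n \<le> T" if "k \<le> Suc n" for k n
  proof -
    have "real k * \<delta> n \<le> real (Suc n) * \<delta> n" using that \<delta>0 by (intro mult_right_mono) auto
    then show ?thesis by (simp add: \<delta>_def)
  qed
  define \<Psi> where "\<Psi> n = grid_exit_value (P x) Z D T \<Phi> n" for n
  have \<Psi>_eq: "\<Psi> n \<omega> = \<Phi> 0 \<omega> + (\<Sum>k<Suc n. indicator (A (real k * \<delta> n)) \<omega> *
      (\<Phi> (real k * \<delta> n + \<delta> n) \<omega> - \<Phi> (real k * \<delta> n) \<omega>))" for n \<omega>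
    by (simp add: \<Psi>_def grid_exit_value_def Let_def \<delta>_def A_def sp)
  have grid: "\<exists>t. \<tau> \<omega> \<le> t \<and> t \<le> T \<and> \<Psi> n \<omega> = \<Phi> t \<omega>" if \<omega>: "\<omega> \<in> space \<Omega>" for \<omega> n
    using grid_exit_value_eq[of \<omega> "P x" T Z D n \<Phi>] \<omega> T unfolding \<tau>_def \<Psi>_def sp by blast
  have lim\<delta>: "\<delta> \<longlonglongrightarrow> 0" unfolding \<delta>_def by (rule LIMSEQ_Suc[OF lim_const_over_n])
  have \<tau>0: "0 \<le> \<tau> \<omega>" for \<omega> unfolding \<tau>_def by (rule exit_time_nonneg[OF T])
  have rc\<Phi>: "continuous (at_right t) (\<lambda>s. \<Phi> s \<omega>)" if "\<omega> \<in> space (P x)" "0 \<le> t" for \<omega> t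
    unfolding \<Phi>_def using that by (intro continuous_intros rc) (simp_all add: sp)
  have conv: "(\<lambda>n. \<Psi> n \<omega>) \<longlonglongrightarrow> \<Phi> (\<tau> \<omega>) \<omega>" if \<omega>: "\<omega> \<in> space \<Omega>" for \<omega>
    unfolding \<Psi>_def \<tau>_def using \<omega> \<tau>0[of \<omega>]
    by (intro grid_exit_value_tendsto T rc\<Phi>) (simp_all add: sp \<tau>_def)
  have stays: "{\<omega> \<in> space (P x). \<forall>s\<in>{0..t}. Z s \<omega> \<in> D} \<in> sets (P x)" if "0 \<le> t" for t
    using APx[OF that] by (simp add: A_def sp)
  note meas = exit_value_measurable[OF \<Phi>m stays rc\<Phi> T, folded \<tau>_def \<Psi>_def]
  note limm = meas(1) and \<Psi>m = meas(2)
  have start: "(\<integral>\<omega>. \<Phi> 0 \<omega> \<partial>P x) = u x"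
  proof -
    have "AE \<omega> in P x. Z 0 \<omega> = x" using mp x by (simp add: markov_process_def)
    then have "(\<integral>\<omega>. \<Phi> 0 \<omega> \<partial>P x) = (\<integral>\<omega>. u x \<partial>P x)"
      using uZm[of 0] by (intro integral_cong_AE) (auto simp: \<Phi>_def)
    then show ?thesis by (simp add: prob_space)
  qed
  have "(\<lambda>n. \<integral>\<omega>. \<Psi> n \<omega> \<partial>P x) \<longlonglongrightarrow> (\<integral>\<omega>. \<Phi> (\<tau> \<omega>) \<omega> \<partial>P x)"
  proof (rule integral_dominated_convergence[where w = "\<lambda>_. K * C"])
    show "AE \<omega> in P x. (\<lambda>n. \<Psi> n \<omega>) \<longlonglongrightarrow> \<Phi> (\<tau> \<omega>) \<omega>" using conv by (auto simp: sp)
    fix n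
    have "norm (\<Psi> n \<omega>) \<le> K * C" if "\<omega> \<in> space \<Omega>" for \<omega>
      using grid[OF that, of n] \<tau>0[of \<omega>] \<Phi>b[OF _ _ that] by force
    then show "AE \<omega> in P x. norm (\<Psi> n \<omega>) \<le> K * C" by (auto simp: sp)
  qed (use limm \<Psi>m in auto)
  moreover have "(\<lambda>n. \<integral>\<omega>. \<Psi> n \<omega> \<partial>P x) \<longlonglongrightarrow> u x"
  proof (cases "T = 0")
    case True
    have "\<Psi> n \<omega> = \<Phi> 0 \<omega>" for n \<omega> by (simp add: \<Psi>_eq \<delta>_def True)
    then show ?thesis using start by simp
  next
    case False
    then have T0: "0 < T" using T by simp
    have \<delta>pos: "0 < \<delta> n" for n using T0 by (simp add: \<delta>_def)
    show ?thesis
    proof (rule LIMSEQ_I)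
      fix e :: real assume e: "0 < e"
      \<comment> \<open>The increments add up to at most \<open>K e' T\<close>.\<close>
      define e' where "e' = e / (2 * K * T)"
      have K0: "0 < K" by (simp add: K_def)
      have e': "0 < e'" using e K0 T0 by (simp add: e'_def)
      have "uniform_limit D (\<lambda>t y. (exp (- lam * t) * (\<integral>\<omega>. u (Z t \<omega>) \<partial>P y) - u y) / t) (\<lambda>_. 0) (at_right 0)"
        by (rule discounted_generator_limit[OF gen bnd]) (use D in auto)
      then have "\<forall>\<^sub>F t in at_right 0. \<forall>y\<in>D.
          dist ((exp (- lam * t) * (\<integral>\<omega>. u (Z t \<omega>) \<partial>P y) - u y) / t) 0 < e'"
        by (rule uniform_limitD[OF _ e'])
      moreover have "filterlim \<delta> (at_right 0) sequentially"
        by (intro tendsto_imp_filterlim_at_right[OF lim\<delta>] always_eventually allI \<delta>pos)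
      ultimately have "\<forall>\<^sub>F n in sequentially. \<forall>y\<in>D.
          dist ((exp (- lam * \<delta> n) * (\<integral>\<omega>. u (Z (\<delta> n) \<omega>) \<partial>P y) - u y) / \<delta> n) 0 < e'"
        by (rule eventually_compose_filterlim)
      then obtain n0 where n0: "\<And>n y. n0 \<le> n \<Longrightarrow> y \<in> D \<Longrightarrow>
          dist ((exp (- lam * \<delta> n) * (\<integral>\<omega>. u (Z (\<delta> n) \<omega>) \<partial>P y) - u y) / \<delta> n) 0 < e'"
        unfolding eventually_sequentially by blast
      have "norm ((\<integral>\<omega>. \<Psi> n \<omega> \<partial>P x) - u x) < e" if n: "n0 \<le> n" for n
      proof -
        let ?t = "\<lambda>k. real k * \<delta> n"
        let ?R = "\<lambda>\<omega> y. \<integral>\<omega>. u (Z (\<delta> n) \<omega>) \<partial>P y"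
        have t0: "0 \<le> ?t k" for k using \<delta>0 by simp
        have int\<Phi>: "integrable (P x) (\<Phi> t)" if "0 \<le> t" for t
          by (rule integrable_const_bound[OF _ \<Phi>m[OF that], of "exp (- lam * t) * C"])
            (use bnd[OF Zsp[OF that]] in \<open>auto simp: sp \<Phi>_def abs_mult\<close>)
        have int1: "integrable (P x) (\<lambda>\<omega>. indicator (A s) \<omega> * \<Phi> t \<omega>)" if "0 \<le> s" "0 \<le> t" for s t
          using integrable_mult_indicator[OF APx[OF that(1)] int\<Phi>[OF that(2)]] by simp
        have step: "\<bar>\<integral>\<omega>. indicator (A (?t k)) \<omega> * (\<Phi> (?t k + \<delta> n) \<omega> - \<Phi> (?t k) \<omega>) \<partial>P x\<bar> \<le> K * (e' * \<delta> n)"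
          if k: "k < Suc n" for k
        proof -
          let ?p = "\<lambda>y. \<integral>\<omega>'. u (Z (\<delta> n) \<omega>') \<partial>P y"
          have tT: "?t k \<le> T" using \<delta>T[of k n] k by simp
          note pm = semigroup_bounded(1)[OF mp \<delta>0[of n] u bnd]
          have inD: "Z (?t k) \<omega> \<in> D" if "\<omega> \<in> A (?t k)" for \<omega>
            using that t0[of k] by (auto simp: A_def)
          have close: "\<bar>exp (- lam * \<delta> n) * ?p y - u y\<bar> \<le> e' * \<delta> n" if "y \<in> D" for y
            using n0[OF n that] \<delta>pos[of n] by (simp add: dist_real_def abs_divide field_simps)
          note pC = semigroup_bounded(3)[OF mp \<delta>0[of n] u bnd]
          have int2: "integrable (P x) (\<lambda>\<omega>. indicator (A (?t k)) \<omega> * ?p (Z (?t k) \<omega>))"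
          proof -
            have "integrable (P x) (\<lambda>\<omega>. ?p (Z (?t k) \<omega>))" by (rule semigroup_bounded(2)[OF mp t0 pm pC x])
            from integrable_mult_indicator[OF APx[OF t0] this] show ?thesis by simp
          qed
          have int3: "integrable (P x) (\<lambda>\<omega>. indicator (A (?t k)) \<omega> * u (Z (?t k) \<omega>))"
          proof -
            have "integrable (P x) (\<lambda>\<omega>. u (Z (?t k) \<omega>))" by (rule semigroup_bounded(2)[OF mp t0 u bnd x])
            from integrable_mult_indicator[OF APx[OF t0] this] show ?thesis by simp
          qed
          have factor: "e12 * a - e1 * c = e1 * (e2 * a - c)" if "e12 = e1 * e2" for e12 e1 e2 a c :: real
            by (simp add: that right_diff_distrib mult.assoc)
          have exp12: "exp (- lam * (?t k + \<delta> n)) = exp (- lam * ?t k) * exp (- lam * \<delta> n)"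
            by (simp add: exp_add[symmetric] distrib_left)
          have "(\<integral>\<omega>. indicator (A (?t k)) \<omega> * (\<Phi> (?t k + \<delta> n) \<omega> - \<Phi> (?t k) \<omega>) \<partial>P x) =
            (\<integral>\<omega>. indicator (A (?t k)) \<omega> * \<Phi> (?t k + \<delta> n) \<omega> \<partial>P x) - (\<integral>\<omega>. indicator (A (?t k)) \<omega> * \<Phi> (?t k) \<omega> \<partial>P x)"
            unfolding right_diff_distrib
            by (rule Bochner_Integration.integral_diff[OF int1[OF t0 add_nonneg_nonneg[OF t0 \<delta>0]] int1[OF t0 t0]])
          also have "(\<integral>\<omega>. indicator (A (?t k)) \<omega> * \<Phi> (?t k + \<delta> n) \<omega> \<partial>P x)
            = exp (- lam * (?t k + \<delta> n)) * (\<integral>\<omega>. indicator (A (?t k)) \<omega> * u (Z (?t k + \<delta> n) \<omega>) \<partial>P x)"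
            unfolding \<Phi>_def by (subst mult.left_commute) (rule integral_mult_right_zero)
          also have "(\<integral>\<omega>. indicator (A (?t k)) \<omega> * u (Z (?t k + \<delta> n) \<omega>) \<partial>P x) =
            (\<integral>\<omega>. indicator (A (?t k)) \<omega> * ?p (Z (?t k) \<omega>) \<partial>P x)"
            by (rule markov_property[OF mp x t0 \<delta>0 AF[OF t0] u bnd])
          also have "(\<integral>\<omega>. indicator (A (?t k)) \<omega> * \<Phi> (?t k) \<omega> \<partial>P x) =
            exp (- lam * ?t k) * (\<integral>\<omega>. indicator (A (?t k)) \<omega> * u (Z (?t k) \<omega>) \<partial>P x)"
            unfolding \<Phi>_def by (subst mult.left_commute) (rule integral_mult_right_zero)
          also have "exp (- lam * (?t k + \<delta> n)) * (\<integral>\<omega>. indicator (A (?t k)) \<omega> * ?p (Z (?t k) \<omega>) \<partial>P x) -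
              exp (- lam * ?t k) * (\<integral>\<omega>. indicator (A (?t k)) \<omega> * u (Z (?t k) \<omega>) \<partial>P x) =
            exp (- lam * ?t k) * (exp (- lam * \<delta> n) * (\<integral>\<omega>. indicator (A (?t k)) \<omega> * ?p (Z (?t k) \<omega>) \<partial>P x)
              - (\<integral>\<omega>. indicator (A (?t k)) \<omega> * u (Z (?t k) \<omega>) \<partial>P x))"
            by (rule factor[OF exp12])
          also have "exp (- lam * \<delta> n) * (\<integral>\<omega>. indicator (A (?t k)) \<omega> * ?p (Z (?t k) \<omega>) \<partial>P x)
              - (\<integral>\<omega>. indicator (A (?t k)) \<omega> * u (Z (?t k) \<omega>) \<partial>P x) =
            (\<integral>\<omega>. exp (- lam * \<delta> n) * (indicator (A (?t k)) \<omega> * ?p (Z (?t k) \<omega>)) - indicator (A (?t k)) \<omega> * u (Z (?t k) \<omega>) \<partial>P x)"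
            using int2 int3 by simp
          finally have eq: "(\<integral>\<omega>. indicator (A (?t k)) \<omega> * (\<Phi> (?t k + \<delta> n) \<omega> - \<Phi> (?t k) \<omega>) \<partial>P x) =
            exp (- lam * ?t k) * (\<integral>\<omega>. exp (- lam * \<delta> n) * (indicator (A (?t k)) \<omega> * ?p (Z (?t k) \<omega>))
              - indicator (A (?t k)) \<omega> * u (Z (?t k) \<omega>) \<partial>P x)" .
          have "\<bar>\<integral>\<omega>. exp (- lam * \<delta> n) * (indicator (A (?t k)) \<omega> * ?p (Z (?t k) \<omega>))
              - indicator (A (?t k)) \<omega> * u (Z (?t k) \<omega>) \<partial>P x\<bar>
            \<le> (\<integral>\<omega>. \<bar>exp (- lam * \<delta> n) * (indicator (A (?t k)) \<omega> * ?p (Z (?t k) \<omega>))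
              - indicator (A (?t k)) \<omega> * u (Z (?t k) \<omega>)\<bar> \<partial>P x)"
            by (rule integral_abs_bound)
          also have "\<dots> \<le> (\<integral>\<omega>. e' * \<delta> n \<partial>P x)"
            by (intro integral_mono integrable_abs Bochner_Integration.integrable_diff integrable_mult_right int2 int3)
              (use close[OF inD] e' \<delta>0 in \<open>auto simp: indicator_def\<close>)
          also have "\<dots> = e' * \<delta> n" by (simp add: prob_space)
          finally show ?thesis
            unfolding eq abs_mult using expK[OF t0 tT] K0 by (intro mult_mono) auto
        qed
        have int4: "integrable (P x) (\<lambda>\<omega>. indicator (A (?t k)) \<omega> * (\<Phi> (?t k + \<delta> n) \<omega> - \<Phi> (?t k) \<omega>))" for k
          unfolding right_diff_distrib
          by (rule Bochner_Integration.integrable_diff[OF int1[OF t0 add_nonneg_nonneg[OF t0 \<delta>0]] int1[OF t0 t0]])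
        have "(\<integral>\<omega>. \<Psi> n \<omega> \<partial>P x) = (\<integral>\<omega>. \<Phi> 0 \<omega> \<partial>P x) +
          (\<integral>\<omega>. (\<Sum>k<Suc n. indicator (A (?t k)) \<omega> * (\<Phi> (?t k + \<delta> n) \<omega> - \<Phi> (?t k) \<omega>)) \<partial>P x)"
          unfolding \<Psi>_eq
          by (rule Bochner_Integration.integral_add; rule Bochner_Integration.integrable_sum int\<Phi>)
            (rule order_refl int4)+
        moreover have "(\<integral>\<omega>. (\<Sum>k<Suc n. indicator (A (?t k)) \<omega> * (\<Phi> (?t k + \<delta> n) \<omega> - \<Phi> (?t k) \<omega>)) \<partial>P x) =
          (\<Sum>k<Suc n. \<integral>\<omega>. indicator (A (?t k)) \<omega> * (\<Phi> (?t k + \<delta> n) \<omega> - \<Phi> (?t k) \<omega>) \<partial>P x)"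
          by (rule Bochner_Integration.integral_sum) (rule int4)
        ultimately have "(\<integral>\<omega>. \<Psi> n \<omega> \<partial>P x) - u x =
          (\<Sum>k<Suc n. \<integral>\<omega>. indicator (A (?t k)) \<omega> * (\<Phi> (?t k + \<delta> n) \<omega> - \<Phi> (?t k) \<omega>) \<partial>P x)"
          using start by linarith
        then have "\<bar>(\<integral>\<omega>. \<Psi> n \<omega> \<partial>P x) - u x\<bar> \<le> (\<Sum>k<Suc n. K * (e' * \<delta> n))"
          by (simp only:) (rule order_trans[OF sum_abs sum_mono], rule step, simp)
        also have "\<dots> = K * e' * T" by (simp add: \<delta>_def)
        also have "\<dots> < e" using K0 T0 e by (simp add: e'_def)
        finally show ?thesis by simp
      qed
      then show "\<exists>no. \<forall>n\<ge>no. norm ((\<integral>\<omega>. \<Psi> n \<omega> \<partial>P x) - u x) < e" by blast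
    qed
  qed
  ultimately have "(\<integral>\<omega>. \<Phi> (\<tau> \<omega>) \<omega> \<partial>P x) = u x" by (rule LIMSEQ_unique)
  then show ?thesis by (simp add: \<Phi>_def \<tau>_def)
qed

text \<open>A continuous positive function on \<open>[0, t]\<close> is bounded away from 0, and for a closed condition it
  suffices to look at a countable dense set of times.\<close>

lemma stays_positive_measurable:
  fixes \<psi> :: "'x \<Rightarrow> real"
  assumes \<psi>: "\<psi> \<in> borel_measurable E" and Z: "\<And>s. 0 \<le> s \<Longrightarrow> Z s \<in> \<Omega> \<rightarrow>\<^sub>M E"
    and cont: "\<And>\<omega>. \<omega> \<in> space \<Omega> \<Longrightarrow> continuous_on {0..} (\<lambda>s. \<psi> (Z s \<omega>))" and t: "0 \<le> t"
  shows "{\<omega> \<in> space \<Omega>. \<forall>s\<in>{0..t}. 0 < \<psi> (Z s \<omega>)} \<in> sets (natural_filtration \<Omega> E Z t)"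
proof -
  obtain S where S: "countable S" "S \<subseteq> {0..t}" "{0..t} \<subseteq> closure S" by (rule separable)
  have S0: "S \<noteq> {}" using S(3) t by auto
  let ?F = "natural_filtration \<Omega> E Z t"
  have "{\<omega> \<in> space \<Omega>. \<forall>s\<in>{0..t}. 0 < \<psi> (Z s \<omega>)} =
    (\<Union>n. \<Inter>s\<in>S. {\<omega> \<in> space \<Omega>. Z s \<omega> \<in> {y \<in> space E. 1 / real (Suc n) \<le> \<psi> y}})" (is "?L = ?R")
  proof (intro set_eqI iffI)
    fix \<omega> assume "\<omega> \<in> ?L"
    then have \<omega>: "\<omega> \<in> space \<Omega>" and pos: "\<And>s. s \<in> {0..t} \<Longrightarrow> 0 < \<psi> (Z s \<omega>)" by auto
    have "continuous_on {0..t} (\<lambda>s. \<psi> (Z s \<omega>))"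
      by (rule continuous_on_subset[OF cont[OF \<omega>]]) auto
    then obtain r where r: "r \<in> {0..t}" "\<And>s. s \<in> {0..t} \<Longrightarrow> \<psi> (Z r \<omega>) \<le> \<psi> (Z s \<omega>)"
      using continuous_attains_inf[OF compact_Icc _ \<open>continuous_on {0..t} _\<close>] t by auto
    obtain n where "1 / real (Suc n) < \<psi> (Z r \<omega>)"
      using nat_approx_posE[OF pos[OF r(1)]] by auto
    then have "1 / real (Suc n) \<le> \<psi> (Z s \<omega>)" if "s \<in> S" for s
      using r(2)[of s] S(2) that by force
    moreover have "Z s \<omega> \<in> space E" if "s \<in> S" for s
      using measurable_space[OF Z \<omega>] S(2) that by auto
    ultimately show "\<omega> \<in> ?R" using \<omega> by auto
  next
    fix \<omega> assume "\<omega> \<in> ?R"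
    then obtain n where n: "\<And>s. s \<in> S \<Longrightarrow> 1 / real (Suc n) \<le> \<psi> (Z s \<omega>)" and \<omega>: "\<omega> \<in> space \<Omega>"
      using S0 by auto
    have cl: "closure S \<subseteq> {0..t}" using S(2) by (simp add: closure_minimal)
    have "1 / real (Suc n) \<le> \<psi> (Z s \<omega>)" if s: "s \<in> {0..t}" for s
    proof (rule continuous_ge_on_closure[where f = "\<lambda>s. \<psi> (Z s \<omega>)" and S = S])
      show "continuous_on (closure S) (\<lambda>s. \<psi> (Z s \<omega>))"
        by (rule continuous_on_subset[OF cont[OF \<omega>]]) (use cl in auto)
    qed (use S(3) s n in auto)
    then have "0 < \<psi> (Z s \<omega>)" if "s \<in> {0..t}" for s
      using that by (rule_tac less_le_trans[of _ "1 / real (Suc n)"]) auto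
    then show "\<omega> \<in> ?L" using \<omega> by blast
  qed
  also have "\<dots> \<in> sets ?F"
  proof (rule sets.countable_UN, rule image_subsetI, rule sets.countable_INT'[OF S(1) S0], rule image_subsetI)
    fix n s assume s: "s \<in> S"
    have "{y \<in> space E. 1 / real (Suc n) \<le> \<psi> y} \<in> sets E" using \<psi> by measurable
    then show "{\<omega> \<in> space \<Omega>. Z s \<omega> \<in> {y \<in> space E. 1 / real (Suc n) \<le> \<psi> y}} \<in> sets ?F"
      using s S(2) by (intro natural_filtration_vimage) auto
  qed
  finally show ?thesis .
qed

lemma right_continuous_discrete_const:
  fixes f :: "real \<Rightarrow> int"
  assumes "continuous (at_right t) f"
  shows "\<exists>e>0. \<forall>s. t \<le> s \<and> s < t + e \<longrightarrow> f s = f t"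
proof -
  have "open {f t}" by (rule discrete_topology_class.open_discrete)
  then have "eventually (\<lambda>s. f s \<in> {f t}) (at_right t)"
    by (intro topological_tendstoD[OF assms[unfolded continuous_within]]) simp_all
  then obtain b where b: "t < b" "\<And>s. t < s \<Longrightarrow> s < b \<Longrightarrow> f s = f t"
    unfolding eventually_at_right_field by auto
  then show ?thesis
    by (intro exI[of _ "b - t"]) (auto simp: le_less)
qed

text \<open>A right-continuous path in a discrete space that is constantly \<open>k\<close> on a dense set of times before
  \<open>t\<close> is constantly \<open>k\<close> before \<open>t\<close>; the time \<open>t\<close> has to be looked at separately.\<close>

lemma stays_in_state_measurable:
  fixes \<phi> :: "'x \<Rightarrow> int"
  assumes \<phi>: "{y \<in> space E. \<phi> y = k} \<in> sets E" and Z: "\<And>s. 0 \<le> s \<Longrightarrow> Z s \<in> \<Omega> \<rightarrow>\<^sub>M E"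
    and cont: "\<And>\<omega> s. \<omega> \<in> space \<Omega> \<Longrightarrow> 0 \<le> s \<Longrightarrow> continuous (at_right s) (\<lambda>s. \<phi> (Z s \<omega>))" and t: "0 \<le> t"
  shows "{\<omega> \<in> space \<Omega>. \<forall>s\<in>{0..t}. \<phi> (Z s \<omega>) = k} \<in> sets (natural_filtration \<Omega> E Z t)"
proof -
  obtain S where S: "countable S" "S \<subseteq> {0..<t}" "{0..<t} \<subseteq> closure S" by (rule separable)
  let ?F = "natural_filtration \<Omega> E Z t"
  have "{\<omega> \<in> space \<Omega>. \<forall>s\<in>{0..t}. \<phi> (Z s \<omega>) = k} =
    (\<Inter>s\<in>insert t S. {\<omega> \<in> space \<Omega>. Z s \<omega> \<in> {y \<in> space E. \<phi> y = k}})" (is "?L = ?R")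
  proof (intro set_eqI iffI)
    fix \<omega> assume "\<omega> \<in> ?L"
    then show "\<omega> \<in> ?R" using S(2) t measurable_space[OF Z] by (auto simp: subset_iff)
  next
    fix \<omega> assume R: "\<omega> \<in> ?R"
    then have \<omega>: "\<omega> \<in> space \<Omega>" by auto
    have "\<phi> (Z s \<omega>) = k" if s: "s \<in> {0..t}" for s
    proof (cases "s = t")
      case False
      then have st: "s < t" using s by auto
      obtain e where e: "0 < e" "\<And>r. s \<le> r \<Longrightarrow> r < s + e \<Longrightarrow> \<phi> (Z r \<omega>) = \<phi> (Z s \<omega>)"
        using right_continuous_discrete_const[OF cont[OF \<omega>, of s]] s by auto
      let ?O = "{s<..<min t (s + e)}"
      have "?O \<noteq> {}" using st e(1) by simp
      moreover have "?O \<subseteq> closure S" using S(3) s by force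
      ultimately have "?O \<inter> S \<noteq> {}"
        by (metis Int_absorb2 open_Int_closure_eq_empty open_greaterThanLessThan)
      then obtain r where "r \<in> S" "s < r" "r < s + e" by auto
      then show ?thesis using e(2)[of r] R by auto
    qed (use R in auto)
    then show "\<omega> \<in> ?L" using \<omega> by auto
  qed
  also have "\<dots> \<in> sets ?F"
  proof (rule sets.countable_INT', simp add: S, simp, rule image_subsetI)
    fix s assume s: "s \<in> insert t S"
    have "0 \<le> s" "s \<le> t" using s S(2) t by auto
    then show "{\<omega> \<in> space \<Omega>. Z s \<omega> \<in> {y \<in> space E. \<phi> y = k}} \<in> sets ?F"
      by (rule natural_filtration_vimage) (rule \<phi>)
  qed
  finally show ?thesis .
qed

text \<open>The exit times from the regions \<open>{\<psi> > \<kappa>}\<close> converge to the exit time of \<open>{\<psi> > 0}\<close>, since a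
  continuous path keeps a positive distance from the boundary on every compact time interval before
  it leaves.\<close>

lemma exit_time_exhaustion:
  fixes \<psi> :: "'x \<Rightarrow> real"
  assumes cont: "continuous_on {0..} (\<lambda>s. \<psi> (Z s \<omega>))" and T: "0 \<le> T"
    and \<kappa>: "\<kappa> \<longlonglongrightarrow> 0" "\<And>n. 0 < \<kappa> n"
  shows "(\<lambda>n. exit_time Z {y \<in> D. \<kappa> n < \<psi> y} T \<omega>) \<longlonglongrightarrow> exit_time Z {y \<in> D. 0 < \<psi> y} T \<omega>"
    (is "(\<lambda>n. ?\<tau>n n) \<longlonglongrightarrow> ?\<tau>")
proof (rule order_tendstoI)
  fix a assume a: "?\<tau> < a"
  have "?\<tau>n n \<le> ?\<tau>" for n by (rule exit_time_mono) (use \<kappa>(2)[of n] in auto)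
  then show "\<forall>\<^sub>F n in sequentially. ?\<tau>n n < a"
    by (intro always_eventually allI) (rule le_less_trans[OF _ a])
next
  fix a assume a: "a < ?\<tau>"
  show "\<forall>\<^sub>F n in sequentially. a < ?\<tau>n n"
  proof (cases "a < 0")
    case True
    then show ?thesis by (intro always_eventually allI less_le_trans[OF True] exit_time_nonneg[OF T])
  next
    case False
    define s where "s = (a + ?\<tau>) / 2"
    have s: "a < s" "s < ?\<tau>" "0 \<le> s" using a False by (auto simp: s_def)
    have inD: "Z r \<omega> \<in> D \<and> 0 < \<psi> (Z r \<omega>)" if "r \<in> {0..s}" for r
      using exit_time_before[of r Z "{y \<in> D. 0 < \<psi> y}" T \<omega>] that s by auto
    have "continuous_on {0..s} (\<lambda>s. \<psi> (Z s \<omega>))"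
      by (rule continuous_on_subset[OF cont]) auto
    then obtain r where r: "r \<in> {0..s}" "\<And>q. q \<in> {0..s} \<Longrightarrow> \<psi> (Z r \<omega>) \<le> \<psi> (Z q \<omega>)"
      using continuous_attains_inf[OF compact_Icc _ \<open>continuous_on {0..s} _\<close>] s(3) by auto
    have "\<forall>\<^sub>F n in sequentially. \<kappa> n < \<psi> (Z r \<omega>)"
      using order_tendstoD(2)[OF \<kappa>(1)] inD[OF r(1)] by auto
    then show ?thesis
    proof eventually_elim
      case (elim n)
      have "s \<le> ?\<tau>n n"
      proof (rule exit_time_ge)
        show "s \<le> T" using s exit_time_le[of Z "{y \<in> D. 0 < \<psi> y}" T \<omega>] by simp
        fix q assume "0 \<le> q" "q < s"
        then show "Z q \<omega> \<in> {y \<in> D. \<kappa> n < \<psi> y}" using inD[of q] r(2)[of q] elim by auto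
      qed
      then show ?case using s by simp
    qed
  qed
qed

section \<open>The diffusion stopped on leaving an arc\<close>

lemma space_torus_borel: "space torus_borel = torus"
  by (simp add: torus_borel_def space_restrict_space)

lemma measurable_torus_borel: "F \<in> borel_measurable borel \<Longrightarrow> F \<in> borel_measurable torus_borel"
  unfolding torus_borel_def by (rule measurable_restrict_space1)

lemma continuous_bounded_on_torus:
  fixes F :: "real \<Rightarrow> real"
  assumes "continuous_on UNIV F"
  obtains C where "\<And>y. y \<in> torus \<Longrightarrow> \<bar>F y\<bar> \<le> C"
proof -
  have "bounded (F ` {0..1})"
    by (intro compact_imp_bounded compact_continuous_image continuous_on_subset[OF assms]) auto
  then obtain C where "\<And>y. y \<in> {0..1} \<Longrightarrow> \<bar>F y\<bar> \<le> C" unfolding bounded_iff by fastforce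
  then show ?thesis by (intro that[of C]) (auto simp: torus_def)
qed

lemma continuous_on_at_right:
  fixes f :: "real \<Rightarrow> 'a :: topological_space"
  assumes "continuous_on {0..} f" "0 \<le> t"
  shows "continuous (at_right t) f"
proof -
  have "continuous (at t within {0..}) f" using assms by (simp add: continuous_on_eq_continuous_within)
  then show ?thesis by (rule continuous_within_subset) (use assms(2) in auto)
qed

lemma level_at_exit:
  fixes f :: "real \<Rightarrow> real"
  assumes f: "continuous_on {0..} f" and t: "0 < t" and above: "\<And>s. 0 \<le> s \<Longrightarrow> s < t \<Longrightarrow> \<kappa> \<le> f s"
  shows "\<kappa> \<le> f t"
proof (rule continuous_ge_on_closure[where S = "{0..<t}" and f = f and x = t])
  show "continuous_on (closure {0..<t}) f" using t by (intro continuous_on_subset[OF f]) simp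
qed (use t above in auto)

lemma C2_torus_continuous: "f \<in> C2_torus \<Longrightarrow> continuous_on UNIV f"
  unfolding C2_torus_def by (auto elim: C2_on_openE)

text \<open>Optional stopping for \<open>e\<^sup>-\<^sup>\<gamma>\<^sup>t g (X t)\<close>. It holds for the cut-off functions on the smaller regions where
  the height exceeds \<open>\<kappa> n\<close>; on leaving such a region the cutoff factor is still 1, and the exit times
  converge to that of the full region. The function \<open>\<rho>\<close> allows for an additional obstacle: it is constant for
  the exit from the arc, and vanishes at a point \<open>z\<close> for the first visit to \<open>z\<close>.\<close>

lemma torus_exit_expectation:
  fixes g g' \<rho> :: "real \<Rightarrow> real" and T :: real
  assumes dif: "torus_diffusion b \<epsilon> \<Omega> P X" and per: "periodic1 b" and \<epsilon>: "0 < \<epsilon>"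
    and cd: "c < d" "d \<le> c + 1"
    and cg: "continuous_on {c..d} g" and bdry: "g c = 1" "g d = 1"
    and C2: "C2_on_open {c<..<d} g"
    and dg: "\<And>x. x \<in> {c<..<d} \<Longrightarrow> (g has_real_derivative g' x) (at x)"
    and dg': "\<And>x. x \<in> {c<..<d} \<Longrightarrow>
      (g' has_real_derivative \<gamma> / (exp (barrier b / \<epsilon>) * \<epsilon>) * g x - b x / \<epsilon> * g' x) (at x)"
    and \<rho>: "continuous_on UNIV \<rho>" "periodic1 \<rho>"
    and x: "x \<in> torus" "0 < arc_height c d x" and T: "0 \<le> T"
  defines "\<tau> \<equiv> exit_time X {y \<in> {y \<in> torus. 0 < \<rho> y}. 0 < arc_height c d y} T"
  shows "(\<lambda>\<omega>. exp (- \<gamma> * \<tau> \<omega>) * arc_extension c d g (X (\<tau> \<omega>) \<omega>)) \<in> borel_measurable (P x)"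
    and "(\<integral>\<omega>. exp (- \<gamma> * \<tau> \<omega>) * arc_extension c d g (X (\<tau> \<omega>) \<omega>) \<partial>P x) = arc_extension c d g x"
proof -
  have mp: "markov_process torus_borel \<Omega> P X"
    and path: "\<And>\<omega>. \<omega> \<in> space \<Omega> \<Longrightarrow> continuous_on {0..} (\<lambda>t. cis (2 * pi * X t \<omega>))"
    and gen: "has_generator_on C2_torus torus_borel P X (gen_torus b \<epsilon>)"
    using dif by (auto simp: torus_diffusion_def)
  have xE: "x \<in> space torus_borel" using x by (simp add: space_torus_borel)
  interpret prob_space "P x" by (rule markov_process_lawD[OF mp xE])
  have sp: "space (P x) = space \<Omega>" and setsP: "sets (P x) = sets \<Omega>" by (rule markov_process_lawD[OF mp xE])+
  have Zm: "\<And>s. 0 \<le> s \<Longrightarrow> X s \<in> \<Omega> \<rightarrow>\<^sub>M torus_borel" by (rule markov_process_measurable[OF mp])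
  have Xt: "X s \<omega> \<in> torus" if "0 \<le> s" "\<omega> \<in> space \<Omega>" for s \<omega>
    using measurable_space[OF Zm[OF that(1)] that(2)] by (simp add: space_torus_borel)
  let ?h = "arc_height c d" and ?G = "arc_extension c d g"
  have cG: "continuous_on UNIV ?G" by (rule continuous_arc_extension[OF cd _ cg]) (simp add: bdry)
  obtain C where C: "\<And>y. y \<in> torus \<Longrightarrow> \<bar>?G y\<bar> \<le> C" by (rule continuous_bounded_on_torus[OF cG]) blast
  have stays: "{\<omega> \<in> space \<Omega>. \<forall>s\<in>{0..t}. X s \<omega> \<in> {y \<in> {y \<in> torus. 0 < \<rho> y}. k < ?h y}}
      \<in> sets (natural_filtration \<Omega> torus_borel X t)" if t: "0 \<le> t" for t k
  proof -
    let ?\<psi> = "\<lambda>y. min (\<rho> y) (?h y - k)"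
    have \<psi>c: "continuous_on UNIV ?\<psi>" by (intro continuous_intros \<rho> continuous_arc_height)
    have \<psi>p: "periodic1 ?\<psi>" using \<rho>(2) periodic1_arc_height[of c d] by (simp add: periodic1_def)
      have "{\<omega> \<in> space \<Omega>. \<forall>s\<in>{0..t}. 0 < ?\<psi> (X s \<omega>)} \<in> sets (natural_filtration \<Omega> torus_borel X t)"
        by (rule stays_positive_measurable[OF _ Zm _ t])
          (auto intro: measurable_torus_borel borel_measurable_continuous_onI \<psi>c continuous_on_torus_path[OF \<psi>p \<psi>c path])
      also have "{\<omega> \<in> space \<Omega>. \<forall>s\<in>{0..t}. 0 < ?\<psi> (X s \<omega>)} = {\<omega> \<in> space \<Omega>. \<forall>s\<in>{0..t}. X s \<omega> \<in> {y \<in> {y \<in> torus. 0 < \<rho> y}. k < ?h y}}"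
        using Xt by auto
      finally show ?thesis .
  qed
  \<comment> \<open>The levels are below the height of \<open>x\<close>, so that the path starts inside all the regions.\<close>
  define \<kappa> where "\<kappa> n = ?h x / real (n + 2)" for n
  have \<kappa>0: "0 < \<kappa> n" and \<kappa>x: "\<kappa> n < ?h x" for n
    using x mult_strict_left_mono[of 1 "real (n + 2)" "?h x"] by (simp_all add: \<kappa>_def divide_less_eq)
  have \<kappa>lim: "\<kappa> \<longlonglongrightarrow> 0" unfolding \<kappa>_def by (rule LIMSEQ_ignore_initial_segment[OF lim_const_over_n])
  define D where "D n = {y \<in> {y \<in> torus. 0 < \<rho> y}. \<kappa> n < ?h y}" for n
  define \<tau>n where "\<tau>n n = exit_time X (D n) T" for n
  define u where "u n = arc_cutoff c d g (\<kappa> n)" for n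
  have uC2: "u n \<in> C2_torus" for n unfolding u_def by (rule C2_arc_cutoff[OF cd \<kappa>0 C2])
  have ucont: "continuous_on UNIV (u n)" for n by (rule C2_torus_continuous[OF uC2])
  have uper: "periodic1 (u n)" for n using uC2[of n] by (simp add: C2_torus_def)
  have stopped: "(\<integral>\<omega>. exp (- \<gamma> * \<tau>n n \<omega>) * u n (X (\<tau>n n \<omega>) \<omega>) \<partial>P x) = u n x" for n
  proof -
    obtain B where B: "\<And>y. y \<in> torus \<Longrightarrow> \<bar>u n y\<bar> \<le> B" by (rule continuous_bounded_on_torus[OF ucont]) blast
    have "uniform_limit (space torus_borel) (\<lambda>t y. ((\<integral>\<omega>. u n (X t \<omega>) \<partial>P y) - u n y) / t) (gen_torus b \<epsilon> (u n)) (at_right 0)"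
      using gen uC2 by (simp add: has_generator_on_def)
    then have "uniform_limit (D n) (\<lambda>t y. ((\<integral>\<omega>. u n (X t \<omega>) \<partial>P y) - u n y) / t) (gen_torus b \<epsilon> (u n)) (at_right 0)"
      by (rule uniform_limit_on_subset) (auto simp: space_torus_borel D_def)
    moreover have "gen_torus b \<epsilon> (u n) y = \<gamma> * u n y" if "y \<in> D n" for y
      unfolding u_def using that by (intro gen_torus_arc_cutoff[OF cd \<kappa>0 per \<epsilon> dg dg']) (auto simp: D_def)
    ultimately have ul: "uniform_limit (D n) (\<lambda>t y. ((\<integral>\<omega>. u n (X t \<omega>) \<partial>P y) - u n y) / t) (\<lambda>y. \<gamma> * u n y) (at_right 0)"
      by (subst uniform_limit_cong'[of _ _ _ _ "gen_torus b \<epsilon> (u n)"]) auto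
    have rc: "continuous (at_right t) (\<lambda>s. u n (X s \<omega>))" if "\<omega> \<in> space \<Omega>" "0 \<le> t" for \<omega> t
      by (rule continuous_on_at_right[OF continuous_on_torus_path[OF uper ucont path[OF that(1)]] that(2)])
    have um: "u n \<in> borel_measurable torus_borel"
      by (intro measurable_torus_borel borel_measurable_continuous_onI ucont)
    have Dsub: "D n \<subseteq> space torus_borel" by (auto simp: D_def space_torus_borel)
    have uB: "\<bar>u n y\<bar> \<le> B" if "y \<in> space torus_borel" for y using B that by (simp add: space_torus_borel)
    show ?thesis
      unfolding \<tau>n_def
      using expectation_at_exit[OF mp xE um uB Dsub ul stays[of _ "\<kappa> n", folded D_def] rc T] by blast
  qed
  have ux: "u n x = ?G x" for n
    unfolding u_def by (rule arc_cutoff_inside) (use \<kappa>0 \<kappa>x in \<open>auto intro: less_imp_le\<close>)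
  have at_exit: "u n (X (\<tau>n n \<omega>) \<omega>) = ?G (X (\<tau>n n \<omega>) \<omega>)" if \<omega>: "\<omega> \<in> space \<Omega>" "X 0 \<omega> = x" for \<omega> n
  proof -
    have "\<kappa> n \<le> ?h (X (\<tau>n n \<omega>) \<omega>)"
    proof (cases "\<tau>n n \<omega> = 0")
      case True
      then show ?thesis using \<omega> \<kappa>x[of n] by simp
    next
      case False
      then have pos: "0 < \<tau>n n \<omega>" using exit_time_nonneg[OF T, of X "D n" \<omega>] by (simp add: \<tau>n_def)
      show ?thesis
      proof (rule level_at_exit[OF continuous_on_torus_path[OF periodic1_arc_height continuous_arc_height path[OF \<omega>(1)]] pos])
        fix s assume "0 \<le> s" "s < \<tau>n n \<omega>"
        then have "X s \<omega> \<in> D n" unfolding \<tau>n_def by (rule exit_time_before)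
        then show "\<kappa> n \<le> ?h (X s \<omega>)" by (simp add: D_def)
      qed
    qed
    then show ?thesis unfolding u_def by (rule arc_cutoff_inside[OF \<kappa>0])
  qed
  have start: "AE \<omega> in P x. X 0 \<omega> = x" using mp xE by (simp add: markov_process_def)
  define \<Phi> where "\<Phi> t \<omega> = exp (- \<gamma> * t) * ?G (X t \<omega>)" for t \<omega>
  have \<tau>lim: "(\<lambda>n. \<tau>n n \<omega>) \<longlonglongrightarrow> \<tau> \<omega>" if \<omega>: "\<omega> \<in> space \<Omega>" for \<omega>
    unfolding \<tau>n_def \<tau>_def D_def
    by (rule exit_time_exhaustion[OF _ T \<kappa>lim \<kappa>0])
      (rule continuous_on_torus_path[OF periodic1_arc_height continuous_arc_height path[OF \<omega>]])
  have \<Phi>c: "continuous_on {0..} (\<lambda>t. \<Phi> t \<omega>)" if \<omega>: "\<omega> \<in> space \<Omega>" for \<omega>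
    unfolding \<Phi>_def
    by (intro continuous_intros continuous_on_torus_path[OF periodic1_arc_extension cG path[OF \<omega>]])
  have \<tau>n0: "0 \<le> \<tau>n n \<omega>" "\<tau>n n \<omega> \<le> T" and \<tau>0: "0 \<le> \<tau> \<omega>" "\<tau> \<omega> \<le> T" for n \<omega>
    by (simp_all add: \<tau>n_def \<tau>_def exit_time_nonneg[OF T] exit_time_le)
  have \<Phi>lim: "(\<lambda>n. \<Phi> (\<tau>n n \<omega>) \<omega>) \<longlonglongrightarrow> \<Phi> (\<tau> \<omega>) \<omega>" if \<omega>: "\<omega> \<in> space \<Omega>" for \<omega>
  proof (rule continuous_within_tendsto_compose'[where S = "{0..}", OF _ _ \<tau>lim[OF \<omega>]])
    show "continuous (at (\<tau> \<omega>) within {0..}) (\<lambda>t. \<Phi> t \<omega>)"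
      using \<Phi>c[OF \<omega>] \<tau>0(1) by (simp add: continuous_on_eq_continuous_within)
  qed (simp add: \<tau>n0)
  have \<Phi>rc: "continuous (at_right t) (\<lambda>s. \<Phi> s \<omega>)" if "\<omega> \<in> space (P x)" "0 \<le> t" for \<omega> t
    by (rule continuous_on_at_right[OF \<Phi>c]) (use that sp in auto)
  have \<Phi>m: "\<Phi> t \<in> borel_measurable (P x)" if "0 \<le> t" for t
  proof -
    have "?G \<in> borel_measurable torus_borel"
      by (intro measurable_torus_borel borel_measurable_continuous_onI cG)
    then have "(\<lambda>\<omega>. ?G (X t \<omega>)) \<in> borel_measurable \<Omega>" by (rule measurable_compose[OF Zm[OF that]])
    then have "(\<lambda>\<omega>. ?G (X t \<omega>)) \<in> borel_measurable (P x)"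
      using measurable_cong_sets[OF setsP refl] by blast
    then show ?thesis unfolding \<Phi>_def by simp
  qed
  have staysP: "{\<omega> \<in> space (P x). \<forall>s\<in>{0..t}. X s \<omega> \<in> {y \<in> {y \<in> torus. 0 < \<rho> y}. k < ?h y}} \<in> sets (P x)"
    if "0 \<le> t" for t k
    using stays[OF that, of k] sets_natural_filtration_subset[OF mp] by (auto simp: sp setsP)
  show meas: "(\<lambda>\<omega>. exp (- \<gamma> * \<tau> \<omega>) * ?G (X (\<tau> \<omega>) \<omega>)) \<in> borel_measurable (P x)"
    using exit_value_measurable(1)[OF \<Phi>m staysP[of _ 0] \<Phi>rc T] by (simp add: \<Phi>_def \<tau>_def)
  have meas_n: "(\<lambda>\<omega>. \<Phi> (\<tau>n n \<omega>) \<omega>) \<in> borel_measurable (P x)" for n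
    unfolding \<tau>n_def D_def by (rule exit_value_measurable(1)[OF \<Phi>m staysP \<Phi>rc T])
  have umeas_n: "(\<lambda>\<omega>. exp (- \<gamma> * \<tau>n n \<omega>) * u n (X (\<tau>n n \<omega>) \<omega>)) \<in> borel_measurable (P x)" for n
  proof -
    have rc: "continuous (at_right t) (\<lambda>s. exp (- \<gamma> * s) * u n (X s \<omega>))" if "\<omega> \<in> space (P x)" "0 \<le> t" for \<omega> t
      by (intro continuous_intros continuous_on_at_right[OF continuous_on_torus_path[OF uper ucont path] that(2)])
        (use that sp in simp)
    have "(\<lambda>\<omega>. exp (- \<gamma> * t) * u n (X t \<omega>)) \<in> borel_measurable (P x)" if "0 \<le> t" for t
    proof -
      have "u n \<in> borel_measurable torus_borel"
        by (intro measurable_torus_borel borel_measurable_continuous_onI ucont)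
      then have "(\<lambda>\<omega>. u n (X t \<omega>)) \<in> borel_measurable \<Omega>" by (rule measurable_compose[OF Zm[OF that]])
      then have "(\<lambda>\<omega>. u n (X t \<omega>)) \<in> borel_measurable (P x)"
        using measurable_cong_sets[OF setsP refl] by blast
      then show ?thesis by simp
    qed
    then show ?thesis unfolding \<tau>n_def D_def by (rule exit_value_measurable(1)[OF _ staysP rc T])
  qed
  have "(\<lambda>n. \<integral>\<omega>. \<Phi> (\<tau>n n \<omega>) \<omega> \<partial>P x) \<longlonglongrightarrow> (\<integral>\<omega>. \<Phi> (\<tau> \<omega>) \<omega> \<partial>P x)"
  proof (rule integral_dominated_convergence[where w = "\<lambda>_. exp (\<bar>\<gamma>\<bar> * T) * C"])
    show "AE \<omega> in P x. (\<lambda>n. \<Phi> (\<tau>n n \<omega>) \<omega>) \<longlonglongrightarrow> \<Phi> (\<tau> \<omega>) \<omega>" using \<Phi>lim by (auto simp: sp)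
    fix n
    have "norm (\<Phi> (\<tau>n n \<omega>) \<omega>) \<le> exp (\<bar>\<gamma>\<bar> * T) * C" if "\<omega> \<in> space \<Omega>" for \<omega>
      using C[OF Xt[OF \<tau>n0(1) that]] exp_weight_bound[OF \<tau>n0, of \<gamma> n \<omega>]
      by (auto simp: \<Phi>_def abs_mult intro!: mult_mono)
    then show "AE \<omega> in P x. norm (\<Phi> (\<tau>n n \<omega>) \<omega>) \<le> exp (\<bar>\<gamma>\<bar> * T) * C" by (auto simp: sp)
  qed (use meas meas_n in \<open>simp_all add: \<Phi>_def\<close>)
  moreover have "(\<integral>\<omega>. \<Phi> (\<tau>n n \<omega>) \<omega> \<partial>P x) = ?G x" for n
  proof -
    have "AE \<omega> in P x. \<Phi> (\<tau>n n \<omega>) \<omega> = exp (- \<gamma> * \<tau>n n \<omega>) * u n (X (\<tau>n n \<omega>) \<omega>)"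
      using start AE_space by eventually_elim (simp add: \<Phi>_def at_exit sp)
    then have "(\<integral>\<omega>. \<Phi> (\<tau>n n \<omega>) \<omega> \<partial>P x) = (\<integral>\<omega>. exp (- \<gamma> * \<tau>n n \<omega>) * u n (X (\<tau>n n \<omega>) \<omega>) \<partial>P x)"
      by (rule integral_cong_AE[OF meas_n umeas_n])
    then show ?thesis by (simp only: stopped ux)
  qed
  ultimately show "(\<integral>\<omega>. exp (- \<gamma> * \<tau> \<omega>) * ?G (X (\<tau> \<omega>) \<omega>) \<partial>P x) = ?G x"
    by (simp add: LIMSEQ_const_iff \<Phi>_def)
qed

section \<open>Comparing hitting times of the diffusion\<close>

text \<open>The hitting time of a closed set by a continuous path is attained. The set is given as
  \<open>{f \<le> 0}\<close> along the path.\<close>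

lemma hitting_time_le_iff:
  fixes f :: "real \<Rightarrow> real"
  assumes f: "continuous_on {0..} f" and B: "\<And>s. 0 \<le> s \<Longrightarrow> X s \<omega> \<in> B \<longleftrightarrow> f s \<le> 0" and t: "0 \<le> t"
  shows "hitting_time X B \<omega> \<le> ereal t \<longleftrightarrow> (\<exists>s\<in>{0..t}. X s \<omega> \<in> B)"
proof
  assume le: "hitting_time X B \<omega> \<le> ereal t"
  show "\<exists>s\<in>{0..t}. X s \<omega> \<in> B"
  proof (rule ccontr)
    assume "\<not> (\<exists>s\<in>{0..t}. X s \<omega> \<in> B)"
    then have out: "X s \<omega> \<notin> B" if "s \<in> {0..t}" for s using that by blast
    then have pos: "0 < f t" using B[of t] t by force
    have "(f \<longlongrightarrow> f t) (at_right t)" using continuous_on_at_right[OF f t] by (simp add: continuous_within)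
    then have "\<forall>\<^sub>F s in at_right t. 0 < f s" using pos by (rule order_tendstoD)
    then obtain e where e: "t < e" "\<And>s. t < s \<Longrightarrow> s < e \<Longrightarrow> 0 < f s"
      unfolding eventually_at_right_field by auto
    have "ereal e \<le> hitting_time X B \<omega>"
      unfolding hitting_time_def
    proof (rule Inf_greatest, clarify)
      fix s assume s: "0 \<le> s" "X s \<omega> \<in> B"
      then have "t < s" using out[of s] by force
      moreover have "\<not> 0 < f s" using s B by force
      ultimately show "ereal e \<le> ereal s" using e(2)[of s] by force
    qed
    then show False using le e(1) by (meson ereal_less_eq(3) leD order_trans)
  qed
next
  assume "\<exists>s\<in>{0..t}. X s \<omega> \<in> B"
  then obtain s where "0 \<le> s" "s \<le> t" "X s \<omega> \<in> B" by auto
  then have "hitting_time X B \<omega> \<le> ereal s" unfolding hitting_time_def by (intro Inf_lower) auto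
  then show "hitting_time X B \<omega> \<le> ereal t" using \<open>s \<le> t\<close> by (meson ereal_less_eq(3) order_trans)
qed

lemma outside_at_exit:
  fixes f :: "real \<Rightarrow> real"
  assumes f: "continuous_on {0..} f" and D: "\<And>s. 0 \<le> s \<Longrightarrow> X s \<omega> \<in> D \<longleftrightarrow> 0 < f s"
    and T: "0 \<le> T" and lt: "exit_time X D T \<omega> < T"
  shows "X (exit_time X D T \<omega>) \<omega> \<notin> D"
proof
  let ?\<tau> = "exit_time X D T \<omega>"
  assume inD: "X ?\<tau> \<omega> \<in> D"
  have \<tau>0: "0 \<le> ?\<tau>" by (rule exit_time_nonneg[OF T])
  have pos: "0 < f ?\<tau>" using inD D[OF \<tau>0] by simp
  have "(f \<longlongrightarrow> f ?\<tau>) (at_right ?\<tau>)" using continuous_on_at_right[OF f \<tau>0] by (simp add: continuous_within)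
  then have "\<forall>\<^sub>F s in at_right ?\<tau>. 0 < f s" using pos by (rule order_tendstoD)
  then obtain e where e: "?\<tau> < e" "\<And>s. ?\<tau> < s \<Longrightarrow> s < e \<Longrightarrow> 0 < f s"
    unfolding eventually_at_right_field by auto
  then obtain s where "?\<tau> < s" "s < ?\<tau> + (e - ?\<tau>)" "X s \<omega> \<notin> D"
    using exit_time_outside_sequence[OF lt T inD, of "e - ?\<tau>"] by auto
  then show False using e(2)[of s] D[of s] \<tau>0 by auto
qed

lemma point_height:
  assumes "y \<in> torus" "z \<in> torus"
  shows "0 < 1 - cos (2 * pi * (y - z)) \<longleftrightarrow> y \<noteq> z"
proof -
  have "cos (2 * pi * (y - z)) = 1 \<longleftrightarrow> y = z"
  proof
    assume "cos (2 * pi * (y - z)) = 1"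
    then obtain n :: int where "2 * pi * (y - z) = of_int n * 2 * pi" by (auto simp: cos_one_2pi_int)
    then have n: "y - z = of_int n" by simp
    moreover have "-1 < y - z" "y - z < 1" using assms by (auto simp: torus_def)
    ultimately have "n = 0" by linarith
    then show "y = z" using n by simp
  qed simp
  then show ?thesis using cos_le_one[of "2 * pi * (y - z)"] by linarith
qed

text \<open>The comparison of the two stopped martingales described at the beginning: \<open>F1\<close> is the event that the
  arc is left by time \<open>A\<close>, \<open>F2\<close> that it is left before \<open>z\<close> is hit, and the pointwise inequality \<open>key\<close> is
  integrated.\<close>

lemma hitting_comparison:
  fixes g g' :: "real \<Rightarrow> real" and A :: real
  assumes dif: "torus_diffusion b \<epsilon> \<Omega> P X" and per: "periodic1 b" and \<epsilon>: "0 < \<epsilon>" and A: "0 < A"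
    and cd: "c < d" "d \<le> c + 1"
    and cg: "continuous_on {c..d} g" and bdry: "g c = 1" "g d = 1"
    and C2: "C2_on_open {c<..<d} g"
    and dg: "\<And>x. x \<in> {c<..<d} \<Longrightarrow> (g has_real_derivative g' x) (at x)"
    and dg': "\<And>x. x \<in> {c<..<d} \<Longrightarrow>
      (g' has_real_derivative (1 / A) / (exp (barrier b / \<epsilon>) * \<epsilon>) * g x - b x / \<epsilon> * g' x) (at x)"
    and nonneg: "\<And>y. y \<in> torus \<Longrightarrow> 0 \<le> arc_extension c d g y"
    and x: "x \<in> torus" "0 < arc_height c d x" and z: "z \<in> torus" "0 < arc_height c d z"
  defines "I \<equiv> {y \<in> torus. 0 < arc_height c d y}"
  shows "measure (P x) {\<omega> \<in> space \<Omega>. hitting_time X (torus - I) \<omega> \<le> ereal A}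
    \<le> measure (P x) {\<omega> \<in> space \<Omega>. hitting_time X (torus - I) \<omega> < hitting_time X {z} \<omega>}
      + exp 1 * arc_extension c d g z"
proof -
  have mp: "markov_process torus_borel \<Omega> P X"
    and path: "\<And>\<omega>. \<omega> \<in> space \<Omega> \<Longrightarrow> continuous_on {0..} (\<lambda>t. cis (2 * pi * X t \<omega>))"
    using dif by (auto simp: torus_diffusion_def)
  have xE: "x \<in> space torus_borel" using x by (simp add: space_torus_borel)
  interpret prob_space "P x" by (rule markov_process_lawD[OF mp xE])
  have sp: "space (P x) = space \<Omega>" and setsP: "sets (P x) = sets \<Omega>" by (rule markov_process_lawD[OF mp xE])+
  have Zm: "\<And>s. 0 \<le> s \<Longrightarrow> X s \<in> \<Omega> \<rightarrow>\<^sub>M torus_borel" by (rule markov_process_measurable[OF mp])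
  have Xt: "X s \<omega> \<in> torus" if "0 \<le> s" "\<omega> \<in> space \<Omega>" for s \<omega>
    using measurable_space[OF Zm[OF that(1)] that(2)] by (simp add: space_torus_borel)
  let ?h = "arc_height c d" and ?G = "arc_extension c d g"
  define \<rho> where "\<rho> y = 1 - cos (2 * pi * (y - z))" for y
  have \<rho>c: "continuous_on UNIV \<rho>" unfolding \<rho>_def by (intro continuous_intros)
  have \<rho>p: "periodic1 \<rho>"
  proof -
    have "2 * pi * (y + 1 - z) = 2 * pi * (y - z) + 2 * pi" for y by (simp add: algebra_simps)
    then have "cos (2 * pi * (y + 1 - z)) = cos (2 * pi * (y - z))" for y by (simp only: cos_periodic)
    then show ?thesis by (simp add: periodic1_def \<rho>_def)
  qed
  have \<rho>pos: "0 < \<rho> y \<longleftrightarrow> y \<noteq> z" if "y \<in> torus" for y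
    using point_height[OF that z(1)] by (simp add: \<rho>_def)
  define D where "D = {y \<in> {y \<in> torus. 0 < \<rho> y}. 0 < ?h y}"
  define \<tau> where "\<tau> = exit_time X I A"
  define \<sigma> where "\<sigma> = exit_time X D A"
  define \<Phi> where "\<Phi> t \<omega> = exp (- (1 / A) * t) * ?G (X t \<omega>)" for t \<omega>
  have hpath: "continuous_on {0..} (\<lambda>t. ?h (X t \<omega>))" if "\<omega> \<in> space \<Omega>" for \<omega>
    by (rule continuous_on_torus_path[OF periodic1_arc_height continuous_arc_height path[OF that]])
  have \<rho>path: "continuous_on {0..} (\<lambda>t. \<rho> (X t \<omega>))" if "\<omega> \<in> space \<Omega>" for \<omega>
    by (rule continuous_on_torus_path[OF \<rho>p \<rho>c path[OF that]])
  have A0: "0 \<le> A" using A by simp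
  have "\<tau> = exit_time X {y \<in> {y \<in> torus. 0 < (1 :: real)}. 0 < ?h y} A" by (simp add: \<tau>_def I_def)
  then have E\<tau>: "(\<lambda>\<omega>. \<Phi> (\<tau> \<omega>) \<omega>) \<in> borel_measurable (P x)" "(\<integral>\<omega>. \<Phi> (\<tau> \<omega>) \<omega> \<partial>P x) = ?G x"
    using torus_exit_expectation[OF dif per \<epsilon> cd cg bdry C2 dg dg', of "\<lambda>_. 1" x A] x A0
    by (simp_all add: \<Phi>_def periodic1_def)
  have E\<sigma>: "(\<lambda>\<omega>. \<Phi> (\<sigma> \<omega>) \<omega>) \<in> borel_measurable (P x)" "(\<integral>\<omega>. \<Phi> (\<sigma> \<omega>) \<omega> \<partial>P x) = ?G x"
    using torus_exit_expectation[OF dif per \<epsilon> cd cg bdry C2 dg dg' \<rho>c \<rho>p x A0]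
    by (simp_all add: \<Phi>_def \<sigma>_def D_def)
  have hitI: "hitting_time X (torus - I) \<omega> \<le> ereal t \<longleftrightarrow> (\<exists>s\<in>{0..t}. X s \<omega> \<notin> I)"
    if "\<omega> \<in> space \<Omega>" "0 \<le> t" for \<omega> t
  proof -
    have B: "X s \<omega> \<in> torus - I \<longleftrightarrow> ?h (X s \<omega>) \<le> 0" if "0 \<le> s" for s
      using Xt[OF that \<open>\<omega> \<in> space \<Omega>\<close>] by (auto simp: I_def not_less)
    have "X s \<omega> \<in> torus - I \<longleftrightarrow> X s \<omega> \<notin> I" if "s \<in> {0..t}" for s
      using Xt[OF _ \<open>\<omega> \<in> space \<Omega>\<close>, of s] that by auto
    then show ?thesis
      using hitting_time_le_iff[where f = "\<lambda>t. ?h (X t \<omega>)" and X = X and \<omega> = \<omega> and B = "torus - I", OF hpath[OF that(1)] B that(2)] by simp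
  qed
  have hitz: "hitting_time X {z} \<omega> \<le> ereal t \<longleftrightarrow> (\<exists>s\<in>{0..t}. X s \<omega> = z)"
    if "\<omega> \<in> space \<Omega>" "0 \<le> t" for \<omega> t
    using hitting_time_le_iff[where f = "\<lambda>t. \<rho> (X t \<omega>)" and X = X and \<omega> = \<omega> and B = "{z}" and t = t]
      \<rho>path[OF that(1)] \<rho>pos[OF Xt[OF _ that(1)]] that(2) by (auto simp: not_less[symmetric])
  have hit0: "0 \<le> hitting_time X B \<omega>" for B \<omega>
    unfolding hitting_time_def by (rule Inf_greatest) auto
  define F1 where "F1 = {\<omega> \<in> space \<Omega>. hitting_time X (torus - I) \<omega> \<le> ereal A}"
  define F2 where "F2 = {\<omega> \<in> space \<Omega>. hitting_time X (torus - I) \<omega> < hitting_time X {z} \<omega>}"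
  have staysI: "{\<omega> \<in> space \<Omega>. \<forall>s\<in>{0..t}. X s \<omega> \<in> I} \<in> sets \<Omega>" if t: "0 \<le> t" for t
  proof -
    have "{\<omega> \<in> space \<Omega>. \<forall>s\<in>{0..t}. 0 < ?h (X s \<omega>)} \<in> sets (natural_filtration \<Omega> torus_borel X t)"
      by (rule stays_positive_measurable[OF _ Zm hpath t])
        (auto intro: measurable_torus_borel borel_measurable_continuous_onI continuous_arc_height)
    also have "{\<omega> \<in> space \<Omega>. \<forall>s\<in>{0..t}. 0 < ?h (X s \<omega>)} = {\<omega> \<in> space \<Omega>. \<forall>s\<in>{0..t}. X s \<omega> \<in> I}"
      using Xt by (auto simp: I_def)
    finally show ?thesis using sets_natural_filtration_subset[OF mp] by blast
  qed
  have staysz: "{\<omega> \<in> space \<Omega>. \<forall>s\<in>{0..t}. X s \<omega> \<noteq> z} \<in> sets \<Omega>" if t: "0 \<le> t" for t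
  proof -
    have "{\<omega> \<in> space \<Omega>. \<forall>s\<in>{0..t}. 0 < \<rho> (X s \<omega>)} \<in> sets (natural_filtration \<Omega> torus_borel X t)"
      by (rule stays_positive_measurable[OF _ Zm \<rho>path t])
        (auto intro: measurable_torus_borel borel_measurable_continuous_onI \<rho>c)
    also have "{\<omega> \<in> space \<Omega>. \<forall>s\<in>{0..t}. 0 < \<rho> (X s \<omega>)} = {\<omega> \<in> space \<Omega>. \<forall>s\<in>{0..t}. X s \<omega> \<noteq> z}"
      using \<rho>pos[OF Xt] by auto
    finally show ?thesis using sets_natural_filtration_subset[OF mp] by blast
  qed
  have hitI_sets: "{\<omega> \<in> space \<Omega>. hitting_time X (torus - I) \<omega> \<le> ereal t} \<in> sets \<Omega>" if t: "0 \<le> t" for t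
  proof -
    have "{\<omega> \<in> space \<Omega>. hitting_time X (torus - I) \<omega> \<le> ereal t} = space \<Omega> - {\<omega> \<in> space \<Omega>. \<forall>s\<in>{0..t}. X s \<omega> \<in> I}"
      using hitI[OF _ t] by auto
    then show ?thesis using staysI[OF t] by auto
  qed
  have F1s: "F1 \<in> sets (P x)" using hitI_sets[OF A0] by (simp add: F1_def setsP)
  have "F2 = (\<Union>q\<in>{q \<in> \<rat>. 0 \<le> q}. {\<omega> \<in> space \<Omega>. hitting_time X (torus - I) \<omega> \<le> ereal q}
      \<inter> {\<omega> \<in> space \<Omega>. \<forall>s\<in>{0..q}. X s \<omega> \<noteq> z})" (is "_ = ?U")
  proof (intro set_eqI iffI)
    fix \<omega> assume "\<omega> \<in> F2"
    then have \<omega>: "\<omega> \<in> space \<Omega>" and lt: "hitting_time X (torus - I) \<omega> < hitting_time X {z} \<omega>" by (auto simp: F2_def)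
    obtain r :: rat where r: "hitting_time X (torus - I) \<omega> < real_of_rat r" "real_of_rat r < hitting_time X {z} \<omega>"
      using ereal_dense3[OF lt] by auto
    have r0: "0 \<le> (real_of_rat r :: real)"
      using le_less_trans[OF hit0 r(1)] by (simp add: zero_ereal_def)
    have "\<not> hitting_time X {z} \<omega> \<le> ereal (real_of_rat r)" using r(2) by simp
    then show "\<omega> \<in> ?U" using r0 r(1) \<omega> hitz[OF \<omega> r0] by (intro UN_I[of "real_of_rat r"]) auto
  next
    fix \<omega> assume "\<omega> \<in> ?U"
    then obtain q where q: "0 \<le> q" "\<omega> \<in> space \<Omega>" "hitting_time X (torus - I) \<omega> \<le> ereal q" "\<forall>s\<in>{0..q}. X s \<omega> \<noteq> z" by auto
    then have "\<not> hitting_time X {z} \<omega> \<le> ereal q" using hitz[OF q(2,1)] by auto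
    then show "\<omega> \<in> F2" using q by (auto simp: F2_def intro: le_less_trans)
  qed
  also have "\<dots> \<in> sets \<Omega>"
  proof (rule sets.countable_UN'[OF _ image_subsetI])
    show "countable {q :: real. q \<in> \<rat> \<and> 0 \<le> q}" by (rule countable_subset[OF _ countable_rat]) auto
    show "{\<omega> \<in> space \<Omega>. hitting_time X (torus - I) \<omega> \<le> ereal q} \<inter> {\<omega> \<in> space \<Omega>. \<forall>s\<in>{0..q}. X s \<omega> \<noteq> z} \<in> sets \<Omega>"
      if "q \<in> {q. q \<in> \<rat> \<and> 0 \<le> q}" for q
      using that by (intro sets.Int hitI_sets staysz) auto
  qed
  finally have F2s: "F2 \<in> sets (P x)" by (simp add: setsP)
  \<comment> \<open>If the two exit times differ then the first one that occurs is a visit to \<open>z\<close>.\<close>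
  have key: "exp (- 1) * indicator (F1 - F2) \<omega> - ?G z \<le> \<Phi> (\<tau> \<omega>) \<omega> - \<Phi> (\<sigma> \<omega>) \<omega>" if \<omega>: "\<omega> \<in> space \<Omega>" for \<omega>
  proof -
    have \<tau>0: "0 \<le> \<tau> \<omega>" "\<tau> \<omega> \<le> A" and \<sigma>0: "0 \<le> \<sigma> \<omega>" "\<sigma> \<omega> \<le> \<tau> \<omega>"
      unfolding \<tau>_def \<sigma>_def using A0
      by (auto simp: exit_time_nonneg exit_time_le D_def I_def intro: exit_time_mono)
    have XI: "X s \<omega> \<in> I \<longleftrightarrow> 0 < ?h (X s \<omega>)" if "0 \<le> s" for s using Xt[OF that \<omega>] by (simp add: I_def)
    have late: "X (\<tau> \<omega>) \<omega> \<notin> I \<and> (\<exists>s. 0 \<le> s \<and> s < \<tau> \<omega> \<and> X s \<omega> = z)" if F: "\<omega> \<in> F1 - F2"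
    proof -
      obtain s where s: "0 \<le> s" "s \<le> A" "X s \<omega> \<notin> I" using F hitI[OF \<omega> A0] by (auto simp: F1_def)
      have out: "X (\<tau> \<omega>) \<omega> \<notin> I"
      proof (cases "\<tau> \<omega> < A")
        case True
        then have lt: "exit_time X I A \<omega> < A" by (simp add: \<tau>_def)
        show ?thesis
          unfolding \<tau>_def
          by (rule outside_at_exit[where f = "\<lambda>t. ?h (X t \<omega>)" and X = X and \<omega> = \<omega> and D = I and T = A])
            (rule hpath \<omega> XI A0 lt | assumption)+
      next
        case False
        moreover have "\<tau> \<omega> \<le> s" unfolding \<tau>_def by (rule exit_time_le_outside[of s X \<omega> I A]) (use s in auto)
        ultimately show ?thesis using s \<tau>0 by auto
      qed
      then have "hitting_time X (torus - I) \<omega> \<le> ereal (\<tau> \<omega>)" using hitI[OF \<omega> \<tau>0(1)] \<tau>0 by auto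
      moreover have "hitting_time X {z} \<omega> \<le> hitting_time X (torus - I) \<omega>" using F \<omega> by (auto simp: F2_def not_less)
      ultimately have "hitting_time X {z} \<omega> \<le> ereal (\<tau> \<omega>)" by simp
      then obtain r where r: "0 \<le> r" "r \<le> \<tau> \<omega>" "X r \<omega> = z" using hitz[OF \<omega> \<tau>0(1)] by auto
      moreover have "r \<noteq> \<tau> \<omega>" using r out z by (auto simp: I_def)
      ultimately show ?thesis using out by (intro conjI exI[of _ r]) auto
    qed
    have Gz: "0 \<le> ?G z" by (rule nonneg[OF z(1)])
    show ?thesis
    proof (cases "\<sigma> \<omega> = \<tau> \<omega>")
      case True
      have "\<omega> \<notin> F1 - F2"
      proof
        assume "\<omega> \<in> F1 - F2"
        then obtain r where r: "0 \<le> r" "r < \<tau> \<omega>" "X r \<omega> = z" using late by blast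
        have "X r \<omega> \<notin> D" using r(3) \<rho>pos[OF z(1)] by (auto simp: D_def)
        then have "\<sigma> \<omega> \<le> r" unfolding \<sigma>_def using exit_time_le_outside[OF r(1)] by metis
        then show False using r True by simp
      qed
      then show ?thesis using True Gz by simp
    next
      case False
      then have lt: "\<sigma> \<omega> < \<tau> \<omega>" using \<sigma>0 by simp
      have "X (\<sigma> \<omega>) \<omega> \<notin> D"
      proof -
        have "\<sigma> \<omega> < A" using lt \<tau>0 by simp
        moreover have "continuous_on {0..} (\<lambda>t. min (\<rho> (X t \<omega>)) (?h (X t \<omega>)))"
          by (intro continuous_intros hpath \<rho>path \<omega>)
        moreover have "X s \<omega> \<in> D \<longleftrightarrow> 0 < min (\<rho> (X s \<omega>)) (?h (X s \<omega>))" if "0 \<le> s" for s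
          using Xt[OF that \<omega>] by (auto simp: D_def)
        ultimately show ?thesis
          unfolding \<sigma>_def
          by (intro outside_at_exit[where f = "\<lambda>t. min (\<rho> (X t \<omega>)) (?h (X t \<omega>))" and X = X and \<omega> = \<omega> and D = D and T = A] A0)
      qed
      moreover have "X (\<sigma> \<omega>) \<omega> \<in> I" using exit_time_before[of "\<sigma> \<omega>" X I A \<omega>] lt \<sigma>0 by (simp add: \<tau>_def)
      ultimately have Xz: "X (\<sigma> \<omega>) \<omega> = z" using \<rho>pos[of "X (\<sigma> \<omega>) \<omega>"] by (auto simp: D_def I_def)
      have "exp (- (1 / A) * \<sigma> \<omega>) \<le> 1" using A \<sigma>0 by simp
      then have 1: "\<Phi> (\<sigma> \<omega>) \<omega> \<le> ?G z" using mult_right_mono[OF _ Gz, of "exp (- (1 / A) * \<sigma> \<omega>)" 1] by (simp add: \<Phi>_def Xz)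
      have 2: "exp (- 1) * indicator (F1 - F2) \<omega> \<le> \<Phi> (\<tau> \<omega>) \<omega>"
      proof (cases "\<omega> \<in> F1 - F2")
        case True
        then have "X (\<tau> \<omega>) \<omega> \<notin> I" using late by blast
        then have "?h (X (\<tau> \<omega>) \<omega>) \<le> 0" using XI[OF \<tau>0(1)] by simp
        then have "?G (X (\<tau> \<omega>) \<omega>) = 1" using arc_extension_outside[OF cd] bdry by simp
        moreover have "exp (- 1) \<le> exp (- (1 / A) * \<tau> \<omega>)" using \<tau>0 A by (simp add: field_simps)
        ultimately show ?thesis using True by (simp add: \<Phi>_def)
      next
        case False
        then show ?thesis using nonneg[OF Xt[OF \<tau>0(1) \<omega>]] by (simp add: \<Phi>_def)
      qed
      show ?thesis using 1 2 by simp
    qed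
  qed
  obtain C where C: "\<And>y. y \<in> torus \<Longrightarrow> \<bar>?G y\<bar> \<le> C"
  proof -
    have "continuous_on UNIV ?G" by (rule continuous_arc_extension[OF cd _ cg]) (simp add: bdry)
    then show ?thesis by (rule continuous_bounded_on_torus) (rule that)
  qed
  have \<Phi>b: "norm (\<Phi> t \<omega>) \<le> C" if "\<omega> \<in> space \<Omega>" "0 \<le> t" for t \<omega>
  proof -
    have "exp (- (1 / A) * t) \<le> 1" using A that by simp
    then have "exp (- (1 / A) * t) * \<bar>?G (X t \<omega>)\<bar> \<le> 1 * C" using C[OF Xt[OF that(2,1)]] by (intro mult_mono) auto
    then show ?thesis by (simp add: \<Phi>_def abs_mult)
  qed
  have int\<tau>: "integrable (P x) (\<lambda>\<omega>. \<Phi> (\<tau> \<omega>) \<omega>)"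
    by (rule integrable_const_bound[OF _ E\<tau>(1), of C]) (use \<Phi>b A0 in \<open>auto simp: sp \<tau>_def exit_time_nonneg\<close>)
  have int\<sigma>: "integrable (P x) (\<lambda>\<omega>. \<Phi> (\<sigma> \<omega>) \<omega>)"
    by (rule integrable_const_bound[OF _ E\<sigma>(1), of C]) (use \<Phi>b A0 in \<open>auto simp: sp \<sigma>_def exit_time_nonneg\<close>)
  have F12: "F1 - F2 \<in> sets (P x)" using F1s F2s by auto
  have intF1: "integrable (P x) (\<lambda>\<omega>. exp (- 1) * indicator (F1 - F2) \<omega> :: real)"
    using F12 by (intro integrable_mult_right integrable_real_indicator) (auto simp: emeasure_eq_measure)
  have intG: "integrable (P x) (\<lambda>\<omega>. ?G z)" by simp
  note intF = Bochner_Integration.integrable_diff[OF intF1 intG]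
  have "(\<integral>\<omega>. exp (- 1) * indicator (F1 - F2) \<omega> - ?G z \<partial>P x) \<le> (\<integral>\<omega>. \<Phi> (\<tau> \<omega>) \<omega> - \<Phi> (\<sigma> \<omega>) \<omega> \<partial>P x)"
    by (intro integral_mono intF Bochner_Integration.integrable_diff int\<tau> int\<sigma>) (use key sp in auto)
  also have "\<dots> = 0" using int\<tau> int\<sigma> E\<tau>(2) E\<sigma>(2) by simp
  also have "(\<integral>\<omega>. exp (- 1) * indicator (F1 - F2) \<omega> - ?G z \<partial>P x) = exp (- 1) * measure (P x) (F1 - F2) - ?G z"
    using sets.Int_space_eq2[OF F12] by (subst Bochner_Integration.integral_diff[OF intF1 intG]) (simp add: prob_space)
  finally have "exp (- 1) * measure (P x) (F1 - F2) \<le> ?G z" by simp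
  then have "exp 1 * (exp (- 1) * measure (P x) (F1 - F2)) \<le> exp 1 * ?G z" by (intro mult_left_mono) auto
  moreover have "exp 1 * (exp (- 1) * r) = r" for r :: real by (simp add: exp_minus)
  ultimately have 3: "measure (P x) (F1 - F2) \<le> exp 1 * ?G z" by simp
  have "F1 \<subseteq> F2 \<union> (F1 - F2)" by auto
  then have "measure (P x) F1 \<le> measure (P x) (F2 \<union> (F1 - F2))" using sets.Un[OF F2s F12] by (intro finite_measure_mono)
  also have "\<dots> \<le> measure (P x) F2 + measure (P x) (F1 - F2)" using F2s F12 by (intro measure_Un_le)
  finally show ?thesis using 3 by (simp add: F1_def F2_def)
qed

section \<open>The equilibrium function of the enlarged process\<close>

lemma space_torus2_borel: "space torus2_borel = torus \<times> {-1, 1}"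
  by (simp add: torus2_borel_def space_pair_measure space_torus_borel)

lemma snd_measurable_torus2: "{y \<in> space torus2_borel. snd y = 1} \<in> sets torus2_borel"
proof -
  have "snd -` {1} \<inter> space torus2_borel \<in> sets torus2_borel"
    unfolding torus2_borel_def by (rule measurable_sets[OF measurable_snd]) simp
  also have "snd -` {1} \<inter> space torus2_borel = {y \<in> space torus2_borel. snd y = 1}" by auto
  finally show ?thesis .
qed

lemma fst_measurable_torus2: "F \<in> borel_measurable borel \<Longrightarrow> (\<lambda>y. F (fst y)) \<in> borel_measurable torus2_borel"
  unfolding torus2_borel_def by (rule measurable_compose[OF measurable_fst measurable_torus_borel])

lemma C2_torus_const: "(\<lambda>_. a) \<in> C2_torus"
proof -
  have "C2_on_open UNIV (\<lambda>_. a)"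
    by (rule C2_on_openI[of _ _ "\<lambda>_. 0" "\<lambda>_. 0"]) simp_all
  then show ?thesis by (simp add: C2_torus_def periodic1_def)
qed

lemma exit_time_cap:
  assumes "0 \<le> s" "Z s \<omega> \<notin> D" "s \<le> T"
  shows "exit_time Z D T \<omega> = exit_time Z D s \<omega>"
proof (rule antisym)
  have "exit_time Z D T \<omega> \<le> s" by (rule exit_time_le_outside) (rule assms)+
  then show "exit_time Z D T \<omega> \<le> exit_time Z D s \<omega>"
    by (intro exit_time_ge) (auto intro: exit_time_before)
  show "exit_time Z D s \<omega> \<le> exit_time Z D T \<omega>"
    using exit_time_le[of Z D s \<omega>] assms(3) by (intro exit_time_ge) (auto intro: exit_time_before)
qed

text \<open>The standing assumptions for the identification of \<open>g\<close> with the equilibrium function.\<close>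

locale enlarged_arc =
  fixes b :: "real \<Rightarrow> real" and \<epsilon> \<gamma> c d :: real
    and \<Omega> :: "'v measure" and Q :: "real \<times> int \<Rightarrow> 'v measure" and Y :: "real \<Rightarrow> 'v \<Rightarrow> real \<times> int"
    and g g' :: "real \<Rightarrow> real"
  assumes enl: "enlarged_process b \<epsilon> \<gamma> \<Omega> Q Y" and per: "periodic1 b" and \<epsilon>: "0 < \<epsilon>" and \<gamma>: "0 < \<gamma>"
    and cd: "c < d" "d \<le> c + 1"
    and cg: "continuous_on {c..d} g" and bdry: "g c = 1" "g d = 1"
    and C2: "C2_on_open {c<..<d} g"
    and dg: "\<And>x. x \<in> {c<..<d} \<Longrightarrow> (g has_real_derivative g' x) (at x)"
    and dg': "\<And>x. x \<in> {c<..<d} \<Longrightarrow>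
      (g' has_real_derivative \<gamma> / (exp (barrier b / \<epsilon>) * \<epsilon>) * g x - b x / \<epsilon> * g' x) (at x)"
begin

abbreviation "h \<equiv> arc_height c d"
abbreviation "G \<equiv> arc_extension c d g"
abbreviation "E \<equiv> torus2_borel"

text \<open>The part of the upper copy of the arc where the height exceeds \<open>\<kappa>\<close>. For \<open>\<kappa> = 0\<close> its complement is
  the union of the two sets whose hitting times define the equilibrium function.\<close>

definition region :: "real \<Rightarrow> (real \<times> int) set"
  where "region \<kappa> = {y \<in> {y \<in> space E. snd y = 1}. \<kappa> < h (fst y)}"

lemma mp: "markov_process E \<Omega> Q Y"
  and path: "\<And>\<omega>. \<omega> \<in> space \<Omega> \<Longrightarrow> continuous_on {0..} (\<lambda>t. cis (2 * pi * fst (Y t \<omega>)))"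
  and sign_path: "\<And>\<omega> t. \<omega> \<in> space \<Omega> \<Longrightarrow> 0 \<le> t \<Longrightarrow> continuous (at_right t) (\<lambda>s. snd (Y s \<omega>))"
  and gen: "has_generator_on C2_torus2 E Q Y (gen_enlarged b \<epsilon> \<gamma>)"
  using enl by (auto simp: enlarged_process_def)

lemma Y_space: "0 \<le> s \<Longrightarrow> \<omega> \<in> space \<Omega> \<Longrightarrow> Y s \<omega> \<in> space E"
  using measurable_space[OF markov_process_measurable[OF mp]] by blast

lemma Y_torus: "0 \<le> s \<Longrightarrow> \<omega> \<in> space \<Omega> \<Longrightarrow> fst (Y s \<omega>) \<in> torus"
  and Y_sign: "0 \<le> s \<Longrightarrow> \<omega> \<in> space \<Omega> \<Longrightarrow> snd (Y s \<omega>) \<noteq> 1 \<Longrightarrow> snd (Y s \<omega>) = -1"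
  using Y_space[of s \<omega>] by (auto simp: space_torus2_borel mem_Times_iff)

lemma torus_path:
  "periodic1 F \<Longrightarrow> continuous_on UNIV F \<Longrightarrow> \<omega> \<in> space \<Omega> \<Longrightarrow> continuous_on {0..} (\<lambda>t. F (fst (Y t \<omega>)))"
  for F :: "real \<Rightarrow> real"
  by (rule continuous_on_torus_path[OF _ _ path])

lemma hpath: "\<omega> \<in> space \<Omega> \<Longrightarrow> continuous_on {0..} (\<lambda>t. h (fst (Y t \<omega>)))"
  by (rule torus_path[OF periodic1_arc_height continuous_arc_height])

lemma stays_in_region:
  assumes t: "0 \<le> t"
  shows "{\<omega> \<in> space \<Omega>. \<forall>s\<in>{0..t}. Y s \<omega> \<in> region \<kappa>} \<in> sets (natural_filtration \<Omega> E Y t)"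
proof -
  note Ym = markov_process_measurable[OF mp]
  have 1: "{\<omega> \<in> space \<Omega>. \<forall>s\<in>{0..t}. snd (Y s \<omega>) = 1} \<in> sets (natural_filtration \<Omega> E Y t)"
    by (rule stays_in_state_measurable[where \<phi> = snd and Z = Y and E = E and \<Omega> = \<Omega> and t = t, OF snd_measurable_torus2 Ym sign_path t])
  have 2: "{\<omega> \<in> space \<Omega>. \<forall>s\<in>{0..t}. 0 < (\<lambda>y. h (fst y) - \<kappa>) (Y s \<omega>)} \<in> sets (natural_filtration \<Omega> E Y t)"
  proof (rule stays_positive_measurable[where \<psi> = "\<lambda>y. h (fst y) - \<kappa>" and Z = Y and E = E and \<Omega> = \<Omega> and t = t, OF _ Ym _ t])
    show "(\<lambda>y. h (fst y) - \<kappa>) \<in> borel_measurable E"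
      by (intro borel_measurable_diff borel_measurable_const fst_measurable_torus2
          borel_measurable_continuous_onI continuous_arc_height)
    show "continuous_on {0..} (\<lambda>s. h (fst (Y s \<omega>)) - \<kappa>)" if "\<omega> \<in> space \<Omega>" for \<omega>
      by (intro continuous_on_diff continuous_on_const hpath that)
  qed
  have "{\<omega> \<in> space \<Omega>. \<forall>s\<in>{0..t}. Y s \<omega> \<in> region \<kappa>} = {\<omega> \<in> space \<Omega>. \<forall>s\<in>{0..t}. snd (Y s \<omega>) = 1} \<inter>
      {\<omega> \<in> space \<Omega>. \<forall>s\<in>{0..t}. 0 < (\<lambda>y. h (fst y) - \<kappa>) (Y s \<omega>)}"
    using Y_space by (auto simp: region_def)
  then show ?thesis using sets.Int[OF 1 2] by simp
qed

lemma right_continuous_up: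
  assumes \<omega>: "\<omega> \<in> space \<Omega>" and t: "0 \<le> t" and w: "periodic1 w" "continuous_on UNIV w"
  shows "continuous (at_right t) (\<lambda>s. if snd (Y s \<omega>) = 1 then w (fst (Y s \<omega>)) else 0 :: real)"
proof -
  have ev: "\<forall>\<^sub>F s in at_right t. snd (Y s \<omega>) = snd (Y t \<omega>)"
    using sign_path[OF \<omega> t] unfolding continuous_within by (rule tendsto_discrete[THEN iffD1])
  have "((\<lambda>s. w (fst (Y s \<omega>))) \<longlongrightarrow> w (fst (Y t \<omega>))) (at_right t)"
    using continuous_on_at_right[OF torus_path[OF w \<omega>] t] by (simp add: continuous_within)
  then have lim: "((\<lambda>s. if snd (Y t \<omega>) = 1 then w (fst (Y s \<omega>)) else 0) \<longlongrightarrow>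
      (if snd (Y t \<omega>) = 1 then w (fst (Y t \<omega>)) else 0)) (at_right t)"
    by (cases "snd (Y t \<omega>) = 1") simp_all
  show ?thesis
    unfolding continuous_within
  proof (rule Lim_transform_eventually[OF lim])
    show "\<forall>\<^sub>F s in at_right t. (if snd (Y t \<omega>) = 1 then w (fst (Y s \<omega>)) else 0) =
        (if snd (Y s \<omega>) = 1 then w (fst (Y s \<omega>)) else 0)"
      using ev by eventually_elim simp
  qed
qed

lemma up_measurable:
  assumes "w \<in> borel_measurable borel"
  shows "(\<lambda>y. if snd y = 1 then w (fst y) else 0 :: real) \<in> borel_measurable E"
  by (rule measurable_If[OF fst_measurable_torus2[OF assms] measurable_const snd_measurable_torus2]) simp

text \<open>Optional stopping for a function on the upper copy of the torus, on leaving a region in which it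
  is an eigenfunction of the generator.\<close>

lemma up_exit_expectation:
  assumes w: "w \<in> C2_torus" and x: "x \<in> torus" and T: "0 \<le> T"
    and eig: "\<And>y. y \<in> torus \<Longrightarrow> \<kappa> < h y \<Longrightarrow> gen_torus b \<epsilon> w y - \<gamma> * w y = lam * w y"
  defines "v \<equiv> \<lambda>y. if snd y = 1 then w (fst y) else 0"
  shows "(\<integral>\<omega>. exp (- lam * exit_time Y (region \<kappa>) T \<omega>) * v (Y (exit_time Y (region \<kappa>) T \<omega>) \<omega>) \<partial>Q (x, 1)) = w x"
proof -
  have wc: "continuous_on UNIV w" by (rule C2_torus_continuous[OF w])
  have wp: "periodic1 w" using w by (simp add: C2_torus_def)
  obtain C where C: "\<And>y. y \<in> torus \<Longrightarrow> \<bar>w y\<bar> \<le> C" by (rule continuous_bounded_on_torus[OF wc]) blast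
  have xE: "(x, 1) \<in> space E" using x by (simp add: space_torus2_borel)
  have vC: "\<bar>v y\<bar> \<le> C" if "y \<in> space E" for y
  proof -
    have "fst y \<in> torus" using that by (auto simp: space_torus2_borel)
    from C[OF this] show ?thesis by (auto simp: v_def)
  qed
  have vm: "v \<in> borel_measurable E"
    unfolding v_def by (rule up_measurable) (rule borel_measurable_continuous_onI[OF wc])
  have "(\<lambda>_. 0) \<in> C2_torus" by (rule C2_torus_const)
  then have v2: "v \<in> C2_torus2" using w by (simp add: C2_torus2_def v_def)
  have "uniform_limit (space E) (\<lambda>t y. ((\<integral>\<omega>. v (Y t \<omega>) \<partial>Q y) - v y) / t) (gen_enlarged b \<epsilon> \<gamma> v) (at_right 0)"
    using gen v2 by (simp add: has_generator_on_def)
  then have "uniform_limit (region \<kappa>) (\<lambda>t y. ((\<integral>\<omega>. v (Y t \<omega>) \<partial>Q y) - v y) / t) (gen_enlarged b \<epsilon> \<gamma> v) (at_right 0)"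
    by (rule uniform_limit_on_subset) (auto simp: region_def)
  moreover have "gen_enlarged b \<epsilon> \<gamma> v y = lam * v y" if y: "y \<in> region \<kappa>" for y
  proof -
    have "fst y \<in> torus" "snd y = 1" "\<kappa> < h (fst y)" using y by (auto simp: region_def space_torus2_borel)
    then show ?thesis using eig[of "fst y"] by (simp add: gen_enlarged_def v_def case_prod_beta)
  qed
  ultimately have ul: "uniform_limit (region \<kappa>) (\<lambda>t y. ((\<integral>\<omega>. v (Y t \<omega>) \<partial>Q y) - v y) / t) (\<lambda>y. lam * v y) (at_right 0)"
    by (subst uniform_limit_cong'[of _ _ _ _ "gen_enlarged b \<epsilon> \<gamma> v"]) auto
  have sub: "region \<kappa> \<subseteq> space E" by (auto simp: region_def)
  have rc: "continuous (at_right t) (\<lambda>s. v (Y s \<omega>))" if "\<omega> \<in> space \<Omega>" "0 \<le> t" for \<omega> t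
    unfolding v_def by (rule right_continuous_up[OF that wp wc])
  have "(\<integral>\<omega>. exp (- lam * exit_time Y (region \<kappa>) T \<omega>) * v (Y (exit_time Y (region \<kappa>) T \<omega>) \<omega>) \<partial>Q (x, 1)) = v (x, 1)"
    by (rule expectation_at_exit[OF mp xE vm vC sub ul stays_in_region rc T])
  also have "v (x, 1) = w x" by (simp add: v_def)
  finally show ?thesis .
qed

lemma up_value_measurable:
  assumes w: "periodic1 w" "continuous_on UNIV w" and x: "x \<in> torus" and T: "0 \<le> T"
  shows "(\<lambda>\<omega>. exp (a * exit_time Y (region \<kappa>) T \<omega>) * (if snd (Y (exit_time Y (region \<kappa>) T \<omega>) \<omega>) = 1
    then w (fst (Y (exit_time Y (region \<kappa>) T \<omega>) \<omega>)) else 0 :: real)) \<in> borel_measurable (Q (x, 1))"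
proof -
  have xE: "(x, 1) \<in> space E" using x by (simp add: space_torus2_borel)
  note law = markov_process_lawD[OF mp xE]
  define \<Phi> where "\<Phi> t \<omega> = exp (a * t) * (if snd (Y t \<omega>) = 1 then w (fst (Y t \<omega>)) else 0 :: real)" for t \<omega>
  have 1: "\<Phi> t \<in> borel_measurable (Q (x, 1))" if "0 \<le> t" for t
  proof -
    have "(\<lambda>\<omega>. if snd (Y t \<omega>) = 1 then w (fst (Y t \<omega>)) else 0 :: real) \<in> borel_measurable \<Omega>"
      by (rule measurable_compose[OF markov_process_measurable[OF mp that] up_measurable])
        (rule borel_measurable_continuous_onI[OF w(2)])
    then have "(\<lambda>\<omega>. if snd (Y t \<omega>) = 1 then w (fst (Y t \<omega>)) else 0 :: real) \<in> borel_measurable (Q (x, 1))"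
      using measurable_cong_sets[OF law(2) refl] by blast
    then show ?thesis unfolding \<Phi>_def by (intro borel_measurable_times borel_measurable_const)
  qed
  have 2: "{\<omega> \<in> space (Q (x, 1)). \<forall>s\<in>{0..t}. Y s \<omega> \<in> region \<kappa>} \<in> sets (Q (x, 1))" if "0 \<le> t" for t
    using subsetD[OF sets_natural_filtration_subset[OF mp] stays_in_region[OF that, of \<kappa>]] by (simp only: law)
  have 3: "continuous (at_right t) (\<lambda>s. \<Phi> s \<omega>)" if "\<omega> \<in> space (Q (x, 1))" "0 \<le> t" for \<omega> t
    unfolding \<Phi>_def
  proof (rule continuous_mult)
    show "continuous (at_right t) (\<lambda>s. if snd (Y s \<omega>) = 1 then w (fst (Y s \<omega>)) else 0)"
      using that law(3) by (intro right_continuous_up w) simp_all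
  qed (intro continuous_intros)
  show ?thesis
    using exit_value_measurable(1)[where \<Phi> = \<Phi> and Z = Y and D = "region \<kappa>" and T = T, OF 1 2 3 T] unfolding \<Phi>_def by simp
qed

text \<open>The function that is 1 on the upper copy is an eigenfunction with eigenvalue \<open>-\<gamma>\<close>, since only the flips
  of the sign act on it.\<close>

lemma flip_rate:
  fixes \<kappa> :: real
  assumes x: "x \<in> torus" and T: "0 \<le> T"
  defines "\<tau> \<equiv> exit_time Y (region \<kappa>) T"
  shows "(\<integral>\<omega>. exp (\<gamma> * \<tau> \<omega>) * (if snd (Y (\<tau> \<omega>) \<omega>) = 1 then 1 else 0) \<partial>Q (x, 1)) = 1"
proof -
  have 1: "(\<lambda>_. 1) \<in> C2_torus" by (rule C2_torus_const)
  have "gen_torus b \<epsilon> (\<lambda>_. 1) y - \<gamma> * 1 = - \<gamma> * 1" for y by (simp add: gen_torus_def)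
  from up_exit_expectation[OF 1 x T this] show ?thesis
    by (simp only: \<tau>_def minus_minus)
qed

text \<open>The sign does not flip at the very time at which the first coordinate reaches the end of the arc. By
  \<open>flip_rate\<close>, the weighted probability of still having sign 1 is equal to 1 both at the exit from the
  exhausting regions and at the exit from their union. In the limit the former also counts the paths
  that flip exactly when they reach the boundary, so the probability of these paths, the event \<open>B\<close>, is 0.\<close>

lemma sign_flip_not_at_exit:
  assumes x: "x \<in> torus" and T: "0 \<le> T" and \<kappa>: "decseq \<kappa>" "\<And>n. 0 < \<kappa> n" "\<kappa> \<longlonglongrightarrow> 0"
  defines "\<tau> \<equiv> exit_time Y (region 0) T" and "\<tau>n \<equiv> \<lambda>n. exit_time Y (region (\<kappa> n)) T"
  shows "AE \<omega> in Q (x, 1).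
    (\<lambda>n. if snd (Y (\<tau>n n \<omega>) \<omega>) = 1 then 1 else 0 :: real) \<longlonglongrightarrow> (if snd (Y (\<tau> \<omega>) \<omega>) = 1 then 1 else 0)"
proof -
  have xE: "(x, 1) \<in> space E" using x by (simp add: space_torus2_borel)
  note law = markov_process_lawD[OF mp xE]
  interpret prob_space "Q (x, 1)" by (rule law)
  have \<tau>n0: "0 \<le> \<tau>n n \<omega>" "\<tau>n n \<omega> \<le> T" and \<tau>0: "0 \<le> \<tau> \<omega>" "\<tau> \<omega> \<le> T" for n \<omega>
    by (simp_all add: \<tau>n_def \<tau>_def exit_time_nonneg[OF T] exit_time_le)
  have mono: "\<tau>n n \<omega> \<le> \<tau>n m \<omega>" if "n \<le> m" for n m \<omega>
    unfolding \<tau>n_def by (rule exit_time_mono) (use decseqD[OF \<kappa>(1) that] in \<open>auto simp: region_def\<close>)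
  have le: "\<tau>n n \<omega> \<le> \<tau> \<omega>" for n \<omega>
    unfolding \<tau>n_def \<tau>_def by (rule exit_time_mono) (use \<kappa>(2)[of n] in \<open>auto simp: region_def\<close>)
  have \<tau>lim: "(\<lambda>n. \<tau>n n \<omega>) \<longlonglongrightarrow> \<tau> \<omega>" if \<omega>: "\<omega> \<in> space \<Omega>" for \<omega>
    unfolding \<tau>n_def \<tau>_def region_def
    by (rule exit_time_exhaustion[where \<psi> = "\<lambda>y. h (fst y)" and Z = Y]) (rule hpath[OF \<omega>] T \<kappa>)+
  define I where "I n \<omega> = (if snd (Y (\<tau>n n \<omega>) \<omega>) = 1 then 1 else 0 :: real)" for n \<omega>
  define I' where "I' \<omega> = (if snd (Y (\<tau> \<omega>) \<omega>) = 1 then 1 else 0 :: real)" for \<omega>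
  \<comment> \<open>the indicator function of a sign flip exactly at the limiting time\<close>
  define B where "B \<omega> = (if snd (Y (\<tau> \<omega>) \<omega>) \<noteq> 1 \<and> (\<forall>n. \<tau>n n \<omega> < \<tau> \<omega>) then 1 else 0 :: real)" for \<omega>
  have lim: "(\<lambda>n. I n \<omega>) \<longlonglongrightarrow> I' \<omega> + B \<omega>" for \<omega>
  proof (cases "\<forall>n. \<tau>n n \<omega> < \<tau> \<omega>")
    case True
    have "I n \<omega> = 1" for n
    proof -
      have "Y (\<tau>n n \<omega>) \<omega> \<in> region 0"
        using True \<tau>n0(1) unfolding \<tau>_def by (intro exit_time_before[of "\<tau>n n \<omega>" Y "region 0" T \<omega>]) auto
      then show ?thesis by (simp add: I_def region_def)
    qed
    moreover have "I' \<omega> + B \<omega> = 1" using True by (simp add: I'_def B_def)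
    ultimately show ?thesis by simp
  next
    case False
    then obtain n where n: "\<tau>n n \<omega> = \<tau> \<omega>" using le by (metis le_less)
    have "\<tau>n m \<omega> = \<tau> \<omega>" if "n \<le> m" for m
      using mono[OF that, of \<omega>] le[of m \<omega>] n by simp
    then have "\<forall>\<^sub>F m in sequentially. I m \<omega> = I' \<omega> + B \<omega>"
      using False by (auto simp: eventually_sequentially I_def I'_def B_def intro!: exI[of _ n])
    then show ?thesis by (rule tendsto_eventually)
  qed
  have one: "periodic1 (\<lambda>_. 1)" "continuous_on UNIV (\<lambda>_. 1 :: real)" by (simp_all add: periodic1_def)
  have m: "(\<lambda>\<omega>. exp (\<gamma> * \<tau> \<omega>) * I' \<omega>) \<in> borel_measurable (Q (x, 1))"
    "(\<lambda>\<omega>. exp (\<gamma> * \<tau>n n \<omega>) * I n \<omega>) \<in> borel_measurable (Q (x, 1))" for n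
    unfolding I_def I'_def \<tau>_def \<tau>n_def by (rule up_value_measurable[OF one x T])+
  have e: "(\<integral>\<omega>. exp (\<gamma> * \<tau> \<omega>) * I' \<omega> \<partial>Q (x, 1)) = 1" "(\<integral>\<omega>. exp (\<gamma> * \<tau>n n \<omega>) * I n \<omega> \<partial>Q (x, 1)) = 1" for n
    unfolding I_def I'_def \<tau>_def \<tau>n_def by (rule flip_rate[OF x T])+
  have lim2: "(\<lambda>n. exp (\<gamma> * \<tau>n n \<omega>) * I n \<omega>) \<longlonglongrightarrow> exp (\<gamma> * \<tau> \<omega>) * (I' \<omega> + B \<omega>)" if "\<omega> \<in> space (Q (x, 1))" for \<omega>
    using that by (intro tendsto_intros lim \<tau>lim) (simp add: law)
  have m2: "(\<lambda>\<omega>. exp (\<gamma> * \<tau> \<omega>) * (I' \<omega> + B \<omega>)) \<in> borel_measurable (Q (x, 1))"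
    by (rule borel_measurable_LIMSEQ_real[OF lim2 m(2)])
  have bound: "exp (\<gamma> * t) * r \<le> exp (\<gamma> * T) * 1" if "t \<le> T" "0 \<le> r" "r \<le> 1" for t r
    using that \<gamma> by (intro mult_mono) auto
  have I01: "0 \<le> I n \<omega>" "I n \<omega> \<le> 1" "0 \<le> I' \<omega>" "I' \<omega> \<le> 1" "0 \<le> B \<omega>" "I' \<omega> + B \<omega> \<le> 1" for n \<omega>
    by (auto simp: I_def I'_def B_def)
  have "(\<lambda>n. \<integral>\<omega>. exp (\<gamma> * \<tau>n n \<omega>) * I n \<omega> \<partial>Q (x, 1)) \<longlonglongrightarrow> (\<integral>\<omega>. exp (\<gamma> * \<tau> \<omega>) * (I' \<omega> + B \<omega>) \<partial>Q (x, 1))"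
  proof (rule integral_dominated_convergence[where w = "\<lambda>_. exp (\<gamma> * T) * 1"])
    show "AE \<omega> in Q (x, 1). norm (exp (\<gamma> * \<tau>n n \<omega>) * I n \<omega>) \<le> exp (\<gamma> * T) * 1" for n
      using bound[OF \<tau>n0(2) I01(1,2)] I01(1) by (simp add: abs_mult)
  qed (use m m2 lim2 in auto)
  then have e2: "(\<integral>\<omega>. exp (\<gamma> * \<tau> \<omega>) * (I' \<omega> + B \<omega>) \<partial>Q (x, 1)) = 1" unfolding e by (simp add: LIMSEQ_const_iff)
  have i1: "integrable (Q (x, 1)) (\<lambda>\<omega>. exp (\<gamma> * \<tau> \<omega>) * I' \<omega>)"
    by (rule integrable_const_bound[OF _ m(1), of "exp (\<gamma> * T) * 1"])
      (use bound[OF \<tau>0(2) I01(3,4)] I01(3) in \<open>simp add: abs_mult\<close>)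
  have "0 \<le> I' \<omega> + B \<omega>" for \<omega> using I01(3,5)[of \<omega>] by linarith
  then have i2: "integrable (Q (x, 1)) (\<lambda>\<omega>. exp (\<gamma> * \<tau> \<omega>) * (I' \<omega> + B \<omega>))"
    by (intro integrable_const_bound[OF _ m2, of "exp (\<gamma> * T) * 1"])
      (use bound[OF \<tau>0(2) _ I01(6)] in \<open>simp add: abs_mult\<close>)
  have "exp (\<gamma> * \<tau> \<omega>) * B \<omega> = exp (\<gamma> * \<tau> \<omega>) * (I' \<omega> + B \<omega>) - exp (\<gamma> * \<tau> \<omega>) * I' \<omega>" for \<omega>
    by (simp add: distrib_left)
  then have "integrable (Q (x, 1)) (\<lambda>\<omega>. exp (\<gamma> * \<tau> \<omega>) * B \<omega>)" "(\<integral>\<omega>. exp (\<gamma> * \<tau> \<omega>) * B \<omega> \<partial>Q (x, 1)) = 0"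
    using Bochner_Integration.integrable_diff[OF i2 i1] Bochner_Integration.integral_diff[OF i2 i1] e(1) e2 by simp_all
  then have "AE \<omega> in Q (x, 1). exp (\<gamma> * \<tau> \<omega>) * B \<omega> = 0"
    using I01(5) by (subst (asm) integral_nonneg_eq_0_iff_AE) auto
  then have "AE \<omega> in Q (x, 1). (\<lambda>n. I n \<omega>) \<longlonglongrightarrow> I' \<omega>"
  proof eventually_elim
    case (elim \<omega>)
    then show ?case using lim[of \<omega>] by simp
  qed
  then show ?thesis by (simp add: I_def I'_def)
qed

text \<open>This is optional stopping for the harmonic function equal to \<open>g\<close> on the upper copy and to 0 on the lower
  one, by the same exhaustion as for the diffusion. Now the sign may jump at the limiting exit time, and
  the previous lemma is needed for the convergence of the sign.\<close>

lemma up_exit_value: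
  assumes x: "x \<in> torus" "0 < h x" and T: "0 \<le> T"
  defines "\<tau> \<equiv> exit_time Y (region 0) T"
  shows "(\<integral>\<omega>. (if snd (Y (\<tau> \<omega>) \<omega>) = 1 then G (fst (Y (\<tau> \<omega>) \<omega>)) else 0) \<partial>Q (x, 1)) = G x"
proof -
  have xE: "(x, 1) \<in> space E" using x by (simp add: space_torus2_borel)
  note law = markov_process_lawD[OF mp xE]
  interpret prob_space "Q (x, 1)" by (rule law)
  have cG: "continuous_on UNIV G" by (rule continuous_arc_extension[OF cd _ cg]) (simp add: bdry)
  obtain C where C: "\<And>y. y \<in> torus \<Longrightarrow> \<bar>G y\<bar> \<le> C" by (rule continuous_bounded_on_torus[OF cG]) blast
  \<comment> \<open>The levels are below the height of \<open>x\<close>, so that the path starts inside all the regions.\<close>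
  define \<kappa> where "\<kappa> n = h x / real (n + 2)" for n
  have \<kappa>0: "0 < \<kappa> n" and \<kappa>x: "\<kappa> n < h x" for n
    using x mult_strict_left_mono[of 1 "real (n + 2)" "h x"] by (simp_all add: \<kappa>_def divide_less_eq)
  have \<kappa>lim: "\<kappa> \<longlonglongrightarrow> 0" unfolding \<kappa>_def by (rule LIMSEQ_ignore_initial_segment[OF lim_const_over_n])
  have \<kappa>dec: "decseq \<kappa>"
    unfolding decseq_def \<kappa>_def using x by (auto intro!: divide_left_mono)
  define \<tau>n where "\<tau>n n = exit_time Y (region (\<kappa> n)) T" for n
  have \<tau>n0: "0 \<le> \<tau>n n \<omega>" "\<tau>n n \<omega> \<le> T" and \<tau>0: "0 \<le> \<tau> \<omega>" "\<tau> \<omega> \<le> T" for n \<omega>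
    by (simp_all add: \<tau>n_def \<tau>_def exit_time_nonneg[OF T] exit_time_le)
  have \<tau>lim: "(\<lambda>n. \<tau>n n \<omega>) \<longlonglongrightarrow> \<tau> \<omega>" if \<omega>: "\<omega> \<in> space \<Omega>" for \<omega>
    unfolding \<tau>n_def \<tau>_def region_def
    by (rule exit_time_exhaustion[where \<psi> = "\<lambda>y. h (fst y)" and Z = Y]) (rule hpath[OF \<omega>] T \<kappa>lim \<kappa>0)+
  define u where "u n = arc_cutoff c d g (\<kappa> n)" for n
  have uC2: "u n \<in> C2_torus" for n unfolding u_def by (rule C2_arc_cutoff[OF cd \<kappa>0 C2])
  have uG: "u n y = G y" if "\<kappa> n \<le> h y" for n y unfolding u_def by (rule arc_cutoff_inside[OF \<kappa>0 that])
  have ueig: "gen_torus b \<epsilon> (u n) y - \<gamma> * u n y = 0 * u n y" if "\<kappa> n < h y" for n y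
    using gen_torus_arc_cutoff[OF cd \<kappa>0 per \<epsilon> dg dg' that] by (simp add: u_def)
  let ?U = "\<lambda>n \<omega>. if snd (Y (\<tau>n n \<omega>) \<omega>) = 1 then u n (fst (Y (\<tau>n n \<omega>) \<omega>)) else 0"
  let ?V = "\<lambda>n \<omega>. if snd (Y (\<tau>n n \<omega>) \<omega>) = 1 then G (fst (Y (\<tau>n n \<omega>) \<omega>)) else 0"
  let ?V' = "\<lambda>\<omega>. if snd (Y (\<tau> \<omega>) \<omega>) = 1 then G (fst (Y (\<tau> \<omega>) \<omega>)) else 0"
  have U: "(\<integral>\<omega>. ?U n \<omega> \<partial>Q (x, 1)) = G x" for n
  proof -
    have "(\<integral>\<omega>. ?U n \<omega> \<partial>Q (x, 1)) = u n x"
      using up_exit_expectation[OF uC2[of n] x(1) T ueig[of n]] unfolding \<tau>n_def by simp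
    then show ?thesis using uG less_imp_le[OF \<kappa>x] by simp
  qed
  have meas: "?U n \<in> borel_measurable (Q (x, 1))" "?V n \<in> borel_measurable (Q (x, 1))" "?V' \<in> borel_measurable (Q (x, 1))" for n
  proof -
    have "periodic1 (u n)" using uC2[of n] by (simp add: C2_torus_def)
    then show "?U n \<in> borel_measurable (Q (x, 1))"
      using up_value_measurable[OF _ C2_torus_continuous[OF uC2] x(1) T, of n 0 "\<kappa> n"] unfolding \<tau>n_def by simp
    show "?V n \<in> borel_measurable (Q (x, 1))" "?V' \<in> borel_measurable (Q (x, 1))"
      using up_value_measurable[OF periodic1_arc_extension cG x(1) T, of 0 "\<kappa> n"]
        up_value_measurable[OF periodic1_arc_extension cG x(1) T, of 0 0]
      unfolding \<tau>n_def \<tau>_def by simp_all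
  qed
  have start: "AE \<omega> in Q (x, 1). Y 0 \<omega> = (x, 1)" using mp xE by (simp add: markov_process_def)
  have UV: "AE \<omega> in Q (x, 1). ?U n \<omega> = ?V n \<omega>" for n
    using start AE_space
  proof eventually_elim
    case (elim \<omega>)
    then have \<omega>: "\<omega> \<in> space \<Omega>" by (simp add: law)
    have "\<kappa> n \<le> h (fst (Y (\<tau>n n \<omega>) \<omega>))"
    proof (cases "\<tau>n n \<omega> = 0")
      case True
      then show ?thesis using elim(1) \<kappa>x[of n] by simp
    next
      case False
      then have pos: "0 < \<tau>n n \<omega>" using \<tau>n0(1)[of n \<omega>] by simp
      show ?thesis
      proof (rule level_at_exit[where f = "\<lambda>t. h (fst (Y t \<omega>))", OF hpath[OF \<omega>] pos])
        fix s assume "0 \<le> s" "s < \<tau>n n \<omega>"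
        then have "Y s \<omega> \<in> region (\<kappa> n)" unfolding \<tau>n_def by (rule exit_time_before)
        then show "\<kappa> n \<le> h (fst (Y s \<omega>))" by (simp add: region_def)
      qed
    qed
    then show ?case by (simp add: uG)
  qed
  have "(\<lambda>n. \<integral>\<omega>. ?V n \<omega> \<partial>Q (x, 1)) \<longlonglongrightarrow> (\<integral>\<omega>. ?V' \<omega> \<partial>Q (x, 1))"
  proof (rule integral_dominated_convergence[where w = "\<lambda>_. C"])
    have "AE \<omega> in Q (x, 1). (\<lambda>n. if snd (Y (\<tau>n n \<omega>) \<omega>) = 1 then 1 else 0 :: real) \<longlonglongrightarrow> (if snd (Y (\<tau> \<omega>) \<omega>) = 1 then 1 else 0)"
      unfolding \<tau>n_def \<tau>_def by (rule sign_flip_not_at_exit[OF x(1) T \<kappa>dec \<kappa>0 \<kappa>lim])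
    then show "AE \<omega> in Q (x, 1). (\<lambda>n. ?V n \<omega>) \<longlonglongrightarrow> ?V' \<omega>"
      using AE_space
    proof eventually_elim
      case (elim \<omega>)
      then have \<omega>: "\<omega> \<in> space \<Omega>" by (simp add: law)
      have Gpath: "continuous_on {0..} (\<lambda>t. G (fst (Y t \<omega>)))" by (rule torus_path[OF periodic1_arc_extension cG \<omega>])
      have "continuous (at (\<tau> \<omega>) within {0..}) (\<lambda>t. G (fst (Y t \<omega>)))"
        using Gpath \<tau>0(1) by (simp add: continuous_on_eq_continuous_within)
      then have "(\<lambda>n. G (fst (Y (\<tau>n n \<omega>) \<omega>))) \<longlonglongrightarrow> G (fst (Y (\<tau> \<omega>) \<omega>))"
        by (rule continuous_within_tendsto_compose'[OF _ _ \<tau>lim[OF \<omega>]]) (simp add: \<tau>n0)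
      have if_mult: "(if p then 1 else 0) * r = (if p then r else 0)" for p and r :: real by simp
      from tendsto_mult[OF elim(1) \<open>(\<lambda>n. G _) \<longlonglongrightarrow> _\<close>] show ?case unfolding if_mult .
    qed
    fix n
    have "norm (?V n \<omega>) \<le> C" if "\<omega> \<in> space \<Omega>" for \<omega>
      using C[OF Y_torus[OF \<tau>n0(1) that]] order_trans[OF abs_ge_zero C[OF x(1)]] by simp
    then show "AE \<omega> in Q (x, 1). norm (?V n \<omega>) \<le> C" by (intro AE_I2) (simp only: law)
  qed (use meas in auto)
  moreover have "(\<integral>\<omega>. ?V n \<omega> \<partial>Q (x, 1)) = G x" for n
    using integral_cong_AE[OF meas(1,2) UV] U by metis
  ultimately show ?thesis by (simp add: LIMSEQ_const_iff)
qed

text \<open>The region is open and the path is right-continuous.\<close>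

lemma left_at_exit:
  assumes \<omega>: "\<omega> \<in> space \<Omega>" and s: "0 \<le> s" "Y s \<omega> \<notin> region 0"
  defines "t \<equiv> exit_time Y (region 0) s \<omega>"
  shows "Y t \<omega> \<notin> region 0"
proof
  assume inR: "Y t \<omega> \<in> region 0"
  have t: "t = exit_time Y (region 0) (s + 1) \<omega>"
    unfolding t_def by (rule exit_time_cap[symmetric, where Z = Y]) (use s in auto)
  have t0: "0 \<le> t" unfolding t_def by (rule exit_time_nonneg[OF s(1)])
  have ts: "t \<le> s" unfolding t_def by (rule exit_time_le)
  have "((\<lambda>s. h (fst (Y s \<omega>))) \<longlongrightarrow> h (fst (Y t \<omega>))) (at_right t)"
    using continuous_on_at_right[OF hpath[OF \<omega>] t0] by (simp add: continuous_within)
  then have "\<forall>\<^sub>F s in at_right t. 0 < h (fst (Y s \<omega>))"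
    by (rule order_tendstoD) (use inR in \<open>simp add: region_def\<close>)
  moreover have "\<forall>\<^sub>F s in at_right t. snd (Y s \<omega>) = snd (Y t \<omega>)"
    using sign_path[OF \<omega> t0] unfolding continuous_within by (rule tendsto_discrete[THEN iffD1])
  moreover have "\<forall>\<^sub>F s in at_right t. t < s" by (rule eventually_at_right_less)
  ultimately have "\<forall>\<^sub>F s in at_right t. Y s \<omega> \<in> region 0"
    by eventually_elim (use inR t0 Y_space[OF _ \<omega>] in \<open>simp add: region_def\<close>)
  then obtain e where e: "t < e" "\<And>s. t < s \<Longrightarrow> s < e \<Longrightarrow> Y s \<omega> \<in> region 0"
    unfolding eventually_at_right_field by auto
  have "exit_time Y (region 0) (s + 1) \<omega> < s + 1" "Y (exit_time Y (region 0) (s + 1) \<omega>) \<omega> \<in> region 0"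
    using ts inR unfolding t[symmetric] by simp_all
  from exit_time_outside_sequence[where Z = Y, OF this(1) _ this(2), of "e - t"] s(1) e(1)
  obtain r where "t < r" "r < e" "Y r \<omega> \<notin> region 0" unfolding t[symmetric] by auto
  then show False using e(2) by blast
qed

lemma hitting_time_greatest:
  "(\<And>r. 0 \<le> r \<Longrightarrow> Z r \<omega> \<in> B \<Longrightarrow> a \<le> ereal r) \<Longrightarrow> a \<le> hitting_time Z B \<omega>"
  unfolding hitting_time_def by (rule Inf_greatest) blast

text \<open>At the exit from the region, the path is in one of the two sets. If it is in the lower copy, the sign stays
  \<open>-1\<close> for a while, so that the other hitting time is strictly larger.\<close>

lemma hitting_order_iff:
  assumes \<omega>: "\<omega> \<in> space \<Omega>" and s: "0 \<le> s" "Y s \<omega> \<notin> region 0"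
  defines "t \<equiv> exit_time Y (region 0) s \<omega>" and "I \<equiv> {y \<in> torus. 0 < h y}"
  shows "hitting_time Y ((torus - I) \<times> {1}) \<omega> \<le> hitting_time Y (torus \<times> {-1}) \<omega> \<longleftrightarrow> snd (Y t \<omega>) = 1"
proof -
  have t0: "0 \<le> t" unfolding t_def by (rule exit_time_nonneg[OF s(1)])
  have out: "Y t \<omega> \<notin> region 0" unfolding t_def by (rule left_at_exit[OF \<omega> s])
  have before: "Y r \<omega> \<in> region 0" if "0 \<le> r" "r < t" for r
    using that unfolding t_def by (rule exit_time_before)
  have ge: "ereal t \<le> hitting_time Y B \<omega>" if "B \<inter> region 0 = {}" for B
  proof (rule hitting_time_greatest)
    fix r assume "0 \<le> r" "Y r \<omega> \<in> B"
    then have "\<not> r < t" using before[of r] that by blast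
    then show "ereal t \<le> ereal r" by simp
  qed
  have le: "hitting_time Y B \<omega> \<le> ereal t" if "Y t \<omega> \<in> B" for B
    unfolding hitting_time_def by (rule Inf_lower) (use t0 that in blast)
  have disj: "(torus - I) \<times> {1} \<inter> region 0 = {}" "torus \<times> {-1} \<inter> region 0 = {}"
    by (auto simp: region_def I_def)
  show ?thesis
  proof (cases "snd (Y t \<omega>) = 1")
    case True
    then have "\<not> 0 < h (fst (Y t \<omega>))" using out Y_space[OF t0 \<omega>] by (simp add: region_def)
    then have "Y t \<omega> \<in> (torus - I) \<times> {1}"
      using True Y_torus[OF t0 \<omega>] by (simp add: I_def mem_Times_iff)
    from order_trans[OF le[OF this] ge[OF disj(2)]] show ?thesis using True by simp
  next
    case False
    then have m: "snd (Y t \<omega>) = -1" by (rule Y_sign[OF t0 \<omega>])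
    then have 2: "hitting_time Y (torus \<times> {-1}) \<omega> \<le> ereal t"
      using Y_torus[OF t0 \<omega>] by (intro le) (simp add: mem_Times_iff)
    have "\<exists>e>0. \<forall>r. t \<le> r \<and> r < t + e \<longrightarrow> snd (Y r \<omega>) = snd (Y t \<omega>)"
      by (rule right_continuous_discrete_const[where f = "\<lambda>r. snd (Y r \<omega>)", OF sign_path[OF \<omega> t0]])
    then obtain e where e: "0 < e" "\<forall>r. t \<le> r \<and> r < t + e \<longrightarrow> snd (Y r \<omega>) = snd (Y t \<omega>)"
      by (elim exE conjE) (rule that)
    have "ereal (t + e) \<le> hitting_time Y ((torus - I) \<times> {1}) \<omega>"
    proof (rule hitting_time_greatest)
      fix r assume r: "0 \<le> r" "Y r \<omega> \<in> (torus - I) \<times> {1}"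
      have "\<not> r < t"
      proof
        assume "r < t"
        from IntI[OF r(2) before[OF r(1) this]] show False unfolding disj(1) by (rule emptyE)
      qed
      moreover have "snd (Y r \<omega>) = 1" using r(2) by (simp add: mem_Times_iff)
      moreover have "t \<le> r \<and> r < t + e \<longrightarrow> snd (Y r \<omega>) = - 1" using e(2) m by simp
      ultimately have "\<not> r < t + e" by simp
      then show "ereal (t + e) \<le> ereal r" by simp
    qed
    then have "ereal t < hitting_time Y ((torus - I) \<times> {1}) \<omega>"
      by (rule less_le_trans[rotated]) (simp add: e(1))
    with 2 have "hitting_time Y (torus \<times> {-1}) \<omega> < hitting_time Y ((torus - I) \<times> {1}) \<omega>"
      by (rule le_less_trans)
    then have "\<not> hitting_time Y ((torus - I) \<times> {1}) \<omega> \<le> hitting_time Y (torus \<times> {-1}) \<omega>"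
      by (simp only: not_le)
    then show ?thesis using False by (simp only: simp_thms)
  qed
qed

lemma hitting_order_never:
  assumes "\<And>s. 0 \<le> s \<Longrightarrow> Y s \<omega> \<in> region 0"
  shows "hitting_time Y ((torus - {y \<in> torus. 0 < h y}) \<times> {1}) \<omega> \<le> hitting_time Y (torus \<times> {-1}) \<omega>"
proof -
  have "(\<infinity> :: ereal) \<le> hitting_time Y (torus \<times> {-1}) \<omega>"
  proof (rule hitting_time_greatest)
    fix r :: real assume "0 \<le> r" "Y r \<omega> \<in> torus \<times> {-1}"
    then have False using assms[of r] by (simp add: region_def mem_Times_iff)
    then show "\<infinity> \<le> ereal r" ..
  qed
  then show ?thesis by (rule order_trans[OF ereal_less_eq(1)])
qed

text \<open>The exit time is capped at \<open>n\<close>, and \<open>n\<close> tends to infinity. By \<open>flip_rate\<close> a path stays in the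
  region up to time \<open>n\<close> with probability at most \<open>e\<^sup>-\<^sup>\<gamma>\<^sup>n\<close>, so that almost every path leaves, and at the
  exit \<open>g\<close> on the upper copy is the indicator function of the event in the definition.\<close>

lemma equilibrium_eq:
  assumes x: "x \<in> torus" "0 < h x"
  shows "equilibrium \<Omega> Q Y {y \<in> torus. 0 < h y} x = G x"
proof -
  have xE: "(x, 1) \<in> space E" using x by (simp add: space_torus2_borel)
  note law = markov_process_lawD[OF mp xE]
  interpret prob_space "Q (x, 1)" by (rule law)
  let ?I = "{y \<in> torus. 0 < h y}"
  define H where "H = {\<omega> \<in> space \<Omega>. hitting_time Y ((torus - ?I) \<times> {1}) \<omega> \<le> hitting_time Y (torus \<times> {-1}) \<omega>}"
  define \<tau> where "\<tau> n = exit_time Y (region 0) (real n)" for n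
  let ?J = "\<lambda>n \<omega>. if snd (Y (\<tau> n \<omega>) \<omega>) = 1 then 1 else 0 :: real"
  let ?V = "\<lambda>n \<omega>. if snd (Y (\<tau> n \<omega>) \<omega>) = 1 then G (fst (Y (\<tau> n \<omega>) \<omega>)) else 0"
  have \<tau>0: "0 \<le> \<tau> n \<omega>" "\<tau> n \<omega> \<le> real n" for n \<omega>
    by (simp_all add: \<tau>_def exit_time_nonneg exit_time_le)
  have cG: "continuous_on UNIV G" by (rule continuous_arc_extension[OF cd _ cg]) (simp add: bdry)
  obtain C where C: "\<And>y. y \<in> torus \<Longrightarrow> \<bar>G y\<bar> \<le> C" by (rule continuous_bounded_on_torus[OF cG]) blast
  have never_\<tau>: "\<tau> n \<omega> = real n" if "\<And>s. 0 \<le> s \<Longrightarrow> s \<le> real n \<Longrightarrow> Y s \<omega> \<in> region 0" for n \<omega>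
    using that by (intro antisym \<tau>0(2)) (auto simp: \<tau>_def intro!: exit_time_ge)
  have left: "(\<forall>\<^sub>F n in sequentially. ?J n \<omega> = indicator H \<omega>) \<and> (\<forall>\<^sub>F n in sequentially. ?V n \<omega> = indicator H \<omega>)"
    if \<omega>: "\<omega> \<in> space \<Omega>" and s: "0 \<le> s" "Y s \<omega> \<notin> region 0" for \<omega> s
  proof -
    define t where "t = exit_time Y (region 0) s \<omega>"
    have t0: "0 \<le> t" unfolding t_def by (rule exit_time_nonneg[OF s(1)])
    have \<tau>t: "\<tau> n \<omega> = t" if "nat \<lceil>s\<rceil> \<le> n" for n
      unfolding \<tau>_def t_def by (rule exit_time_cap[where Z = Y]) (use s that in linarith)+
    have H: "\<omega> \<in> H \<longleftrightarrow> snd (Y t \<omega>) = 1"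
      using hitting_order_iff[OF \<omega> s] \<omega> by (simp add: H_def t_def)
    have out: "Y t \<omega> \<notin> region 0" unfolding t_def by (rule left_at_exit[OF \<omega> s])
    have "G (fst (Y t \<omega>)) = 1" if "snd (Y t \<omega>) = 1"
    proof -
      have "h (fst (Y t \<omega>)) \<le> 0" using out that Y_space[OF t0 \<omega>] by (auto simp: region_def)
      then show ?thesis using arc_extension_outside[OF cd] bdry by simp
    qed
    then have ev: "?J n \<omega> = indicator H \<omega>" "?V n \<omega> = indicator H \<omega>" if "nat \<lceil>s\<rceil> \<le> n" for n
      using \<tau>t[OF that] H by (simp_all add: indicator_def)
    show ?thesis by (intro conjI eventually_sequentiallyI[of "nat \<lceil>s\<rceil>"] ev)
  qed
  have Jlim: "(\<lambda>n. ?J n \<omega>) \<longlonglongrightarrow> indicator H \<omega>" if \<omega>: "\<omega> \<in> space \<Omega>" for \<omega>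
  proof (cases "\<forall>s\<ge>0. Y s \<omega> \<in> region 0")
    case False
    then obtain s where s: "0 \<le> s" "Y s \<omega> \<notin> region 0" by auto
    show ?thesis by (rule tendsto_eventually[OF conjunct1[OF left[OF \<omega> s]]])
  next
    case True
    then have in_R: "Y s \<omega> \<in> region 0" if "0 \<le> s" for s using that by simp
    have "\<omega> \<in> H" using \<omega> hitting_order_never[OF in_R] by (simp add: H_def)
    moreover have "?J n \<omega> = 1" for n using in_R[OF \<tau>0(1), of n] by (simp add: region_def)
    ultimately show ?thesis by simp
  qed
  have one: "periodic1 (\<lambda>_. 1)" "continuous_on UNIV (\<lambda>_. 1 :: real)" by (simp_all add: periodic1_def)
  have Jm: "?J n \<in> borel_measurable (Q (x, 1))" for n
    using up_value_measurable[OF one x(1), of "real n" 0 0] unfolding \<tau>_def by simp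
  have Vm: "?V n \<in> borel_measurable (Q (x, 1))" for n
    using up_value_measurable[OF periodic1_arc_extension cG x(1), of "real n" 0 0] unfolding \<tau>_def by simp
  have "(\<lambda>\<omega>. indicator H \<omega> :: real) \<in> borel_measurable (Q (x, 1))"
    by (rule borel_measurable_LIMSEQ_real[OF Jlim Jm]) (simp add: law)
  then have "H \<inter> space (Q (x, 1)) \<in> sets (Q (x, 1))" by (simp only: borel_measurable_indicator_iff)
  moreover have "H \<inter> space (Q (x, 1)) = H" by (auto simp: H_def law)
  ultimately have Hs: "H \<in> sets (Q (x, 1))" by simp
  define N where "N n = {\<omega> \<in> space \<Omega>. \<forall>s\<in>{0..real n}. Y s \<omega> \<in> region 0}" for n :: nat
  have Ns: "N n \<in> sets (Q (x, 1))" for n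
    using subsetD[OF sets_natural_filtration_subset[OF mp] stays_in_region[of "real n" 0]] by (simp add: N_def law)
  have Nbound: "measure (Q (x, 1)) (N n) \<le> exp (- \<gamma> * real n)" for n
  proof -
    have le: "exp (\<gamma> * real n) * indicator (N n) \<omega> \<le> exp (\<gamma> * \<tau> n \<omega>) * ?J n \<omega>" if "\<omega> \<in> space \<Omega>" for \<omega>
    proof (cases "\<omega> \<in> N n")
      case True
      then have "\<tau> n \<omega> = real n" "snd (Y (real n) \<omega>) = 1"
        using never_\<tau>[of n \<omega>] by (auto simp: N_def region_def)
      then show ?thesis using True by simp
    qed simp
    have m: "(\<lambda>\<omega>. exp (\<gamma> * \<tau> n \<omega>) * ?J n \<omega>) \<in> borel_measurable (Q (x, 1))"
      using up_value_measurable[OF one x(1), of "real n" \<gamma> 0] unfolding \<tau>_def by simp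
    have i: "integrable (Q (x, 1)) (\<lambda>\<omega>. exp (\<gamma> * \<tau> n \<omega>) * ?J n \<omega>)"
      by (rule integrable_const_bound[OF _ m, of "exp (\<gamma> * real n)"])
        (use \<tau>0(2) \<gamma> in \<open>simp add: abs_mult\<close>)
    have iN: "integrable (Q (x, 1)) (\<lambda>\<omega>. exp (\<gamma> * real n) * indicator (N n) \<omega> :: real)"
      using Ns by (intro integrable_mult_right integrable_real_indicator) (auto simp: emeasure_eq_measure)
    have "exp (\<gamma> * real n) * measure (Q (x, 1)) (N n) = (\<integral>\<omega>. exp (\<gamma> * real n) * indicator (N n) \<omega> \<partial>Q (x, 1))"
      using sets.Int_space_eq2[OF Ns] by simp
    also have "\<dots> \<le> (\<integral>\<omega>. exp (\<gamma> * \<tau> n \<omega>) * ?J n \<omega> \<partial>Q (x, 1))"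
      by (intro integral_mono i iN) (use le law in auto)
    also have "\<dots> = 1" unfolding \<tau>_def by (rule flip_rate[OF x(1)]) simp
    finally show ?thesis by (simp add: exp_minus field_simps)
  qed
  have "(\<Inter>n. N n) \<in> null_sets (Q (x, 1))"
  proof -
    have "measure (Q (x, 1)) (\<Inter>n. N n) \<le> exp (- \<gamma> * real n)" for n
      by (rule order_trans[OF _ Nbound]) (intro finite_measure_mono Ns INT_lower UNIV_I)
    moreover have "(\<lambda>n. exp (- \<gamma> * real n)) \<longlonglongrightarrow> 0"
      unfolding exp_of_nat2_mult using \<gamma> by (intro LIMSEQ_realpow_zero) auto
    ultimately have "measure (Q (x, 1)) (\<Inter>n. N n) \<le> 0"
      by (intro LIMSEQ_le_const) auto
    then have "measure (Q (x, 1)) (\<Inter>n. N n) = 0" by (simp add: measure_le_0_iff)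
    then show ?thesis using Ns by (intro null_setsI) (auto simp: emeasure_eq_measure)
  qed
  then have leaves: "AE \<omega> in Q (x, 1). \<omega> \<notin> (\<Inter>n. N n)" by (rule AE_not_in)
  have "(\<lambda>n. \<integral>\<omega>. ?V n \<omega> \<partial>Q (x, 1)) \<longlonglongrightarrow> (\<integral>\<omega>. indicator H \<omega> \<partial>Q (x, 1))"
  proof (rule integral_dominated_convergence[where w = "\<lambda>_. C"])
    show "(\<lambda>\<omega>. indicator H \<omega> :: real) \<in> borel_measurable (Q (x, 1))" using Hs by simp
    show "AE \<omega> in Q (x, 1). (\<lambda>n. ?V n \<omega>) \<longlonglongrightarrow> indicator H \<omega>"
      using leaves AE_space
    proof eventually_elim
      case (elim \<omega>)
      then have \<omega>: "\<omega> \<in> space \<Omega>" by (simp add: law)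
      then obtain s where s: "0 \<le> s" "Y s \<omega> \<notin> region 0" using elim(1) by (auto simp: N_def)
      show ?case by (rule tendsto_eventually[OF conjunct2[OF left[OF \<omega> s]]])
    qed
    fix n
    have "norm (?V n \<omega>) \<le> C" if "\<omega> \<in> space \<Omega>" for \<omega>
      using C[OF Y_torus[OF \<tau>0(1) that]] order_trans[OF abs_ge_zero C[OF x(1)]] by simp
    then show "AE \<omega> in Q (x, 1). norm (?V n \<omega>) \<le> C" by (intro AE_I2) (simp only: law)
  qed (use Vm in auto)
  moreover have "(\<integral>\<omega>. ?V n \<omega> \<partial>Q (x, 1)) = G x" for n
    unfolding \<tau>_def by (rule up_exit_value[OF x]) simp
  ultimately have "(\<integral>\<omega>. indicator H \<omega> \<partial>Q (x, 1)) = G x" by (simp add: LIMSEQ_const_iff)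
  then have "measure (Q (x, 1)) H = G x" using sets.Int_space_eq2[OF Hs] by simp
  moreover have "frac x = x" using x(1) by (simp add: torus_def frac_eq)
  ultimately show ?thesis by (simp add: equilibrium_def H_def)
qed

end

section \<open>The estimate\<close>

lemma long_arc_covers:
  assumes "c + 1 < d" "y \<in> torus"
  shows "y \<in> frac ` {c<..<d}"
proof -
  define k where "k = \<lfloor>c - y\<rfloor> + 1"
  have "c - y < of_int k" "of_int k \<le> c - y + 1" unfolding k_def by linarith+
  moreover have "frac (y + of_int k) = y" using assms(2) by (simp add: torus_def frac_unique_iff)
  ultimately show ?thesis using assms(1) by (intro image_eqI[of _ _ "y + of_int k"]) auto
qed

lemma capacity_nonneg:
  assumes "0 \<le> \<epsilon>" "0 \<le> \<gamma>"
  shows "0 \<le> capacity b \<epsilon> \<gamma> \<Omega> Q Y I"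
  unfolding capacity_def set_lebesgue_integral_def
  by (intro add_nonneg_nonneg mult_nonneg_nonneg integral_nonneg) (use assms in auto)

lemma deriv_periodic1:
  assumes "periodic1 f"
  shows "periodic1 (deriv f)"
proof -
  have "(f has_real_derivative D) (at (x + 1)) \<longleftrightarrow> (f has_real_derivative D) (at x)" for x D
    using assms DERIV_shift[of f D x 1] by (simp add: periodic1_def)
  then show ?thesis by (simp add: periodic1_def deriv_def)
qed

text \<open>The equilibrium function is \<open>g\<close> on the arc, so this is the energy identity.\<close>

lemma (in enlarged_arc) capacity_eq_mass:
  fixes I
  assumes cont: "continuous_on UNIV b" and cg': "continuous_on {c..d} g'"
  defines "I \<equiv> {y \<in> torus. 0 < h y}"
  shows "2 * capacity b \<epsilon> \<gamma> \<Omega> Q Y I = \<gamma> * (LINT y:I|mu_eps b \<epsilon>. G y)"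
    and "set_integrable (mu_eps b \<epsilon>) I G"
proof -
  obtain J where dm: "\<And>x. (m_eps b \<epsilon> has_real_derivative (b x * m_eps b \<epsilon> x - J) / \<epsilon>) (at x)"
    and mpos: "\<And>x. 0 < m_eps b \<epsilon> x" and mper: "periodic1 (m_eps b \<epsilon>)"
    by (rule stationary_density[OF per cont \<epsilon>]) blast
  have mc: "continuous_on UNIV (m_eps b \<epsilon>)"
    using dm by (intro DERIV_continuous_on) (auto intro: has_field_derivative_at_within)
  have I: "I = frac ` {c<..<d}" unfolding I_def by (rule arc_eq_height_pos[OF cd, symmetric])
  let ?f = "equilibrium \<Omega> Q Y I" and ?K = "exp (barrier b / \<epsilon>)"
  have fper: "periodic1 ?f" by (simp add: periodic1_def equilibrium_def frac_1_eq)
  have Gg: "G x = g x" if "x \<in> {c<..<d}" for x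
    using arc_extension_on_arc[OF cd(2), of x 0 g] that by simp
  have fg: "?f x = g x" if x: "x \<in> {c<..<d}" for x
  proof -
    have "frac x \<in> I" using x by (simp add: I)
    then have "?f (frac x) = G (frac x)" unfolding I_def by (intro equilibrium_eq) auto
    then show ?thesis using Gg[OF x] by (simp add: periodic1_frac[OF fper] periodic1_frac[OF periodic1_arc_extension])
  qed
  have df: "deriv ?f x = g' x" if x: "x \<in> {c<..<d}" for x
    by (rule DERIV_imp_deriv, rule has_field_derivative_transform_within_open[OF dg[OF x] open_greaterThanLessThan x])
      (simp add: fg)
  note arc = stationary_arc_integral[OF mc mpos mper cd, folded I]
  have 1: "(LINT x:I|mu_eps b \<epsilon>. (deriv ?f x)\<^sup>2) = integral {c..d} (\<lambda>x. m_eps b \<epsilon> x * (g' x)\<^sup>2)"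
    by (rule arc(2)) (use deriv_periodic1[OF fper] in \<open>auto simp: periodic1_def df intro!: continuous_intros cg'\<close>)
  have 2: "(LINT x:I|mu_eps b \<epsilon>. (?f x)\<^sup>2) = integral {c..d} (\<lambda>x. m_eps b \<epsilon> x * (g x)\<^sup>2)"
    by (rule arc(2)) (use fper in \<open>auto simp: periodic1_def fg intro!: continuous_intros cg\<close>)
  have 3: "(LINT x:I|mu_eps b \<epsilon>. G x) = integral {c..d} (\<lambda>x. m_eps b \<epsilon> x * g x)"
    by (rule arc(2)[OF periodic1_arc_extension cg Gg])
  show "set_integrable (mu_eps b \<epsilon>) I G"
    by (rule arc(1)[OF periodic1_arc_extension cg Gg])
  have "\<epsilon> * ?K * integral {c..d} (\<lambda>x. m_eps b \<epsilon> x * (g' x)\<^sup>2) + \<gamma> * integral {c..d} (\<lambda>x. m_eps b \<epsilon> x * (g x)\<^sup>2)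
      = \<gamma> * integral {c..d} (\<lambda>x. m_eps b \<epsilon> x * g x)"
    by (rule energy_identity[OF cd(1) exp_gt_zero \<epsilon> cg cg' continuous_on_subset[OF mc] bdry dg dg' dm]) auto
  then show "2 * capacity b \<epsilon> \<gamma> \<Omega> Q Y I = \<gamma> * (LINT y:I|mu_eps b \<epsilon>. G y)"
    unfolding capacity_def 1 2 3 by (simp add: algebra_simps)
qed

lemma stationary_arc_mass_pos:
  assumes per: "periodic1 b" and cont: "continuous_on UNIV b" and \<epsilon>: "0 < \<epsilon>" and cd: "c < d" "d \<le> c + 1"
  shows "0 < measure (mu_eps b \<epsilon>) (frac ` {c<..<d})"
    and "set_integrable (mu_eps b \<epsilon>) (frac ` {c<..<d}) (\<lambda>_. r :: real)"
    and "(LINT y:frac ` {c<..<d}|mu_eps b \<epsilon>. r) = r * measure (mu_eps b \<epsilon>) (frac ` {c<..<d})"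
proof -
  obtain J where dm: "\<And>x. (m_eps b \<epsilon> has_real_derivative (b x * m_eps b \<epsilon> x - J) / \<epsilon>) (at x)"
    and mpos: "\<And>x. 0 < m_eps b \<epsilon> x" and mper: "periodic1 (m_eps b \<epsilon>)"
    by (rule stationary_density[OF per cont \<epsilon>]) blast
  have mc: "continuous_on UNIV (m_eps b \<epsilon>)"
    using dm by (intro DERIV_continuous_on) (auto intro: has_field_derivative_at_within)
  let ?J = "frac ` {c<..<d}" and ?\<mu> = "mu_eps b \<epsilon>"
  have const: "periodic1 (\<lambda>_. r :: real)" "continuous_on {c..d} (\<lambda>_. r :: real)" for r
    by (simp_all add: periodic1_def)
  note arc = stationary_arc_integral[OF mc mpos mper cd const refl]
  show "set_integrable ?\<mu> ?J (\<lambda>_. r)" by (rule arc(1))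
  have "?J \<inter> torus = ?J" by (auto simp: torus_def frac_lt_1)
  moreover have "?J \<in> sets borel" by (rule arc_measurable[OF cd])
  ultimately have Js: "?J \<in> sets ?\<mu>" "space ?\<mu> = torus"
    by (auto simp: mu_eps_def sets_restrict_space image_iff space_restrict_space intro!: bexI[of _ ?J])
  have m1: "(LINT y:?J|?\<mu>. 1) = measure ?\<mu> ?J"
    using sets.Int_space_eq2[OF Js(1)] by (simp add: set_lebesgue_integral_def)
  show "(LINT y:?J|?\<mu>. r) = r * measure ?\<mu> ?J"
    unfolding m1[symmetric] by (simp add: set_lebesgue_integral_def mult.commute)
  have mcd: "continuous_on {c..d} (\<lambda>x. m_eps b \<epsilon> x * 1)" by (intro continuous_intros continuous_on_subset[OF mc]) auto
  have "integral {c..d} (\<lambda>x. m_eps b \<epsilon> x * 1) \<noteq> 0"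
    using integral_eq_0_iff[OF mcd cd(1)] mpos[of c] less_imp_le[OF mpos] cd(1) by force
  moreover have "0 \<le> integral {c..d} (\<lambda>x. m_eps b \<epsilon> x * 1)"
    by (intro integral_nonneg integrable_continuous_interval mcd) (simp add: less_imp_le[OF mpos])
  ultimately show "0 < measure ?\<mu> ?J" unfolding m1[symmetric] arc(2) by simp
qed

theorem proposition8p1:
  fixes b :: "real \<Rightarrow> real" and \<epsilon> A \<mm> \<eta> \<theta> :: real and I :: "real set"
    and \<Omega> :: "'w measure" and P :: "real \<Rightarrow> 'w measure" and X :: "real \<Rightarrow> 'w \<Rightarrow> real"
    and \<Omega>' :: "'v measure" and Q :: "real \<times> int \<Rightarrow> 'v measure"
    and Y :: "real \<Rightarrow> 'v \<Rightarrow> real \<times> int"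
  assumes "admissible_drift b"
    and "\<epsilon> > 0"
    and "torus_diffusion b \<epsilon> \<Omega> P X"
    and "A > 0"
    and "enlarged_process b \<epsilon> (1 / A) \<Omega>' Q Y"
    and "open_interval_torus I"
    and "\<theta> \<in> I"
    and "\<mm> \<in> I"
    and "\<eta> > 0"
    and "frac ` {\<mm> - \<eta><..<\<mm> + \<eta>} \<subseteq> I"
  shows "measure (P \<theta>) {\<omega>\<in>space \<Omega>. hitting_time X (torus - I) \<omega> \<le> ereal A}
    \<le> (SUP \<theta>'\<in>{\<mm> - \<eta>..\<mm> + \<eta>}.
          measure (P \<theta>)
            {\<omega>\<in>space \<Omega>. hitting_time X (torus - I) \<omega> < hitting_time X {frac \<theta>'} \<omega>})
      + 2 * exp 1 * A / measure (mu_eps b \<epsilon>) (frac ` {\<mm> - \<eta><..<\<mm> + \<eta>})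
          * capacity b \<epsilon> (1 / A) \<Omega>' Q Y I"
    (is "?lhs \<le> ?sup + 2 * exp 1 * A / ?mass * ?cap")
proof -
  have per: "periodic1 b" and cont: "continuous_on UNIV b"
    using assms(1) by (auto simp: admissible_drift_def)
  obtain c d where cd: "c < d" and I: "I = frac ` {c<..<d}"
    using assms(6) by (auto simp: open_interval_torus_def)
  have Isub: "I \<subseteq> torus" by (auto simp: I torus_def frac_lt_1)
  have \<theta>: "\<theta> \<in> torus" using assms(7) Isub by auto
  have mp: "markov_process torus_borel \<Omega> P X" using assms(3) by (simp add: torus_diffusion_def)
  have \<theta>E: "\<theta> \<in> space torus_borel" using \<theta> by (simp add: space_torus_borel)
  interpret prob_space "P \<theta>" by (rule markov_process_lawD[OF mp \<theta>E])
  let ?q = "\<lambda>y. measure (P \<theta>) {\<omega>\<in>space \<Omega>. hitting_time X (torus - I) \<omega> < hitting_time X {frac y} \<omega>}"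
  have bdd: "bdd_above (?q ` {\<mm> - \<eta>..\<mm> + \<eta>})" by (intro bdd_aboveI2[of _ _ 1]) simp
  have sup_ge: "?q y \<le> ?sup" if "y \<in> {\<mm> - \<eta>..\<mm> + \<eta>}" for y by (rule cSUP_upper[OF that bdd])
  have cap0: "0 \<le> ?cap" by (rule capacity_nonneg) (use assms in auto)
  show ?thesis
  proof (cases "d \<le> c + 1")
    case False
    \<comment> \<open>The arc is the whole torus, and its complement is never hit.\<close>
    then have empty: "torus - I = {}" using long_arc_covers[of c d] by (auto simp: I)
    have "hitting_time X (torus - I) \<omega> = \<infinity>" for \<omega> unfolding empty by (simp add: hitting_time_def top_ereal_def)
    then have "?lhs = 0" by simp
    moreover have "0 \<le> ?sup" using sup_ge[of \<mm>] assms(9) by (intro order_trans[OF measure_nonneg]) auto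
    moreover have "0 \<le> 2 * exp 1 * A / ?mass * ?cap"
      using assms(4) cap0 by (intro mult_nonneg_nonneg divide_nonneg_nonneg) auto
    ultimately show ?thesis by simp
  next
    case True
    note cd = cd True
    define K where "K = exp (barrier b / \<epsilon>)"
    have drift: "continuous_on {c..d} (\<lambda>x. b x / \<epsilon>)"
      using assms(2) by (intro continuous_intros continuous_on_subset[OF cont]) auto
    have rate: "0 \<le> 1 / A / (K * \<epsilon>)" using assms by (simp add: K_def)
    obtain g g' where cg: "continuous_on {c..d} g" and cg': "continuous_on {c..d} g'"
      and bdry: "g c = 1" "g d = 1"
      and dg: "\<And>x. x \<in> {c<..<d} \<Longrightarrow> (g has_real_derivative g' x) (at x)"
      and dg': "\<And>x. x \<in> {c<..<d} \<Longrightarrow> (g' has_real_derivative 1 / A / (K * \<epsilon>) * g x - b x / \<epsilon> * g' x) (at x)"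
      by (rule linear_boundary_value_problem[OF cd(1) drift rate]) blast
    have C2: "C2_on_open {c<..<d} g"
    proof (rule C2_on_openI[OF open_greaterThanLessThan dg dg'])
      have sub: "{c<..<d} \<subseteq> {c..d}" by auto
      show "continuous_on {c<..<d} (\<lambda>x. 1 / A / (K * \<epsilon>) * g x - b x / \<epsilon> * g' x)"
        using assms(2) by (intro continuous_intros continuous_on_subset[OF cg sub] continuous_on_subset[OF cg' sub]
            continuous_on_subset[OF cont]) auto
    qed
    interpret enlarged_arc b \<epsilon> "1 / A" c d \<Omega>' Q Y g g'
      by unfold_locales (use assms per cd cg bdry C2 dg dg' in \<open>simp_all add: K_def\<close>)
    have IH: "I = {y \<in> torus. 0 < h y}" unfolding I by (rule arc_eq_height_pos[OF cd])
    \<comment> \<open>On the arc, \<open>g\<close> is a probability.\<close>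
    have G0: "0 \<le> G y" if y: "y \<in> torus" for y
    proof (cases "0 < h y")
      case True
      have "G y = equilibrium \<Omega>' Q Y {y \<in> torus. 0 < h y} y" by (rule equilibrium_eq[OF y True, symmetric])
      then show ?thesis by (simp add: equilibrium_def)
    next
      case False
      then show ?thesis using arc_extension_outside[OF cd, of g y] bdry by simp
    qed
    have \<theta>h: "0 < h \<theta>" using assms(7) by (simp add: IH)
    let ?J = "frac ` {\<mm> - \<eta><..<\<mm> + \<eta>}"
    \<comment> \<open>A window longer than the torus would contain an end-point of the arc.\<close>
    have short: "\<mm> + \<eta> \<le> \<mm> - \<eta> + 1"
    proof (rule ccontr)
      assume "\<not> \<mm> + \<eta> \<le> \<mm> - \<eta> + 1"
      then have "frac c \<in> ?J" by (intro long_arc_covers) (auto simp: torus_def frac_lt_1)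
      then have "0 < h (frac c)" using assms(10) by (auto simp: IH)
      then have "0 < h c" by (simp add: periodic1_frac[OF periodic1_arc_height])
      then show False using arc_height_pos_iff_fundamental[OF cd, of c] by simp
    qed
    have J: "\<mm> - \<eta> < \<mm> + \<eta>" using assms(9) by simp
    note mass = stationary_arc_mass_pos[OF per cont assms(2) J short]
    have point: "?lhs - ?sup \<le> exp 1 * G y" if y: "y \<in> ?J" for y
    proof -
      obtain z where z: "z \<in> {\<mm> - \<eta><..<\<mm> + \<eta>}" "y = frac z" using y by auto
      have yI: "y \<in> torus" "0 < h y" using y assms(10) by (auto simp: IH)
      have "?lhs \<le> measure (P \<theta>) {\<omega>\<in>space \<Omega>. hitting_time X (torus - I) \<omega> < hitting_time X {y} \<omega>} + exp 1 * G y"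
        unfolding IH
        by (rule hitting_comparison[OF assms(3) per assms(2,4) cd cg bdry C2 dg dg'[unfolded K_def] G0 \<theta> \<theta>h yI])
      also have "measure (P \<theta>) {\<omega>\<in>space \<Omega>. hitting_time X (torus - I) \<omega> < hitting_time X {y} \<omega>} \<le> ?sup"
        using sup_ge[of z] z by simp
      finally show ?thesis by simp
    qed
    have capI: "2 * ?cap = 1 / A * (LINT y:I|mu_eps b \<epsilon>. G y)" "set_integrable (mu_eps b \<epsilon>) I G"
      unfolding IH by (rule capacity_eq_mass[OF cont cg'])+
    have "(?lhs - ?sup) * ?mass = (LINT y:?J|mu_eps b \<epsilon>. ?lhs - ?sup)" by (rule mass(3)[symmetric])
    also have "\<dots> \<le> (LINT y:I|mu_eps b \<epsilon>. exp 1 * G y)"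
      unfolding set_lebesgue_integral_def
    proof (rule integral_mono)
      show "integrable (mu_eps b \<epsilon>) (\<lambda>y. indicator ?J y *\<^sub>R (?lhs - ?sup))"
        using mass(2) by (simp only: set_integrable_def)
      show "integrable (mu_eps b \<epsilon>) (\<lambda>y. indicator I y *\<^sub>R (exp 1 * G y))"
        using set_integrable_mult_right[of "exp 1", OF capI(2)] by (simp only: set_integrable_def)
      fix y
      show "indicator ?J y *\<^sub>R (?lhs - ?sup) \<le> indicator I y *\<^sub>R (exp 1 * G y)"
        using point[of y] G0[of y] assms(10) Isub by (auto simp: indicator_def)
    qed
    also have "\<dots> = exp 1 * (2 * A * ?cap)" using capI(1) assms(4) by (simp add: field_simps)
    finally have "?lhs - ?sup \<le> exp 1 * (2 * A * ?cap) / ?mass" using mass(1) by (simp add: field_simps)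
    then show ?thesis by (simp add: field_simps)
  qed
qed

end
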